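(* Let $\Gamma=kQ_\Gamma/I_\Gamma$ be a bound quiver algebra and let $(M,\theta)$ be a multiplicative $\Gamma$-bimodule. Then the split extension algebra $E=\Gamma\ltimes_\theta M$ is isomorphic to a bound quiver algebra whose underlying quiver has the same number of vertices as $Q_\Gamma$ if and only if $(M,\theta)$ is nilpotent. Furthermore, in that case $\Gamma$ is an arrow pre-removal algebra of $E$.
   Context: A bound quiver algebra $kQ/I$ consists of a field $k$, a finite quiver $Q$ and an admissible ideal $I$ of $kQ$ (every path occurring in an element of $I$ has length at least $2$, and $I$ contains all paths of length $N$ for some $N>1$). A multiplicative $\Gamma$-bimodule is a pair $(M,\theta)$ with $M$ a non-zero $\Gamma$-bimodule on which $k$ acts centrally with $\dim_kM<\infty$ (standing convention), and $\theta:M\otimes_\Gamma M\to M$ an associative $\Gamma$-bimodule homomorphism ($\theta(\theta\otimes1_M)=\theta(1_M\otimes\theta)$). The split extension $\Gamma\ltimes_\theta M$ is $\Gamma\oplus M$ with multiplication $(\gamma_1,m_1)(\gamma_2,m_2)=(\gamma_1\gamma_2,\gamma_1m_2+m_1\gamma_2+\theta(m_1\otimes m_2))$. $(M,\theta)$ is nilpotent if $\theta^N=0$ for some $N\ge1$, where $\theta^0=\mathrm{id}_M$ and $\theta^r=\theta\circ(\theta^{r-1}\otimes1_M):M^{\otimes_\Gamma(r+1)}\to M$. For a bound quiver algebra $kQ/I$ and a set $A$ of arrows, every $z\in kQ$ is uniquely $z=z_A+z_{\mathrm{not}A}$, where $z_A$ is a linear combination of paths passing through at least one arrow of $A$ and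 $z_{\mathrm{not}A}$ one of paths avoiding $A$; $A$ is pre-removable in $kQ/I$ if $z_A,z_{\mathrm{not}A}\in I$ for all $z\in I$. For finite dimensional $k$-algebras $\Gamma,\Lambda$, $\Gamma$ is an arrow pre-removal algebra of $\Lambda$ if there are a bound quiver algebra $kQ_\Lambda/I_\Lambda\cong\Lambda$ and a pre-removable set of arrows $A$ in it such that $\Gamma$ is isomorphic to the quotient of $kQ_\Lambda/I_\Lambda$ by the ideal generated by $A$. *)

theory Defs
  imports
    "HOL-Algebra.QuotRing"
    "HOL-Algebra.Free_Abelian_Groups"
    "Jordan_Normal_Form.Missing_VectorSpace"
    "Graph_Theory.Arc_Walk"
begin

section \<open>Algebras over a field\<close>

text \<open>
  The library locale \<^locale>\<open>algebra\<close> is restricted to commutative algebras.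
\<close>

definition assoc_algebra :: "('k, 'c) ring_scheme \<Rightarrow> ('k, 'a, 'd) module_scheme \<Rightarrow> bool" where
  "assoc_algebra K A \<longleftrightarrow> vectorspace K A \<and> ring A \<and>
     (\<forall>a\<in>carrier K. \<forall>x\<in>carrier A. \<forall>y\<in>carrier A.
        (a \<odot>\<^bsub>A\<^esub> x) \<otimes>\<^bsub>A\<^esub> y = a \<odot>\<^bsub>A\<^esub> (x \<otimes>\<^bsub>A\<^esub> y) \<and>
        x \<otimes>\<^bsub>A\<^esub> (a \<odot>\<^bsub>A\<^esub> y) = a \<odot>\<^bsub>A\<^esub> (x \<otimes>\<^bsub>A\<^esub> y))"

definition fin_dim_algebra :: "('k, 'c) ring_scheme \<Rightarrow> ('k, 'a, 'd) module_scheme \<Rightarrow> bool" where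
  "fin_dim_algebra K A \<longleftrightarrow> assoc_algebra K A \<and> vectorspace.fin_dim K A"

definition alg_isomorphic ::
  "('k, 'c) ring_scheme \<Rightarrow> ('k, 'a, 'd) module_scheme \<Rightarrow> ('k, 'b, 'e) module_scheme \<Rightarrow> bool" where
  "alg_isomorphic K A B \<longleftrightarrow>
     (\<exists>h\<in>ring_iso A B. \<forall>a\<in>carrier K. \<forall>x\<in>carrier A. h (a \<odot>\<^bsub>A\<^esub> x) = a \<odot>\<^bsub>B\<^esub> h x)"

text \<open>
  The quotient ring \<open>A Quot I\<close>, equipped with the induced scalar multiplication. All the cosets
  in the union below coincide, since a two-sided ideal of a unital algebra is a subspace.
\<close>

definition quot_algebra :: "('k, 'a, 'd) module_scheme \<Rightarrow> 'a set \<Rightarrow> ('k, 'a set) module" where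
  "quot_algebra A I =
     \<lparr>carrier = carrier (A Quot I), monoid.mult = monoid.mult (A Quot I),
      monoid.one = monoid.one (A Quot I),
      ring.zero = ring.zero (A Quot I), ring.add = ring.add (A Quot I),
      smult = (\<lambda>a X. \<Union>x\<in>X. I +>\<^bsub>A\<^esub> (a \<odot>\<^bsub>A\<^esub> x))\<rparr>"


section \<open>Path algebras and bound quiver algebras\<close>

text \<open>
  A quiver is a directed multigraph (loops allowed). A path is a pair of its starting vertex and
  the list of its arrows, in order of traversal; the trivial path at \<open>u\<close> is \<open>(u, [])\<close>. The product
  of two paths in the path algebra is the first one followed by the second one.
\<close>

definition is_path :: "('v, 'e) pre_digraph \<Rightarrow> 'v \<times> 'e list \<Rightarrow> bool" where
  "is_path Q p \<longleftrightarrow> (\<exists>w. pre_digraph.awalk Q (fst p) (snd p) w)"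

text \<open>
  Elements of \<open>kQ\<close> are the finitely supported coefficient functions on the set of paths; the
  product sums over all ways of splitting a path into an initial and a final part.
\<close>

definition path_algebra ::
  "('k, 'c) ring_scheme \<Rightarrow> ('v, 'e) pre_digraph \<Rightarrow> ('k, 'v \<times> 'e list \<Rightarrow> 'k) module" where
  "path_algebra K Q =
     \<lparr>carrier = {f. range f \<subseteq> carrier K \<and> finite {p. f p \<noteq> \<zero>\<^bsub>K\<^esub>} \<and>
                   (\<forall>p. f p \<noteq> \<zero>\<^bsub>K\<^esub> \<longrightarrow> is_path Q p)},
      monoid.mult = (\<lambda>f g (u, es).
        \<Oplus>\<^bsub>K\<^esub>i\<in>{..length es}.
          f (u, take i es) \<otimes>\<^bsub>K\<^esub> g (pre_digraph.awlast Q u (take i es), drop i es)),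
      monoid.one = (\<lambda>(u, es). if u \<in> verts Q \<and> es = [] then \<one>\<^bsub>K\<^esub> else \<zero>\<^bsub>K\<^esub>),
      ring.zero = (\<lambda>_. \<zero>\<^bsub>K\<^esub>),
      ring.add = (\<lambda>f g p. f p \<oplus>\<^bsub>K\<^esub> g p),
      smult = (\<lambda>a f p. a \<otimes>\<^bsub>K\<^esub> f p)\<rparr>"

definition path_elt :: "('k, 'c) ring_scheme \<Rightarrow> 'v \<times> 'e list \<Rightarrow> 'v \<times> 'e list \<Rightarrow> 'k" where
  "path_elt K p = (\<lambda>q. if q = p then \<one>\<^bsub>K\<^esub> else \<zero>\<^bsub>K\<^esub>)"

definition admissible ::
  "('k, 'c) ring_scheme \<Rightarrow> ('v, 'e) pre_digraph \<Rightarrow> ('v \<times> 'e list \<Rightarrow> 'k) set \<Rightarrow> bool" where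
  "admissible K Q I \<longleftrightarrow>
     (\<forall>z\<in>I. \<forall>p. z p \<noteq> \<zero>\<^bsub>K\<^esub> \<longrightarrow> 2 \<le> length (snd p)) \<and>
     (\<exists>N>1. \<forall>p. is_path Q p \<and> length (snd p) = N \<longrightarrow> path_elt K p \<in> I)"

definition bound_quiver ::
  "('k, 'c) ring_scheme \<Rightarrow> ('v, 'e) pre_digraph \<Rightarrow> ('v \<times> 'e list \<Rightarrow> 'k) set \<Rightarrow> bool" where
  "bound_quiver K Q I \<longleftrightarrow>
     field K \<and> fin_digraph Q \<and> ideal I (path_algebra K Q) \<and> admissible K Q I"

definition bound_quiver_algebra ::
  "('k, 'c) ring_scheme \<Rightarrow> ('v, 'e) pre_digraph \<Rightarrow> ('v \<times> 'e list \<Rightarrow> 'k) set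
     \<Rightarrow> ('k, ('v \<times> 'e list \<Rightarrow> 'k) set) module" where
  "bound_quiver_algebra K Q I = quot_algebra (path_algebra K Q) I"


section \<open>Arrow pre-removal\<close>

definition part_through ::
  "('k, 'c) ring_scheme \<Rightarrow> 'e set \<Rightarrow> ('v \<times> 'e list \<Rightarrow> 'k) \<Rightarrow> 'v \<times> 'e list \<Rightarrow> 'k" where
  "part_through K A z = (\<lambda>p. if set (snd p) \<inter> A \<noteq> {} then z p else \<zero>\<^bsub>K\<^esub>)"

definition part_avoiding ::
  "('k, 'c) ring_scheme \<Rightarrow> 'e set \<Rightarrow> ('v \<times> 'e list \<Rightarrow> 'k) \<Rightarrow> 'v \<times> 'e list \<Rightarrow> 'k" where
  "part_avoiding K A z = (\<lambda>p. if set (snd p) \<inter> A = {} then z p else \<zero>\<^bsub>K\<^esub>)"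

definition pre_removable ::
  "('k, 'c) ring_scheme \<Rightarrow> ('v, 'e) pre_digraph \<Rightarrow> ('v \<times> 'e list \<Rightarrow> 'k) set \<Rightarrow> 'e set \<Rightarrow> bool" where
  "pre_removable K Q I A \<longleftrightarrow>
     A \<subseteq> arcs Q \<and> (\<forall>z\<in>I. part_through K A z \<in> I \<and> part_avoiding K A z \<in> I)"

definition arrow_ideal ::
  "('k, 'c) ring_scheme \<Rightarrow> ('v, 'e) pre_digraph \<Rightarrow> ('v \<times> 'e list \<Rightarrow> 'k) set \<Rightarrow> 'e set
     \<Rightarrow> ('v \<times> 'e list \<Rightarrow> 'k) set set" where
  "arrow_ideal K Q I A =
     Idl\<^bsub>bound_quiver_algebra K Q I\<^esub>
       ((\<lambda>a. I +>\<^bsub>path_algebra K Q\<^esub> path_elt K (tail Q a, [a])) ` A)"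

text \<open>
  Every finite quiver is isomorphic to one whose vertices and arrows are natural numbers, so
  quantifying over quivers of the type below loses no generality.
\<close>

type_synonym nat_quiver = "(nat, nat) pre_digraph"

definition arrow_pre_removal_algebra ::
  "('k, 'c) ring_scheme \<Rightarrow> ('k, 'g, 'd) module_scheme \<Rightarrow> ('k, 'l, 'e) module_scheme \<Rightarrow> bool" where
  "arrow_pre_removal_algebra K \<Gamma> \<Lambda> \<longleftrightarrow>
     fin_dim_algebra K \<Gamma> \<and> fin_dim_algebra K \<Lambda> \<and>
     (\<exists>(Q :: nat_quiver) I A.
        bound_quiver K Q I \<and>
        alg_isomorphic K (bound_quiver_algebra K Q I) \<Lambda> \<and>
        pre_removable K Q I A \<and>
        alg_isomorphic K \<Gamma> (quot_algebra (bound_quiver_algebra K Q I) (arrow_ideal K Q I A)))"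


section \<open>Bimodules\<close>

text \<open>
  A bimodule uses the additive part of the record, \<open>smult\<close> for the left action and \<open>rsmult\<close> for
  the right action; the inherited ring fields \<open>mult\<close> and \<open>one\<close> play no role.
\<close>

record ('g, 'm) bimodule = "('g, 'm) module" +
  rsmult :: "'m \<Rightarrow> 'g \<Rightarrow> 'm"  (infixl \<open>\<odot>\<^sub>r\<index>\<close> 70)

definition is_bimodule :: "('g, 'c) ring_scheme \<Rightarrow> ('g, 'm, 'd) bimodule_scheme \<Rightarrow> bool" where
  "is_bimodule \<Gamma> M \<longleftrightarrow> ring \<Gamma> \<and> abelian_group M \<and>
     (\<forall>g\<in>carrier \<Gamma>. \<forall>x\<in>carrier M. g \<odot>\<^bsub>M\<^esub> x \<in> carrier M \<and> x \<odot>\<^sub>r\<^bsub>M\<^esub> g \<in> carrier M) \<and>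
     (\<forall>g\<in>carrier \<Gamma>. \<forall>x\<in>carrier M. \<forall>y\<in>carrier M.
        g \<odot>\<^bsub>M\<^esub> (x \<oplus>\<^bsub>M\<^esub> y) = g \<odot>\<^bsub>M\<^esub> x \<oplus>\<^bsub>M\<^esub> g \<odot>\<^bsub>M\<^esub> y \<and>
        (x \<oplus>\<^bsub>M\<^esub> y) \<odot>\<^sub>r\<^bsub>M\<^esub> g = x \<odot>\<^sub>r\<^bsub>M\<^esub> g \<oplus>\<^bsub>M\<^esub> y \<odot>\<^sub>r\<^bsub>M\<^esub> g) \<and>
     (\<forall>g\<in>carrier \<Gamma>. \<forall>h\<in>carrier \<Gamma>. \<forall>x\<in>carrier M.
        (g \<oplus>\<^bsub>\<Gamma>\<^esub> h) \<odot>\<^bsub>M\<^esub> x = g \<odot>\<^bsub>M\<^esub> x \<oplus>\<^bsub>M\<^esub> h \<odot>\<^bsub>M\<^esub> x \<and>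
        x \<odot>\<^sub>r\<^bsub>M\<^esub> (g \<oplus>\<^bsub>\<Gamma>\<^esub> h) = x \<odot>\<^sub>r\<^bsub>M\<^esub> g \<oplus>\<^bsub>M\<^esub> x \<odot>\<^sub>r\<^bsub>M\<^esub> h \<and>
        (g \<otimes>\<^bsub>\<Gamma>\<^esub> h) \<odot>\<^bsub>M\<^esub> x = g \<odot>\<^bsub>M\<^esub> (h \<odot>\<^bsub>M\<^esub> x) \<and>
        x \<odot>\<^sub>r\<^bsub>M\<^esub> (g \<otimes>\<^bsub>\<Gamma>\<^esub> h) = (x \<odot>\<^sub>r\<^bsub>M\<^esub> g) \<odot>\<^sub>r\<^bsub>M\<^esub> h \<and>
        (g \<odot>\<^bsub>M\<^esub> x) \<odot>\<^sub>r\<^bsub>M\<^esub> h = g \<odot>\<^bsub>M\<^esub> (x \<odot>\<^sub>r\<^bsub>M\<^esub> h)) \<and>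
     (\<forall>x\<in>carrier M. \<one>\<^bsub>\<Gamma>\<^esub> \<odot>\<^bsub>M\<^esub> x = x \<and> x \<odot>\<^sub>r\<^bsub>M\<^esub> \<one>\<^bsub>\<Gamma>\<^esub> = x)"

definition bimodule_hom ::
  "('g, 'c) ring_scheme \<Rightarrow> ('g, 'm, 'd) bimodule_scheme \<Rightarrow> ('g, 'n, 'e) bimodule_scheme
     \<Rightarrow> ('m \<Rightarrow> 'n) set" where
  "bimodule_hom \<Gamma> M N =
     {h. (\<forall>x\<in>carrier M. h x \<in> carrier N) \<and>
         (\<forall>x\<in>carrier M. \<forall>y\<in>carrier M. h (x \<oplus>\<^bsub>M\<^esub> y) = h x \<oplus>\<^bsub>N\<^esub> h y) \<and>
         (\<forall>g\<in>carrier \<Gamma>. \<forall>x\<in>carrier M.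
            h (g \<odot>\<^bsub>M\<^esub> x) = g \<odot>\<^bsub>N\<^esub> h x \<and> h (x \<odot>\<^sub>r\<^bsub>M\<^esub> g) = h x \<odot>\<^sub>r\<^bsub>N\<^esub> g)}"

text \<open>
  For a module over a \<open>k\<close>-algebra \<open>\<Gamma>\<close>, scalars of \<open>k\<close> act through \<open>k \<rightarrow> \<Gamma>\<close>, \<open>a \<mapsto> a 1\<close>.
\<close>

definition scalar_restriction ::
  "('k, 'g, 'c) module_scheme \<Rightarrow> ('g, 'm, 'd) bimodule_scheme \<Rightarrow> ('k, 'm) module" where
  "scalar_restriction \<Gamma> M =
     \<lparr>carrier = carrier M, monoid.mult = monoid.mult M, monoid.one = monoid.one M,
      ring.zero = ring.zero M, ring.add = ring.add M,
      smult = (\<lambda>a x. (a \<odot>\<^bsub>\<Gamma>\<^esub> \<one>\<^bsub>\<Gamma>\<^esub>) \<odot>\<^bsub>M\<^esub> x)\<rparr>"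

definition central_action ::
  "('k, 'b) ring_scheme \<Rightarrow> ('k, 'g, 'c) module_scheme \<Rightarrow> ('g, 'm, 'd) bimodule_scheme \<Rightarrow> bool" where
  "central_action K \<Gamma> M \<longleftrightarrow>
     (\<forall>a\<in>carrier K. \<forall>x\<in>carrier M.
        (a \<odot>\<^bsub>\<Gamma>\<^esub> \<one>\<^bsub>\<Gamma>\<^esub>) \<odot>\<^bsub>M\<^esub> x = x \<odot>\<^sub>r\<^bsub>M\<^esub> (a \<odot>\<^bsub>\<Gamma>\<^esub> \<one>\<^bsub>\<Gamma>\<^esub>))"


section \<open>Tensor powers of a bimodule\<close>

text \<open>
  For \<open>n \<ge> 1\<close> the tensor power \<open>M \<otimes>\<^sub>\<Gamma> \<dots> \<otimes>\<^sub>\<Gamma> M\<close> (\<open>n\<close> factors) is the free abelian group on the words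
  of length \<open>n\<close> over \<open>M\<close>, modulo additivity in each place and \<open>\<Gamma>\<close>-balancedness in each pair of
  adjacent places. Working with words makes all the iterated tensor products, for varying \<open>n\<close>,
  inhabit a single type, and makes the associativity isomorphisms identities.
\<close>

definition tensor_words :: "('g, 'm, 'd) bimodule_scheme \<Rightarrow> nat \<Rightarrow> 'm list set" where
  "tensor_words M n = {ms. length ms = n \<and> set ms \<subseteq> carrier M}"

definition tensor_relators ::
  "('g, 'c) ring_scheme \<Rightarrow> ('g, 'm, 'd) bimodule_scheme \<Rightarrow> nat \<Rightarrow> ('m list \<Rightarrow>\<^sub>0 int) set" where
  "tensor_relators \<Gamma> M n =
     {frag_of (xs @ [x \<oplus>\<^bsub>M\<^esub> y] @ ys) - frag_of (xs @ [x] @ ys) - frag_of (xs @ [y] @ ys) | xs x y ys.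
        xs @ [x] @ ys \<in> tensor_words M n \<and> y \<in> carrier M} \<union>
     {frag_of (xs @ [x \<odot>\<^sub>r\<^bsub>M\<^esub> g, y] @ ys) - frag_of (xs @ [x, g \<odot>\<^bsub>M\<^esub> y] @ ys) | xs x g y ys.
        xs @ [x, y] @ ys \<in> tensor_words M n \<and> g \<in> carrier \<Gamma>}"

definition tensor_subgroup ::
  "('g, 'c) ring_scheme \<Rightarrow> ('g, 'm, 'd) bimodule_scheme \<Rightarrow> nat \<Rightarrow> ('m list \<Rightarrow>\<^sub>0 int) set" where
  "tensor_subgroup \<Gamma> M n =
     generate (free_Abelian_group (tensor_words M n)) (tensor_relators \<Gamma> M n)"

definition tensor_coset ::
  "('g, 'c) ring_scheme \<Rightarrow> ('g, 'm, 'd) bimodule_scheme \<Rightarrow> nat \<Rightarrow> ('m list \<Rightarrow>\<^sub>0 int)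
     \<Rightarrow> ('m list \<Rightarrow>\<^sub>0 int) set" where
  "tensor_coset \<Gamma> M n c = tensor_subgroup \<Gamma> M n #>\<^bsub>free_Abelian_group (tensor_words M n)\<^esub> c"

definition pure_tensor ::
  "('g, 'c) ring_scheme \<Rightarrow> ('g, 'm, 'd) bimodule_scheme \<Rightarrow> 'm list \<Rightarrow> ('m list \<Rightarrow>\<^sub>0 int) set" where
  "pure_tensor \<Gamma> M ms = tensor_coset \<Gamma> M (length ms) (frag_of ms)"

text \<open>
  The additive map into the \<open>n\<close>-th tensor power which sends the pure tensor of each word \<open>ms\<close> to
  the pure tensor of \<open>f ms\<close>. (The union is over equal cosets whenever \<open>f\<close> is compatible with the
  relators, as is the case in all the uses below.)
\<close>

definition tensor_map ::
  "('g, 'c) ring_scheme \<Rightarrow> ('g, 'm, 'd) bimodule_scheme \<Rightarrow> nat \<Rightarrow> ('m list \<Rightarrow> 'm list)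
     \<Rightarrow> ('m list \<Rightarrow>\<^sub>0 int) set \<Rightarrow> ('m list \<Rightarrow>\<^sub>0 int) set" where
  "tensor_map \<Gamma> M n f X = (\<Union>c\<in>X. tensor_coset \<Gamma> M n (frag_extend (\<lambda>ms. frag_of (f ms)) c))"

definition tensor_power ::
  "('g, 'c) ring_scheme \<Rightarrow> ('g, 'm, 'd) bimodule_scheme \<Rightarrow> nat
     \<Rightarrow> ('g, ('m list \<Rightarrow>\<^sub>0 int) set) bimodule" where
  "tensor_power \<Gamma> M n =
     (let T = free_Abelian_group (tensor_words M n) Mod tensor_subgroup \<Gamma> M n in
      \<lparr>carrier = carrier T, monoid.mult = undefined, monoid.one = undefined,
       ring.zero = \<one>\<^bsub>T\<^esub>, ring.add = monoid.mult T,
       smult = (\<lambda>g. tensor_map \<Gamma> M n (\<lambda>ms. (g \<odot>\<^bsub>M\<^esub> hd ms) # tl ms)),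
       rsmult = (\<lambda>X g. tensor_map \<Gamma> M n (\<lambda>ms. butlast ms @ [last ms \<odot>\<^sub>r\<^bsub>M\<^esub> g]) X)\<rparr>)"


section \<open>Multiplicative bimodules and split extensions\<close>

type_synonym 'm tensor_fun = "('m list \<Rightarrow>\<^sub>0 int) set \<Rightarrow> 'm"

definition multiplicative_bimodule ::
  "('k, 'b) ring_scheme \<Rightarrow> ('k, 'g, 'c) module_scheme \<Rightarrow> ('g, 'm, 'd) bimodule_scheme
     \<Rightarrow> 'm tensor_fun \<Rightarrow> bool" where
  "multiplicative_bimodule K \<Gamma> M \<theta> \<longleftrightarrow>
     is_bimodule \<Gamma> M \<and> carrier M \<noteq> {\<zero>\<^bsub>M\<^esub>} \<and> central_action K \<Gamma> M \<and>
     vectorspace.fin_dim K (scalar_restriction \<Gamma> M) \<and>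
     \<theta> \<in> bimodule_hom \<Gamma> (tensor_power \<Gamma> M 2) M \<and>
     (\<forall>X\<in>carrier (tensor_power \<Gamma> M 3).
        \<theta> (tensor_map \<Gamma> M 2 (\<lambda>ms. [\<theta> (pure_tensor \<Gamma> M [ms ! 0, ms ! 1]), ms ! 2]) X) =
        \<theta> (tensor_map \<Gamma> M 2 (\<lambda>ms. [ms ! 0, \<theta> (pure_tensor \<Gamma> M [ms ! 1, ms ! 2])]) X))"

text \<open>
  \<open>theta_power \<Gamma> M \<theta> r\<close> is the map \<open>\<theta>\<^sup>r\<close> from the \<open>(r+1)\<close>-st tensor power to \<open>M\<close>. For \<open>r = 0\<close> it is
  the identity of \<open>M\<close>, that is, the canonical isomorphism from the first tensor power to \<open>M\<close>.
\<close>

fun theta_power ::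
  "('g, 'c) ring_scheme \<Rightarrow> ('g, 'm, 'd) bimodule_scheme \<Rightarrow> 'm tensor_fun \<Rightarrow> nat \<Rightarrow> 'm tensor_fun" where
  "theta_power \<Gamma> M \<theta> 0 X = (THE x. x \<in> carrier M \<and> X = pure_tensor \<Gamma> M [x])"
| "theta_power \<Gamma> M \<theta> (Suc r) X =
     \<theta> (tensor_map \<Gamma> M 2
          (\<lambda>ms. [theta_power \<Gamma> M \<theta> r (pure_tensor \<Gamma> M (butlast ms)), last ms]) X)"

definition nilpotent_bimodule ::
  "('g, 'c) ring_scheme \<Rightarrow> ('g, 'm, 'd) bimodule_scheme \<Rightarrow> 'm tensor_fun \<Rightarrow> bool" where
  "nilpotent_bimodule \<Gamma> M \<theta> \<longleftrightarrow>
     (\<exists>N\<ge>1. \<forall>X\<in>carrier (tensor_power \<Gamma> M (N + 1)). theta_power \<Gamma> M \<theta> N X = \<zero>\<^bsub>M\<^esub>)"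

definition split_extension ::
  "('k, 'g, 'c) module_scheme \<Rightarrow> ('g, 'm, 'd) bimodule_scheme \<Rightarrow> 'm tensor_fun
     \<Rightarrow> ('k, 'g \<times> 'm) module" where
  "split_extension \<Gamma> M \<theta> =
     \<lparr>carrier = carrier \<Gamma> \<times> carrier M,
      monoid.mult = (\<lambda>(g, m) (h, n).
        (g \<otimes>\<^bsub>\<Gamma>\<^esub> h, g \<odot>\<^bsub>M\<^esub> n \<oplus>\<^bsub>M\<^esub> m \<odot>\<^sub>r\<^bsub>M\<^esub> h \<oplus>\<^bsub>M\<^esub> \<theta> (pure_tensor \<Gamma> M [m, n]))),
      monoid.one = (\<one>\<^bsub>\<Gamma>\<^esub>, \<zero>\<^bsub>M\<^esub>),
      ring.zero = (\<zero>\<^bsub>\<Gamma>\<^esub>, \<zero>\<^bsub>M\<^esub>),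
      ring.add = (\<lambda>(g, m) (h, n). (g \<oplus>\<^bsub>\<Gamma>\<^esub> h, m \<oplus>\<^bsub>M\<^esub> n)),
      smult = (\<lambda>a (g, m). (a \<odot>\<^bsub>\<Gamma>\<^esub> g, a \<odot>\<^bsub>scalar_restriction \<Gamma> M\<^esub> m))\<rparr>"

end

theory Submission
  imports Defs
begin

text \<open>
  If \<open>E\<close> is isomorphic to a bound quiver algebra \<open>kQ'/I'\<close>, then the coefficient at a vertex of \<open>Q\<close>
  defines a character \<open>kQ' \<rightarrow> E \<rightarrow> \<Gamma> \<rightarrow> k\<close>, and every character of \<open>kQ'\<close> that kills \<open>I'\<close> is the
  coefficient at a vertex of \<open>Q'\<close>. The resulting map from the vertices of \<open>Q\<close> to those of \<open>Q'\<close> is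
  injective, so if both quivers have equally many vertices, it is onto, and \<open>M\<close>, which all these
  characters kill, lies in the nilpotent arrow ideal of \<open>kQ'/I'\<close>.

  Conversely, if \<open>M\<close> is nilpotent and \<open>J\<close> is the arrow ideal of \<open>\<Gamma>\<close>, then \<open>R = J \<oplus> M\<close> is a nilpotent
  ideal of \<open>E\<close>. Add to \<open>Q\<close> one arrow for each member of a minimal subset of
  \<open>\<Union>\<^bsub>u,v\<^esub> e\<^sub>u M e\<^sub>v\<close> that spans \<open>M\<close> modulo \<open>R\<^sup>2\<close>. The path algebra of the new quiver maps onto \<open>E\<close>
  because \<open>R\<close> is nilpotent, and by minimality the kernel is admissible. Paths that use a new arrow are
  mapped into \<open>M\<close> and the others into \<open>\<Gamma>\<close>, so the sum \<open>E = \<Gamma> \<oplus> M\<close> being direct makes the set of new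
  arrows pre-removable; these arrows generate \<open>M\<close>.
\<close>

section \<open>Algebras and path algebras\<close>

text \<open>The number of vertices matters: for \<Gamma> = M = k with \<theta> the multiplication of
  k, the algebra E is k x k, a bound quiver algebra on two vertices, although no power of \<theta>
  vanishes. A technical obstacle is that \<theta> lives on quotients of free abelian groups of
  words. It is reduced to a biadditive balanced product \<open>\<mu>\<close> on M. Since E is a
  ring, the iterates of \<theta> then become products in E, and nilpotency says that long products
  of elements of M vanish there. R is nilpotent because J is: if all paths of length N vanish in
  \<Gamma>, then N factors from R multiply into M, and sufficiently many such blocks multiply to
  zero. Surjectivity onto E is a Nakayama argument: if R = S + R^2 for a subspace S closed under
  products, then R = S + R^k for every k. Admissibility of the kernel is checked in two steps.
  Coefficients at vertices and old arrows can be read off in \<Gamma>, because I has no terms of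
  length below 2. Only then does minimality force the coefficients at new arrows to vanish.\<close>

locale k_algebra =
  fixes K :: "('k, 'c) ring_scheme" and A :: "('k, 'a, 'd) module_scheme" (structure)
  assumes assoc_algebra: "assoc_algebra K A"
begin

sublocale ring A
  using assoc_algebra by (simp add: assoc_algebra_def)

sublocale V: vectorspace K A
  using assoc_algebra by (simp add: assoc_algebra_def)

lemma smult_mult_l:
  "\<lbrakk>a \<in> carrier K; x \<in> carrier A; y \<in> carrier A\<rbrakk> \<Longrightarrow> (a \<odot> x) \<otimes> y = a \<odot> (x \<otimes> y)"
  using assoc_algebra by (simp add: assoc_algebra_def)

lemma smult_mult_r:
  "\<lbrakk>a \<in> carrier K; x \<in> carrier A; y \<in> carrier A\<rbrakk> \<Longrightarrow> x \<otimes> (a \<odot> y) = a \<odot> (x \<otimes> y)"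
  using assoc_algebra by (simp add: assoc_algebra_def)

end

locale path_alg =
  fixes K :: "('k, 'c) ring_scheme" (structure) and Q :: "('v, 'e) pre_digraph"
  assumes field_K: "field K" and fin_digraph_Q: "fin_digraph Q"
begin

sublocale K: field K by (rule field_K)
sublocale Q: fin_digraph Q by (rule fin_digraph_Q)

abbreviation "kQ \<equiv> path_algebra K Q"
abbreviation kQ_times (infixl \<open>\<star>\<close> 70) where "f \<star> g \<equiv> f \<otimes>\<^bsub>kQ\<^esub> g"
abbreviation kQ_plus (infixl \<open>\<uplus>\<close> 65) where "f \<uplus> g \<equiv> f \<oplus>\<^bsub>kQ\<^esub> g"
abbreviation kQ_smult (infixl \<open>\<bullet>\<close> 70) where "a \<bullet> f \<equiv> a \<odot>\<^bsub>kQ\<^esub> f"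
abbreviation "pe \<equiv> path_elt K"

definition path_end :: "'v \<times> 'e list \<Rightarrow> 'v" where
  "path_end p = Q.awlast (fst p) (snd p)"

lemma carrier_iff:
  "f \<in> carrier kQ \<longleftrightarrow> (\<forall>p. f p \<in> carrier K) \<and> finite {p. f p \<noteq> \<zero>} \<and>
     (\<forall>p. f p \<noteq> \<zero> \<longrightarrow> is_path Q p)"
  by (auto simp: path_algebra_def)

lemma coeff_closed [simp]: "f \<in> carrier kQ \<Longrightarrow> f p \<in> carrier K"
  using carrier_iff by blast

lemma finite_support: "f \<in> carrier kQ \<Longrightarrow> finite {p. f p \<noteq> \<zero>}"
  using carrier_iff by blast

lemma carrierI:
  assumes "\<And>p. f p \<in> carrier K" "finite {p. f p \<noteq> \<zero>}"
    and "\<And>p. f p \<noteq> \<zero> \<Longrightarrow> is_path Q p"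
  shows "f \<in> carrier kQ"
  using assms carrier_iff by blast

lemma is_path_support: "\<lbrakk>f \<in> carrier kQ; f p \<noteq> \<zero>\<rbrakk> \<Longrightarrow> is_path Q p"
  using carrier_iff by blast

lemma add_apply: "(f \<uplus> g) p = f p \<oplus> g p"
  by (simp add: path_algebra_def)

lemma smult_apply: "(a \<bullet> f) p = a \<otimes> f p"
  by (simp add: path_algebra_def)

lemma zero_apply: "\<zero>\<^bsub>kQ\<^esub> p = \<zero>"
  by (simp add: path_algebra_def)

lemma one_apply: "\<one>\<^bsub>kQ\<^esub> (u, es) = (if u \<in> verts Q \<and> es = [] then \<one> else \<zero>)"
  by (simp add: path_algebra_def)

lemma mult_apply:
  "(f \<star> g) (u, es) =
     (\<Oplus>i\<in>{..length es}. f (u, take i es) \<otimes> g (Q.awlast u (take i es), drop i es))"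
  by (simp add: path_algebra_def)

lemma pe_apply: "pe p q = (if q = p then \<one> else \<zero>)"
  by (simp add: path_elt_def)

lemma zero_closed: "\<zero>\<^bsub>kQ\<^esub> \<in> carrier kQ"
  by (rule carrierI) (simp_all add: zero_apply)

lemma add_closed:
  assumes "f \<in> carrier kQ" "g \<in> carrier kQ"
  shows "f \<uplus> g \<in> carrier kQ"
proof -
  have "{p. f p \<oplus> g p \<noteq> \<zero>} \<subseteq> {p. f p \<noteq> \<zero>} \<union> {p. g p \<noteq> \<zero>}"
    by auto
  then have "finite {p. f p \<oplus> g p \<noteq> \<zero>}"
    by (rule finite_subset) (use assms finite_support in auto)
  moreover have "is_path Q p" if "f p \<oplus> g p \<noteq> \<zero>" for p
    using that assms is_path_support[of f p] is_path_support[of g p] by fastforce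
  ultimately show ?thesis
    using assms by (intro carrierI) (simp_all add: add_apply)
qed

lemma smult_closed:
  assumes "a \<in> carrier K" "f \<in> carrier kQ"
  shows "a \<bullet> f \<in> carrier kQ"
proof -
  have "{p. a \<otimes> f p \<noteq> \<zero>} \<subseteq> {p. f p \<noteq> \<zero>}"
    using assms by auto
  then have "finite {p. a \<otimes> f p \<noteq> \<zero>}"
    by (rule finite_subset) (use assms finite_support in auto)
  moreover have "is_path Q p" if "a \<otimes> f p \<noteq> \<zero>" for p
    using that assms is_path_support[of f p] by fastforce
  ultimately show ?thesis
    using assms by (intro carrierI) (simp_all add: smult_apply)
qed

lemma pe_closed: "is_path Q p \<Longrightarrow> pe p \<in> carrier kQ"
  by (rule carrierI) (auto simp: pe_apply split: if_splits)

lemma module_kQ: "Module.module K kQ"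
proof (rule moduleI)
  show "cring K" ..
  show "abelian_group kQ"
  proof (rule abelian_groupI)
    fix f assume f: "f \<in> carrier kQ"
    have "((\<ominus> \<one>) \<bullet> f) \<uplus> f = \<zero>\<^bsub>kQ\<^esub>"
      using f by (intro ext) (simp add: add_apply smult_apply zero_apply K.l_minus K.l_neg)
    with f show "\<exists>g\<in>carrier kQ. g \<uplus> f = \<zero>\<^bsub>kQ\<^esub>"
      by (meson K.add.inv_closed K.one_closed smult_closed)
  next
    fix f g assume "f \<in> carrier kQ" "g \<in> carrier kQ"
    then show "f \<uplus> g = g \<uplus> f"
      by (intro ext) (simp add: add_apply K.add.m_comm)
  next
    fix f g h assume "f \<in> carrier kQ" "g \<in> carrier kQ" "h \<in> carrier kQ"
    then show "(f \<uplus> g) \<uplus> h = f \<uplus> (g \<uplus> h)"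
      by (intro ext) (simp add: add_apply K.add.m_assoc)
  next
    fix f assume "f \<in> carrier kQ"
    then show "\<zero>\<^bsub>kQ\<^esub> \<uplus> f = f"
      by (intro ext) (simp add: add_apply zero_apply)
  qed (fact zero_closed add_closed)+
next
  fix a b f assume "a \<in> carrier K" "b \<in> carrier K" "f \<in> carrier kQ"
  then show "(a \<oplus> b) \<bullet> f = a \<bullet> f \<uplus> b \<bullet> f"
    by (intro ext) (simp add: add_apply smult_apply K.l_distr)
next
  fix a f g assume "a \<in> carrier K" "f \<in> carrier kQ" "g \<in> carrier kQ"
  then show "a \<bullet> (f \<uplus> g) = a \<bullet> f \<uplus> a \<bullet> g"
    by (intro ext) (simp add: add_apply smult_apply K.r_distr)
next
  fix a b f assume "a \<in> carrier K" "b \<in> carrier K" "f \<in> carrier kQ"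
  then show "(a \<otimes> b) \<bullet> f = a \<bullet> (b \<bullet> f)"
    by (intro ext) (simp add: smult_apply K.m_assoc)
next
  fix f assume "f \<in> carrier kQ"
  then show "\<one> \<bullet> f = f"
    by (intro ext) (simp add: smult_apply)
qed (fact smult_closed)

sublocale M: Module.module K kQ by (rule module_kQ)

text \<open>Peels one path at a time off the support. The premise
  \<open>f p \<noteq> \<zero>\<close> speaks of the original \<open>f\<close>, so a restriction on
  the support of \<open>f\<close> stays available in every step, and linear claims reduce to single
  paths.\<close>

lemma path_induct [consumes 1, case_names zero add]:
  assumes f: "f \<in> carrier kQ" and zero: "P \<zero>\<^bsub>kQ\<^esub>"
    and add: "\<And>a p g. \<lbrakk>a \<in> carrier K; is_path Q p; f p \<noteq> \<zero>; g \<in> carrier kQ; P g\<rbrakk>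
      \<Longrightarrow> P (a \<bullet> pe p \<uplus> g)"
  shows "P f"
proof -
  \<comment> \<open>The restriction of \<open>f\<close> to a set of paths; the induction runs over
    finite subsets of the support.\<close>
  define r where "r T = (\<lambda>p. if p \<in> T then f p else \<zero>)" for T
  have r_closed: "r T \<in> carrier kQ" for T
  proof -
    have "finite {p. r T p \<noteq> \<zero>}"
      by (rule finite_subset[OF _ finite_support[OF f]]) (auto simp: r_def)
    moreover have "r T p \<in> carrier K" for p
      using f by (simp add: r_def)
    moreover have "is_path Q p" if "r T p \<noteq> \<zero>" for p
      using that is_path_support[OF f, of p] by (simp add: r_def split: if_splits)
    ultimately show ?thesis
      unfolding carrier_iff by blast
  qed
  have "T \<subseteq> {p. f p \<noteq> \<zero>} \<longrightarrow> P (r T)" if "finite T" for T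
    using that
  proof induction
    case empty
    have "r {} = \<zero>\<^bsub>kQ\<^esub>" by (auto simp: r_def zero_apply)
    then show ?case using zero by simp
  next
    case (insert p T)
    have "r (insert p T) = f p \<bullet> pe p \<uplus> r T"
      using f insert(2) by (auto simp: fun_eq_iff r_def add_apply smult_apply pe_apply)
    then show ?case
      using insert f r_closed[of T] add[of "f p" p "r T"] is_path_support[OF f, of p] by auto
  qed
  from this[OF finite_support[OF f]] have "P (r {p. f p \<noteq> \<zero>})" by simp
  moreover have "r {p. f p \<noteq> \<zero>} = f" by (auto simp: r_def)
  ultimately show ?thesis by simp
qed

section \<open>Paths, their ends and their concatenation\<close>

lemma is_path_iff: "is_path Q p \<longleftrightarrow> Q.awalk (fst p) (snd p) (path_end p)"
  unfolding is_path_def path_end_def by auto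

lemma path_end_append: "path_end (u, es @ fs) = path_end (path_end (u, es), fs)"
  by (simp add: path_end_def Q.awlast_append)

lemma is_path_append:
  "is_path Q (u, es @ fs) \<longleftrightarrow> is_path Q (u, es) \<and> is_path Q (path_end (u, es), fs)"
  by (simp add: is_path_iff path_end_def Q.awlast_append)

lemma is_path_Nil: "is_path Q (u, []) \<longleftrightarrow> u \<in> verts Q"
  by (simp add: is_path_def Q.awalk_Nil_iff)

lemma path_end_Nil [simp]: "path_end (u, []) = u"
  by (simp add: path_end_def)

lemma path_end_snoc [simp]: "path_end (u, es @ [a]) = head Q a"
  by (simp add: path_end_def Q.awalk_verts_conv)

lemma path_end_single [simp]: "path_end (u, [a]) = head Q a"
  using path_end_snoc[of u "[]" a] by simp

lemma is_path_Cons: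
  "is_path Q (u, a # es) \<longleftrightarrow> a \<in> arcs Q \<and> u = tail Q a \<and> is_path Q (head Q a, es)"
  by (auto simp: is_path_def Q.awalk_Cons_iff)

lemma path_end_in_verts: "is_path Q p \<Longrightarrow> path_end p \<in> verts Q"
  using is_path_iff by auto

lemma fst_in_verts: "is_path Q p \<Longrightarrow> fst p \<in> verts Q"
  unfolding is_path_iff by auto

lemma path_arcs: "is_path Q p \<Longrightarrow> set (snd p) \<subseteq> arcs Q"
  by (auto simp: is_path_iff)

lemma arc_is_path: "a \<in> arcs Q \<Longrightarrow> is_path Q (tail Q a, [a])"
  by (simp add: is_path_Cons is_path_Nil)

text \<open>Among all cuts in the convolution only the one after \<open>length (snd p)\<close>
  arrows can match \<open>p\<close>, so the sum has at most one non-zero term.\<close>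

lemma pe_mult:
  assumes p: "is_path Q p" and q: "is_path Q q"
  shows "pe p \<star> pe q =
    (if path_end p = fst q then pe (fst p, snd p @ snd q) else \<zero>\<^bsub>kQ\<^esub>)"
proof (rule ext)
  fix r :: "'v \<times> 'e list"
  obtain u es where r: "r = (u, es)" by force
  let ?c = "u = fst p \<and> es = snd p @ snd q \<and> path_end p = fst q"
  have "pe p (u, take i es) \<otimes> pe q (Q.awlast u (take i es), drop i es) =
      (if length (snd p) = i then (if ?c then \<one> else \<zero>) else \<zero>)"
    if i: "i \<le> length es" for i
  proof (cases "u = fst p \<and> take i es = snd p")
    case True
    then have "length (snd p) = i" using i by (metis length_take min_absorb2)
    moreover have "Q.awlast u (take i es) = path_end p" using True by (simp add: path_end_def)
    moreover have "(es = snd p @ snd q) = (drop i es = snd q)"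
      using True by (metis append_eq_conv_conj append_take_drop_id calculation(1))
    ultimately show ?thesis using True by (cases q) (auto simp: pe_apply)
  next
    case False
    then have "\<not> (length (snd p) = i \<and> ?c)" by auto
    then show ?thesis using False by (cases p) (auto simp: pe_apply)
  qed
  then have "(pe p \<star> pe q) (u, es) =
      (\<Oplus>i\<in>{..length es}. if length (snd p) = i then (if ?c then \<one> else \<zero>) else \<zero>)"
    unfolding mult_apply by (intro K.finsum_cong') auto
  also have "\<dots> = (if ?c then \<one> else \<zero>)"
  proof (cases ?c)
    case True
    then show ?thesis
      by (subst K.finsum_singleton) auto
  next
    case False
    have "(\<Oplus>i\<in>{..length es}. if length (snd p) = i then (if ?c then \<one> else \<zero>) else \<zero>)
      = (\<Oplus>i\<in>{..length es}. \<zero>)"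
      using False by (intro K.finsum_cong') auto
    with False show ?thesis by simp
  qed
  finally show "(pe p \<star> pe q) r =
      (if path_end p = fst q then pe (fst p, snd p @ snd q) else \<zero>\<^bsub>kQ\<^esub>) r"
    unfolding r by (auto simp: pe_apply zero_apply)
qed

lemma pe_mult_is_path:
  assumes "is_path Q p" "is_path Q q" "path_end p = fst q"
  shows "is_path Q (fst p, snd p @ snd q)" "path_end (fst p, snd p @ snd q) = path_end q"
  using assms by (auto simp: is_path_append path_end_append)

section \<open>The algebra axioms for the path algebra\<close>

lemma path_eqI: "(\<And>u es. f (u, es) = g (u, es)) \<Longrightarrow> f = g" for f g :: "'v \<times> 'e list \<Rightarrow> 'k"
  by auto

lemma l_distr:
  assumes "f \<in> carrier kQ" "g \<in> carrier kQ" "h \<in> carrier kQ"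
  shows "(f \<uplus> g) \<star> h = f \<star> h \<uplus> g \<star> h"
  using assms
  by (intro path_eqI) (simp add: mult_apply add_apply K.l_distr K.finsum_addf Pi_def)

lemma r_distr:
  assumes "f \<in> carrier kQ" "g \<in> carrier kQ" "h \<in> carrier kQ"
  shows "h \<star> (f \<uplus> g) = h \<star> f \<uplus> h \<star> g"
  using assms
  by (intro path_eqI) (simp add: mult_apply add_apply K.r_distr K.finsum_addf Pi_def)

lemma smult_mult_l:
  assumes "a \<in> carrier K" "f \<in> carrier kQ" "g \<in> carrier kQ"
  shows "(a \<bullet> f) \<star> g = a \<bullet> (f \<star> g)"
  using assms
  by (intro path_eqI) (simp add: mult_apply smult_apply K.m_assoc K.finsum_rdistr Pi_def)

lemma smult_mult_r:
  assumes "a \<in> carrier K" "f \<in> carrier kQ" "g \<in> carrier kQ"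
  shows "f \<star> (a \<bullet> g) = a \<bullet> (f \<star> g)"
  using assms
  by (intro path_eqI) (simp add: mult_apply smult_apply K.m_lcomm K.finsum_rdistr Pi_def)

lemma mult_zero_l: "f \<in> carrier kQ \<Longrightarrow> \<zero>\<^bsub>kQ\<^esub> \<star> f = \<zero>\<^bsub>kQ\<^esub>"
  by (intro path_eqI) (simp add: mult_apply zero_apply)

lemma mult_zero_r: "f \<in> carrier kQ \<Longrightarrow> f \<star> \<zero>\<^bsub>kQ\<^esub> = \<zero>\<^bsub>kQ\<^esub>"
  by (intro path_eqI) (simp add: mult_apply zero_apply)

lemma pe_mult_closed:
  assumes "is_path Q p" "is_path Q q"
  shows "pe p \<star> pe q \<in> carrier kQ"
  using assms by (auto simp: pe_mult zero_closed intro!: pe_closed pe_mult_is_path)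

text \<open>Instead of bounding the support of a convolution, bilinearity is used:
  \<open>path_induct\<close> in either factor reduces the claim to the product of two paths.\<close>

lemma mult_closed:
  assumes "f \<in> carrier kQ" "g \<in> carrier kQ"
  shows "f \<star> g \<in> carrier kQ"
proof -
  have *: "pe p \<star> g \<in> carrier kQ" if "is_path Q p" for p
    using assms(2)
  proof (induction g rule: path_induct)
    case zero
    then show ?case using that by (simp add: mult_zero_r zero_closed pe_closed)
  next
    case (add a q g')
    then show ?case using that
      by (simp add: r_distr smult_mult_r pe_closed pe_mult_closed smult_closed add_closed)
  qed
  show ?thesis
    using assms(1)
  proof (induction f rule: path_induct)
    case zero
    then show ?case using assms by (simp add: mult_zero_l zero_closed)
  next
    case (add a q g')
    then show ?case using assms
      by (simp add: l_distr smult_mult_l pe_closed * smult_closed add_closed)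
  qed
qed

lemma pe_mult_assoc:
  assumes "is_path Q p" "is_path Q q" "is_path Q r"
  shows "(pe p \<star> pe q) \<star> pe r = pe p \<star> (pe q \<star> pe r)"
  using assms pe_mult_is_path[of p q] pe_mult_is_path[of q r]
  by (cases "path_end p = fst q"; cases "path_end q = fst r")
     (simp_all add: pe_mult mult_zero_l mult_zero_r pe_closed)

text \<open>By trilinearity it suffices to treat three paths, where associativity is that of
  concatenation. General factors are restored from right to left.\<close>

lemma mult_assoc:
  assumes f: "f \<in> carrier kQ" and g: "g \<in> carrier kQ" and h: "h \<in> carrier kQ"
  shows "(f \<star> g) \<star> h = f \<star> (g \<star> h)"
proof -
  have 1: "(pe p \<star> pe q) \<star> h = pe p \<star> (pe q \<star> h)"
    if "is_path Q p" "is_path Q q" for p q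
    using h
  proof (induction h rule: path_induct)
    case zero
    then show ?case using that by (simp add: mult_zero_r mult_closed pe_closed)
  next
    case (add a r h')
    then show ?case using that
      by (simp add: r_distr smult_mult_r pe_closed mult_closed smult_closed pe_mult_assoc)
  qed
  have 2: "(pe p \<star> g) \<star> h = pe p \<star> (g \<star> h)" if "is_path Q p" for p
    using g
  proof (induction g rule: path_induct)
    case zero
    then show ?case using that h by (simp add: mult_zero_r mult_zero_l mult_closed pe_closed)
  next
    case (add a r g')
    then show ?case using that h
      by (simp add: r_distr l_distr smult_mult_r smult_mult_l pe_closed mult_closed smult_closed 1)
  qed
  show ?thesis using f
  proof (induction f rule: path_induct)
    case zero
    then show ?case using g h by (simp add: mult_zero_l mult_closed)
  next
    case (add a r f')
    then show ?case using g h
      by (simp add: l_distr smult_mult_l pe_closed mult_closed smult_closed 2)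
  qed
qed

lemma one_closed: "\<one>\<^bsub>kQ\<^esub> \<in> carrier kQ"
proof -
  have "finite {p. \<one>\<^bsub>kQ\<^esub> p \<noteq> \<zero>}"
    by (rule finite_subset[of _ "(\<lambda>u. (u, [])) ` verts Q"]) (auto simp: one_apply split: if_splits)
  moreover have "\<one>\<^bsub>kQ\<^esub> p \<in> carrier K" for p
    by (cases p) (simp add: one_apply)
  moreover have "is_path Q p" if "\<one>\<^bsub>kQ\<^esub> p \<noteq> \<zero>" for p
    using that by (cases p) (auto simp: one_apply is_path_Nil split: if_splits)
  ultimately show ?thesis
    by (intro carrierI) auto
qed

lemma mult_one_pe:
  assumes "is_path Q p"
  shows "\<one>\<^bsub>kQ\<^esub> \<star> pe p = pe p"
proof (rule ext)
  fix r :: "'v \<times> 'e list"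
  obtain u es where r: "r = (u, es)" by force
  have "(\<one>\<^bsub>kQ\<^esub> \<star> pe p) (u, es) =
      (\<Oplus>i\<in>{..length es}. if 0 = i then pe p (u, es) else \<zero>)"
    unfolding mult_apply using assms fst_in_verts[of p]
    by (intro K.finsum_cong') (auto simp: one_apply pe_apply)
  also have "\<dots> = pe p (u, es)"
    by (subst K.finsum_singleton) (auto simp: pe_apply)
  finally show "(\<one>\<^bsub>kQ\<^esub> \<star> pe p) r = pe p r" by (simp add: r)
qed

lemma mult_pe_one:
  assumes "is_path Q p"
  shows "pe p \<star> \<one>\<^bsub>kQ\<^esub> = pe p"
proof (rule ext)
  fix r :: "'v \<times> 'e list"
  obtain u es where r: "r = (u, es)" by force
  have "(pe p \<star> \<one>\<^bsub>kQ\<^esub>) (u, es) =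
      (\<Oplus>i\<in>{..length es}. if length es = i then pe p (u, es) else \<zero>)"
    unfolding mult_apply using assms path_end_in_verts[of p]
    by (intro K.finsum_cong') (auto simp: one_apply pe_apply path_end_def)
  also have "\<dots> = pe p (u, es)"
    by (subst K.finsum_singleton) (auto simp: pe_apply)
  finally show "(pe p \<star> \<one>\<^bsub>kQ\<^esub>) r = pe p r" by (simp add: r)
qed

lemma mult_one_l: "f \<in> carrier kQ \<Longrightarrow> \<one>\<^bsub>kQ\<^esub> \<star> f = f"
proof (induction f rule: path_induct)
  case zero
  then show ?case by (simp add: mult_zero_r one_closed)
next
  case (add a r f')
  then show ?case
    by (simp add: r_distr smult_mult_r pe_closed one_closed smult_closed mult_one_pe)
qed

lemma mult_one_r: "f \<in> carrier kQ \<Longrightarrow> f \<star> \<one>\<^bsub>kQ\<^esub> = f"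
proof (induction f rule: path_induct)
  case zero
  then show ?case by (simp add: mult_zero_l one_closed)
next
  case (add a r f')
  then show ?case
    by (simp add: l_distr smult_mult_l pe_closed one_closed smult_closed mult_pe_one)
qed

lemma assoc_algebra_kQ: "assoc_algebra K kQ"
  unfolding assoc_algebra_def
proof (intro conjI ballI)
  show "vectorspace K kQ"
    by (intro vectorspace.intro module_kQ field_K)
  show "ring kQ"
    by (intro ringI M.abelian_group_axioms monoidI)
       (simp_all add: mult_closed one_closed mult_assoc mult_one_l mult_one_r l_distr r_distr)
qed (simp_all add: smult_mult_l smult_mult_r)

end


section \<open>Algebra homomorphisms and quotients\<close>

definition alg_hom ::
  "('k, 'c) ring_scheme \<Rightarrow> ('k, 'a, 'd) module_scheme \<Rightarrow> ('k, 'b, 'e) module_scheme \<Rightarrow> ('a \<Rightarrow> 'b) set" where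
  "alg_hom K A B = {h \<in> ring_hom A B. \<forall>a\<in>carrier K. \<forall>x\<in>carrier A. h (a \<odot>\<^bsub>A\<^esub> x) = a \<odot>\<^bsub>B\<^esub> h x}"

lemma alg_homI:
  assumes "\<And>x. x \<in> carrier A \<Longrightarrow> h x \<in> carrier B"
    and "\<And>x y. \<lbrakk>x \<in> carrier A; y \<in> carrier A\<rbrakk> \<Longrightarrow> h (x \<otimes>\<^bsub>A\<^esub> y) = h x \<otimes>\<^bsub>B\<^esub> h y"
    and "\<And>x y. \<lbrakk>x \<in> carrier A; y \<in> carrier A\<rbrakk> \<Longrightarrow> h (x \<oplus>\<^bsub>A\<^esub> y) = h x \<oplus>\<^bsub>B\<^esub> h y"
    and "h \<one>\<^bsub>A\<^esub> = \<one>\<^bsub>B\<^esub>"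
    and "\<And>a x. \<lbrakk>a \<in> carrier K; x \<in> carrier A\<rbrakk> \<Longrightarrow> h (a \<odot>\<^bsub>A\<^esub> x) = a \<odot>\<^bsub>B\<^esub> h x"
  shows "h \<in> alg_hom K A B"
  using assms by (simp add: alg_hom_def ring_hom_memI)

lemma alg_homD:
  assumes "h \<in> alg_hom K A B"
  shows "\<And>x. x \<in> carrier A \<Longrightarrow> h x \<in> carrier B"
    and "\<And>x y. \<lbrakk>x \<in> carrier A; y \<in> carrier A\<rbrakk> \<Longrightarrow> h (x \<otimes>\<^bsub>A\<^esub> y) = h x \<otimes>\<^bsub>B\<^esub> h y"
    and "\<And>x y. \<lbrakk>x \<in> carrier A; y \<in> carrier A\<rbrakk> \<Longrightarrow> h (x \<oplus>\<^bsub>A\<^esub> y) = h x \<oplus>\<^bsub>B\<^esub> h y"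
    and "h \<one>\<^bsub>A\<^esub> = \<one>\<^bsub>B\<^esub>"
    and "\<And>a x. \<lbrakk>a \<in> carrier K; x \<in> carrier A\<rbrakk> \<Longrightarrow> h (a \<odot>\<^bsub>A\<^esub> x) = a \<odot>\<^bsub>B\<^esub> h x"
  using assms by (auto simp: alg_hom_def ring_hom_closed ring_hom_mult ring_hom_add ring_hom_one)

lemma alg_hom_ring_hom: "h \<in> alg_hom K A B \<Longrightarrow> h \<in> ring_hom A B"
  by (simp add: alg_hom_def)

lemma alg_hom_comp:
  assumes "h \<in> alg_hom K A B" "g \<in> alg_hom K B C"
  shows "(\<lambda>x. g (h x)) \<in> alg_hom K A C"
  using alg_homD[OF assms(1)] alg_homD[OF assms(2)] by (intro alg_homI) auto

lemma alg_isomorphic_iff: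
  "alg_isomorphic K A B \<longleftrightarrow> (\<exists>h\<in>alg_hom K A B. bij_betw h (carrier A) (carrier B))"
  by (auto simp: alg_isomorphic_def alg_hom_def ring_iso_def)

lemma alg_hom_inv_into:
  assumes A: "assoc_algebra K A" and h: "h \<in> alg_hom K A B"
    and bij: "bij_betw h (carrier A) (carrier B)"
  shows "inv_into (carrier A) h \<in> alg_hom K B A"
proof -
  interpret k_algebra K A using A by unfold_locales
  have "h \<in> ring_iso A B"
    using h bij by (simp add: alg_hom_def ring_iso_def)
  then have "inv_into (carrier A) h \<in> ring_iso B A"
    by (rule ring_iso_set_sym[OF ring_axioms])
  then have g: "inv_into (carrier A) h \<in> ring_hom B A"
    by (simp add: ring_iso_def)
  have "inv_into (carrier A) h (a \<odot>\<^bsub>B\<^esub> y) = a \<odot>\<^bsub>A\<^esub> inv_into (carrier A) h y"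
    if "a \<in> carrier K" "y \<in> carrier B" for a y
  proof -
    let ?x = "inv_into (carrier A) h y"
    have x: "?x \<in> carrier A" "h ?x = y"
      using that bij bij_betw_inv_into_right[OF bij] g by (auto simp: ring_hom_closed)
    then have "h (a \<odot>\<^bsub>A\<^esub> ?x) = a \<odot>\<^bsub>B\<^esub> y"
      using alg_homD(5)[OF h that(1), of ?x] by simp
    then show ?thesis
      using bij_betw_inv_into_left[OF bij, of "a \<odot>\<^bsub>A\<^esub> ?x"] x that(1) V.smult_closed by metis
  qed
  with g show ?thesis by (simp add: alg_hom_def)
qed

lemma alg_isomorphic_sym:
  assumes "assoc_algebra K A" "alg_isomorphic K A B"
  shows "alg_isomorphic K B A"
  using assms alg_hom_inv_into bij_betw_inv_into unfolding alg_isomorphic_iff by blast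

context k_algebra
begin

context
  fixes I assumes ideal_I: "ideal I A"
begin

interpretation I: ideal I A by (rule ideal_I)

lemma quot_carrier: "carrier (quot_algebra A I) = {I +> x | x. x \<in> carrier A}"
  by (auto simp: quot_algebra_def FactRing_simps)

lemma quot_carrierI: "x \<in> carrier A \<Longrightarrow> I +> x \<in> carrier (quot_algebra A I)"
  using quot_carrier by blast

lemma quot_carrierE:
  assumes "X \<in> carrier (quot_algebra A I)"
  obtains x where "x \<in> carrier A" "X = I +> x"
  using assms quot_carrier by blast

lemma quot_eq_iff: "\<lbrakk>x \<in> carrier A; y \<in> carrier A\<rbrakk> \<Longrightarrow> I +> x = I +> y \<longleftrightarrow> x \<ominus> y \<in> I"
  using quotient_eq_iff_same_a_r_cos[OF ideal_I] by blast

lemma quot_zero: "\<zero>\<^bsub>quot_algebra A I\<^esub> = I +> \<zero>"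
  by (simp add: quot_algebra_def FactRing_def a_coset_add_zero I.a_subset)

lemma quot_eq_zero_iff: "x \<in> carrier A \<Longrightarrow> I +> x = \<zero>\<^bsub>quot_algebra A I\<^esub> \<longleftrightarrow> x \<in> I"
  by (simp add: quot_zero quot_eq_iff a_minus_def)

lemma quot_one: "\<one>\<^bsub>quot_algebra A I\<^esub> = I +> \<one>"
  by (simp add: quot_algebra_def FactRing_def)

lemma quot_mult:
  "\<lbrakk>x \<in> carrier A; y \<in> carrier A\<rbrakk> \<Longrightarrow> (I +> x) \<otimes>\<^bsub>quot_algebra A I\<^esub> (I +> y) = I +> x \<otimes> y"
  by (simp add: quot_algebra_def FactRing_def I.rcoset_mult_add)

lemma quot_add:
  "\<lbrakk>x \<in> carrier A; y \<in> carrier A\<rbrakk> \<Longrightarrow> (I +> x) \<oplus>\<^bsub>quot_algebra A I\<^esub> (I +> y) = I +> (x \<oplus> y)"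
  by (simp add: quot_algebra_def FactRing_def I.a_rcos_sum)

text \<open>A scalar multiple is the product with the ring element \<open>a \<odot> \<one>\<close>,
  so a two-sided ideal of a unital algebra is a subspace.\<close>

lemma ideal_smult_closed:
  assumes "a \<in> carrier K" "i \<in> I"
  shows "a \<odot> i \<in> I"
proof -
  have "a \<odot> i = (a \<odot> \<one>) \<otimes> i"
    using assms I.a_Hcarr by (simp add: smult_mult_l)
  then show ?thesis
    using assms I.I_l_closed by simp
qed

text \<open>The union that defines the scalar action on the quotient runs over equal cosets: passing
  to another representative of the coset of \<open>x\<close> changes \<open>a \<odot> x\<close> by a
  multiple of an element of \<open>I\<close>.\<close>

lemma quot_smult:
  assumes a: "a \<in> carrier K" and x: "x \<in> carrier A"
  shows "a \<odot>\<^bsub>quot_algebra A I\<^esub> (I +> x) = I +> a \<odot> x"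
proof -
  have "I +> a \<odot> y = I +> a \<odot> x" if y: "y \<in> I +> x" for y
  proof -
    have yc: "y \<in> carrier A" using I.a_elemrcos_carrier[OF x y] .
    have "I +> y = I +> x" using I.a_repr_independence'[OF y x] by simp
    then have "y \<ominus> x \<in> I" using quot_eq_iff[OF yc x] by simp
    then have "a \<odot> (y \<ominus> x) \<in> I" by (rule ideal_smult_closed[OF a])
    also have "a \<odot> (y \<ominus> x) = a \<odot> y \<ominus> a \<odot> x"
      using a x yc by (simp add: a_minus_def V.smult_r_distr V.smult_r_minus)
    finally show ?thesis using quot_eq_iff a x yc by simp
  qed
  then have "(\<Union>y\<in>I +> x. I +> a \<odot> y) = I +> a \<odot> x"
    using I.a_rcos_self[OF x] by blast
  then show ?thesis by (simp add: quot_algebra_def)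
qed

lemma quot_assoc_algebra: "assoc_algebra K (quot_algebra A I)"
  unfolding assoc_algebra_def
proof (intro conjI ballI)
  let ?B = "quot_algebra A I"
  note simps = quot_mult quot_add quot_smult quot_one quot_zero quot_carrierI
  have ab: "abelian_group ?B"
  proof (rule abelian_groupI)
    fix X assume "X \<in> carrier ?B"
    then obtain x where x: "x \<in> carrier A" "X = I +> x" by (rule quot_carrierE)
    then have "(I +> \<ominus> x) \<oplus>\<^bsub>?B\<^esub> X = \<zero>\<^bsub>?B\<^esub>" by (simp add: simps l_neg)
    then show "\<exists>Y\<in>carrier ?B. Y \<oplus>\<^bsub>?B\<^esub> X = \<zero>\<^bsub>?B\<^esub>"
      using x quot_carrierI a_inv_closed by blast
  next
    fix X Y assume "X \<in> carrier ?B" "Y \<in> carrier ?B"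
    then show "X \<oplus>\<^bsub>?B\<^esub> Y = Y \<oplus>\<^bsub>?B\<^esub> X"
      by (elim quot_carrierE) (simp add: simps a_comm)
  qed (auto elim!: quot_carrierE simp: simps a_assoc)
  have "Module.module K ?B"
    by (rule moduleI)
       (auto elim!: quot_carrierE
         simp: simps ab V.R.is_cring V.smult_l_distr V.smult_r_distr V.smult_assoc1)
  then show "vectorspace K ?B"
    by (intro vectorspace.intro V.field_axioms)
  show "ring ?B"
    by (intro ringI ab monoidI) (auto elim!: quot_carrierE simp: simps m_assoc l_distr r_distr)
qed (auto elim!: quot_carrierE simp: quot_mult quot_smult smult_mult_l smult_mult_r)

lemma quot_proj_alg_hom: "(+>) I \<in> alg_hom K A (quot_algebra A I)"
  by (rule alg_homI) (simp_all add: quot_carrierI quot_mult quot_add quot_one quot_smult)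

text \<open>As \<open>h\<close> kills \<open>I\<close>, it is constant on every coset; the image is
  a singleton, and \<open>the_elem\<close> extracts the value of the induced map.\<close>

lemma quot_lift_apply:
  assumes h: "h \<in> alg_hom K A B" and B: "assoc_algebra K B" and "\<And>i. i \<in> I \<Longrightarrow> h i = \<zero>\<^bsub>B\<^esub>"
    and x: "x \<in> carrier A"
  shows "the_elem (h ` (I +> x)) = h x"
proof -
  interpret B: k_algebra K B using B by unfold_locales
  have "h y = h x" if y: "y \<in> I +> x" for y
  proof -
    obtain i where i: "i \<in> I" "y = i \<oplus> x"
      using y by (auto simp: a_r_coset_def r_coset_def)
    then show ?thesis
      using x assms(3) alg_homD[OF h] I.a_Hcarr by simp
  qed
  then have "h ` (I +> x) = {h x}"
    using I.a_rcos_self[OF x] by blast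
  then show ?thesis by simp
qed

lemma quot_lift_alg_hom:
  assumes h: "h \<in> alg_hom K A B" and B: "assoc_algebra K B" and "\<And>i. i \<in> I \<Longrightarrow> h i = \<zero>\<^bsub>B\<^esub>"
  shows "(\<lambda>X. the_elem (h ` X)) \<in> alg_hom K (quot_algebra A I) B"
  using alg_homD[OF h]
  by (intro alg_homI)
     (auto elim!: quot_carrierE
        simp: quot_mult quot_add quot_one quot_smult quot_lift_apply[OF assms])

lemma quot_lift_iso:
  assumes h: "h \<in> alg_hom K A B" and B: "assoc_algebra K B"
    and ker: "\<And>x. x \<in> carrier A \<Longrightarrow> h x = \<zero>\<^bsub>B\<^esub> \<longleftrightarrow> x \<in> I"
    and surj: "h ` carrier A = carrier B"
  shows "alg_isomorphic K (quot_algebra A I) B"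
  unfolding alg_isomorphic_iff
proof (rule bexI)
  interpret B: k_algebra K B using B by unfold_locales
  interpret h: ring_hom_ring A B h
    by (intro ring_hom_ringI2 ring_axioms B.ring_axioms alg_hom_ring_hom[OF h])
  have ker': "\<And>i. i \<in> I \<Longrightarrow> h i = \<zero>\<^bsub>B\<^esub>" using ker I.a_Hcarr by blast
  note lift = quot_lift_apply[OF h B ker']
  show "bij_betw (\<lambda>X. the_elem (h ` X)) (carrier (quot_algebra A I)) (carrier B)"
    unfolding bij_betw_def
  proof
    show "inj_on (\<lambda>X. the_elem (h ` X)) (carrier (quot_algebra A I))"
    proof (rule inj_onI)
      fix X Y assume "X \<in> carrier (quot_algebra A I)" "Y \<in> carrier (quot_algebra A I)"
        and eq: "the_elem (h ` X) = the_elem (h ` Y)"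
      then obtain x y where xy: "x \<in> carrier A" "y \<in> carrier A" "X = I +> x" "Y = I +> y"
        by (auto elim!: quot_carrierE)
      then have "h (x \<ominus> y) = \<zero>\<^bsub>B\<^esub>"
        using eq by (simp add: lift a_minus_def B.r_neg)
      then show "X = Y" using xy ker[of "x \<ominus> y"] quot_eq_iff by simp
    qed
    show "(\<lambda>X. the_elem (h ` X)) ` carrier (quot_algebra A I) = carrier B"
    proof -
      have "(\<lambda>X. the_elem (h ` X)) ` carrier (quot_algebra A I) = h ` carrier A"
        using lift by (force simp: quot_carrier image_iff)
      then show ?thesis using surj by simp
    qed
  qed
  show "(\<lambda>X. the_elem (h ` X)) \<in> alg_hom K (quot_algebra A I) B"
    by (rule quot_lift_alg_hom[OF h B ker'])
qed

end

lemma kernel_ideal: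
  assumes h: "h \<in> alg_hom K A B" and B: "assoc_algebra K B"
  shows "ideal {x \<in> carrier A. h x = \<zero>\<^bsub>B\<^esub>} A"
proof -
  interpret B: k_algebra K B using B by unfold_locales
  interpret h: ring_hom_ring A B h
    by (intro ring_hom_ringI2 ring_axioms B.ring_axioms alg_hom_ring_hom[OF h])
  show ?thesis using h.kernel_is_ideal unfolding a_kernel_def' .
qed

end


section \<open>Representations of quivers in algebras\<close>

definition list_prod :: "('a, 'd) monoid_scheme \<Rightarrow> 'a list \<Rightarrow> 'a" where
  "list_prod A xs = foldr (monoid.mult A) xs \<one>\<^bsub>A\<^esub>"

lemma list_prod_Nil [simp]: "list_prod A [] = \<one>\<^bsub>A\<^esub>"
  by (simp add: list_prod_def)

lemma list_prod_Cons [simp]: "list_prod A (x # xs) = x \<otimes>\<^bsub>A\<^esub> list_prod A xs"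
  by (simp add: list_prod_def)

lemma (in monoid) list_prod_closed: "set xs \<subseteq> carrier G \<Longrightarrow> list_prod G xs \<in> carrier G"
  by (induction xs) auto

lemma (in monoid) list_prod_append:
  "\<lbrakk>set xs \<subseteq> carrier G; set ys \<subseteq> carrier G\<rbrakk> \<Longrightarrow>
     list_prod G (xs @ ys) = list_prod G xs \<otimes> list_prod G ys"
  by (induction xs) (auto simp: list_prod_closed m_assoc)

lemma alg_hom_list_prod:
  assumes h: "h \<in> alg_hom K A B" and A: "assoc_algebra K A" and "set xs \<subseteq> carrier A"
  shows "h (list_prod A xs) = list_prod B (map h xs)"
proof -
  interpret k_algebra K A using A by unfold_locales
  show ?thesis
    using assms(3) by (induction xs) (auto simp: alg_homD[OF h] list_prod_closed)
qed

context k_algebra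
begin

lemma subspaceI:
  assumes "N \<subseteq> carrier A" "\<zero> \<in> N" "\<And>x y. \<lbrakk>x \<in> N; y \<in> N\<rbrakk> \<Longrightarrow> x \<oplus> y \<in> N"
    and "\<And>a x. \<lbrakk>a \<in> carrier K; x \<in> N\<rbrakk> \<Longrightarrow> a \<odot> x \<in> N"
  shows "submodule K N A"
  using assms V.module_axioms by (simp add: submodule_def)

lemma subspaceD:
  assumes "submodule K N A"
  shows "N \<subseteq> carrier A" "\<zero> \<in> N" "\<And>x y. \<lbrakk>x \<in> N; y \<in> N\<rbrakk> \<Longrightarrow> x \<oplus> y \<in> N"
    and "\<And>a x. \<lbrakk>a \<in> carrier K; x \<in> N\<rbrakk> \<Longrightarrow> a \<odot> x \<in> N"
  using assms by (simp_all add: submodule_def)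

lemma subspace_finsum:
  assumes N: "submodule K N A" and "finite T" "\<And>i. i \<in> T \<Longrightarrow> f i \<in> N"
  shows "finsum A f T \<in> N"
  using assms(2,3)
proof (induction T)
  case empty
  then show ?case using subspaceD(2)[OF N] by simp
next
  case (insert i T)
  then show ?case
    using subspaceD(1,3)[OF N] by (subst finsum_insert) auto
qed

lemma span_subspace: "X \<subseteq> carrier A \<Longrightarrow> submodule K (V.span X) A"
  by (rule V.span_is_submodule)

lemma span_closed: "X \<subseteq> carrier A \<Longrightarrow> x \<in> V.span X \<Longrightarrow> x \<in> carrier A"
  using subspaceD(1)[OF span_subspace] by blast

lemma span_superset: "\<lbrakk>X \<subseteq> carrier A; x \<in> X\<rbrakk> \<Longrightarrow> x \<in> V.span X"
  using V.in_own_span by blast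

lemma span_least: "\<lbrakk>submodule K N A; X \<subseteq> N\<rbrakk> \<Longrightarrow> V.span X \<subseteq> N"
  by (rule V.span_is_subset)

text \<open>With one factor fixed, the other factors whose product lies in \<open>N\<close> form a
  subspace. Hence it is enough to test generators, first in the right and then in the left
  factor.\<close>

lemma span_mult:
  assumes N: "submodule K N A" and X: "X \<subseteq> carrier A" and Y: "Y \<subseteq> carrier A"
    and XY: "\<And>x y. \<lbrakk>x \<in> X; y \<in> Y\<rbrakk> \<Longrightarrow> x \<otimes> y \<in> N"
    and x: "x \<in> V.span X" and y: "y \<in> V.span Y"
  shows "x \<otimes> y \<in> N"
proof -
  note ND = subspaceD[OF N]
  have 1: "x \<otimes> y \<in> N" if "x \<in> X" for x
  proof -
    have "submodule K {y \<in> carrier A. x \<otimes> y \<in> N} A"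
      using that X ND by (intro subspaceI) (auto simp: r_distr smult_mult_r subset_iff)
    moreover have "Y \<subseteq> {y \<in> carrier A. x \<otimes> y \<in> N}"
      using that XY Y by blast
    ultimately show ?thesis
      using y span_least by blast
  qed
  have yc: "y \<in> carrier A" using span_closed[OF Y y] .
  have "submodule K {x \<in> carrier A. x \<otimes> y \<in> N} A"
    using yc ND by (intro subspaceI) (auto simp: l_distr smult_mult_l)
  moreover have "X \<subseteq> {x \<in> carrier A. x \<otimes> y \<in> N}"
    using 1 X by blast
  ultimately show ?thesis
    using x span_least by blast
qed

end

sublocale path_alg \<subseteq> R: k_algebra K "path_algebra K Q"
  using assoc_algebra_kQ by unfold_locales

text \<open>The data of the universal property of the path algebra: a complete system of orthogonal
  idempotents indexed by the vertices, and for each arrow an element of the Peirce component that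
  belongs to its two ends.\<close>

locale quiver_rep = path_alg K Q + A: k_algebra K A
  for K :: "('k, 'c) ring_scheme" and Q :: "('v, 'e) pre_digraph"
    and A :: "('k, 'a, 'd) module_scheme" (structure) +
  fixes eV :: "'v \<Rightarrow> 'a" and eA :: "'e \<Rightarrow> 'a"
  assumes eV_closed: "v \<in> verts Q \<Longrightarrow> eV v \<in> carrier A"
    and eA_closed: "a \<in> arcs Q \<Longrightarrow> eA a \<in> carrier A"
    and eV_idem: "v \<in> verts Q \<Longrightarrow> eV v \<otimes> eV v = eV v"
    and eV_orth: "\<lbrakk>u \<in> verts Q; v \<in> verts Q; u \<noteq> v\<rbrakk> \<Longrightarrow> eV u \<otimes> eV v = \<zero>"
    and eV_sum: "finsum A eV (verts Q) = \<one>"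
    and eA_tail: "a \<in> arcs Q \<Longrightarrow> eV (tail Q a) \<otimes> eA a = eA a"
    and eA_head: "a \<in> arcs Q \<Longrightarrow> eA a \<otimes> eV (head Q a) = eA a"
begin

text \<open>The factor \<open>eV (fst p)\<close> supplies the value of a trivial path; if there are
  arrows, the first one absorbs it by \<open>eA_tail\<close>.\<close>

definition ev :: "'v \<times> 'e list \<Rightarrow> 'a" where
  "ev p = eV (fst p) \<otimes> list_prod A (map eA (snd p))"

definition \<phi> :: "('v \<times> 'e list \<Rightarrow> 'k) \<Rightarrow> 'a" where
  "\<phi> f = (\<Oplus>p\<in>{p. f p \<noteq> \<zero>\<^bsub>K\<^esub>}. f p \<odot> ev p)"

lemma eA_list_closed: "set es \<subseteq> arcs Q \<Longrightarrow> set (map eA es) \<subseteq> carrier A"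
  using eA_closed by auto

lemma list_prod_eA_closed: "set es \<subseteq> arcs Q \<Longrightarrow> list_prod A (map eA es) \<in> carrier A"
  by (intro A.list_prod_closed eA_list_closed)

lemma ev_closed: "is_path Q p \<Longrightarrow> ev p \<in> carrier A"
  using list_prod_eA_closed[OF path_arcs] eV_closed[OF fst_in_verts] by (simp add: ev_def)

lemma ev_Nil: "v \<in> verts Q \<Longrightarrow> ev (v, []) = eV v"
  by (simp add: ev_def eV_closed)

lemma ev_snoc:
  assumes "is_path Q (u, es @ [a])"
  shows "ev (u, es @ [a]) = ev (u, es) \<otimes> eA a"
proof -
  have "set es \<subseteq> arcs Q" "a \<in> arcs Q" "u \<in> verts Q"
    using path_arcs[OF assms] fst_in_verts[OF assms] by auto
  then show ?thesis
    using list_prod_eA_closed[of es] eA_closed[of a] eV_closed[of u] eA_list_closed[of es]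
    by (simp add: ev_def A.list_prod_append A.m_assoc)
qed

lemma ev_arc: "a \<in> arcs Q \<Longrightarrow> ev (tail Q a, [a]) = eA a"
  by (simp add: ev_def eA_closed eA_tail)

lemma ev_end: "is_path Q p \<Longrightarrow> ev p \<otimes> eV (path_end p) = ev p"
proof -
  assume p: "is_path Q p"
  obtain u es where "p = (u, es)" by force
  then show ?thesis
  proof (cases es rule: rev_cases)
    case Nil
    then show ?thesis
      using p \<open>p = _\<close> by (simp add: ev_Nil eV_idem is_path_Nil)
  next
    case (snoc fs a)
    then have p': "is_path Q (u, fs)" and a: "a \<in> arcs Q"
      using p \<open>p = _\<close> by (auto simp: is_path_append is_path_Cons)
    have "ev p = ev (u, fs) \<otimes> eA a"
      using p \<open>p = _\<close> snoc by (simp add: ev_snoc)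
    then show ?thesis
      using a ev_closed[OF p'] eA_head[OF a] eA_closed[OF a] eV_closed[of "head Q a"] \<open>p = _\<close> snoc
      by (simp add: A.m_assoc)
  qed
qed

text \<open>The idempotents of the end of \<open>p\<close> and of the start of \<open>q\<close> can
  be inserted between the two values. Their product decides both cases, by idempotence if the
  vertices agree and by orthogonality otherwise.\<close>

lemma ev_mult:
  assumes p: "is_path Q p" and q: "is_path Q q"
  shows "ev p \<otimes> ev q = (if path_end p = fst q then ev (fst p, snd p @ snd q) else \<zero>)"
proof -
  let ?L = "\<lambda>p. list_prod A (map eA (snd p))"
  have cl: "?L p \<in> carrier A" "?L q \<in> carrier A" "ev p \<in> carrier A" "ev q \<in> carrier A"
     "eV (fst p) \<in> carrier A" "eV (fst q) \<in> carrier A" "eV (path_end p) \<in> carrier A"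
    using p q
    by (simp_all add: list_prod_eA_closed path_arcs ev_closed eV_closed fst_in_verts path_end_in_verts)
  have 1: "ev p \<otimes> ev q = (ev p \<otimes> (eV (path_end p) \<otimes> eV (fst q))) \<otimes> ?L q"
    using cl ev_end[OF p] by (simp add: A.m_assoc[symmetric]) (simp add: ev_def[of q] A.m_assoc)
  show ?thesis
  proof (cases "path_end p = fst q")
    case True
    have "ev p \<otimes> ev q = ev p \<otimes> ?L q"
      using 1 True ev_end[OF p] eV_idem[OF fst_in_verts[OF q]] by simp
    also have "\<dots> = ev (fst p, snd p @ snd q)"
      using cl eA_list_closed[OF path_arcs[OF p]] eA_list_closed[OF path_arcs[OF q]]
      by (simp add: ev_def A.m_assoc A.list_prod_append)
    finally show ?thesis using True by simp
  next
    case False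
    then have "eV (path_end p) \<otimes> eV (fst q) = \<zero>"
      using p q by (intro eV_orth path_end_in_verts fst_in_verts)
    then show ?thesis using 1 False cl by simp
  qed
qed

text \<open>The support shrinks when terms cancel, so the sums for \<open>f\<close>,
  \<open>g\<close> and their sum run over different sets. Any finite set of paths that contains the
  support can serve as a common index set.\<close>

lemma \<phi>_superset:
  assumes "finite T" "\<And>p. p \<in> T \<Longrightarrow> is_path Q p" "\<And>p. f p \<noteq> \<zero>\<^bsub>K\<^esub> \<Longrightarrow> p \<in> T" "\<And>p. f p \<in> carrier K"
  shows "\<phi> f = (\<Oplus>p\<in>T. f p \<odot> ev p)"
  unfolding \<phi>_def
  using assms ev_closed
  by (intro A.add.finprod_mono_neutral_cong_left) auto

lemma \<phi>_zero: "\<phi> \<zero>\<^bsub>kQ\<^esub> = \<zero>"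
  by (subst \<phi>_superset[of "{}"]) (auto simp: zero_apply)

lemma \<phi>_pe: "is_path Q p \<Longrightarrow> \<phi> (pe p) = ev p"
  using ev_closed[of p] by (subst \<phi>_superset[of "{p}"]) (auto simp: pe_apply split: if_splits)

lemma \<phi>_add:
  assumes f: "f \<in> carrier kQ" and g: "g \<in> carrier kQ"
  shows "\<phi> (f \<uplus> g) = \<phi> f \<oplus> \<phi> g"
proof -
  let ?T = "{p. f p \<noteq> \<zero>\<^bsub>K\<^esub>} \<union> {p. g p \<noteq> \<zero>\<^bsub>K\<^esub>}"
  have T: "finite ?T" "\<And>p. p \<in> ?T \<Longrightarrow> is_path Q p"
    using f g finite_support is_path_support by blast+
  have "\<phi> (f \<uplus> g) = (\<Oplus>p\<in>?T. (f p \<oplus>\<^bsub>K\<^esub> g p) \<odot> ev p)"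
    by (subst \<phi>_superset[of ?T]) (use T f g in \<open>auto simp: add_apply\<close>)
  also have "\<dots> = (\<Oplus>p\<in>?T. f p \<odot> ev p \<oplus> g p \<odot> ev p)"
    using f g T ev_closed by (intro A.finsum_cong') (auto simp: A.V.smult_l_distr)
  also have "\<dots> = (\<Oplus>p\<in>?T. f p \<odot> ev p) \<oplus> (\<Oplus>p\<in>?T. g p \<odot> ev p)"
    using f g T ev_closed by (intro A.finsum_addf) auto
  also have "\<dots> = \<phi> f \<oplus> \<phi> g"
    using T f g by (subst (1 2) \<phi>_superset[of ?T]) auto
  finally show ?thesis .
qed

lemma \<phi>_smult:
  assumes a: "a \<in> carrier K" and f: "f \<in> carrier kQ"
  shows "\<phi> (a \<bullet> f) = a \<odot> \<phi> f"
proof -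
  let ?T = "{p. f p \<noteq> \<zero>\<^bsub>K\<^esub>}"
  have T: "finite ?T" "\<And>p. p \<in> ?T \<Longrightarrow> is_path Q p"
    using f finite_support is_path_support by blast+
  have "\<phi> (a \<bullet> f) = (\<Oplus>p\<in>?T. (a \<otimes>\<^bsub>K\<^esub> f p) \<odot> ev p)"
    by (subst \<phi>_superset[of ?T]) (use T f a in \<open>auto simp: smult_apply\<close>)
  also have "\<dots> = (\<Oplus>p\<in>?T. a \<odot> (f p \<odot> ev p))"
    using f a T ev_closed by (intro A.finsum_cong') (auto simp: A.V.smult_assoc1)
  also have "\<dots> = a \<odot> \<phi> f"
    unfolding \<phi>_def using f a T ev_closed by (intro A.V.finsum_smult_ldistr[symmetric]) auto
  finally show ?thesis .
qed

lemma \<phi>_combination: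
  "\<lbrakk>a \<in> carrier K; is_path Q p; g \<in> carrier kQ\<rbrakk> \<Longrightarrow>
    \<phi> (a \<bullet> pe p \<uplus> g) = a \<odot> ev p \<oplus> \<phi> g"
  by (simp add: \<phi>_add \<phi>_smult \<phi>_pe pe_closed smult_closed)

lemma \<phi>_closed: "f \<in> carrier kQ \<Longrightarrow> \<phi> f \<in> carrier A"
  unfolding \<phi>_def using ev_closed is_path_support by (intro A.finsum_closed) auto

lemma \<phi>_one: "\<phi> \<one>\<^bsub>kQ\<^esub> = \<one>"
proof -
  let ?T = "(\<lambda>u. (u, [])) ` verts Q :: ('v \<times> 'e list) set"
  have "\<phi> \<one>\<^bsub>kQ\<^esub> = (\<Oplus>p\<in>?T. \<one>\<^bsub>kQ\<^esub> p \<odot> ev p)"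
    by (rule \<phi>_superset)
       (use one_closed in \<open>auto simp: is_path_Nil one_apply image_iff split: if_splits\<close>)
  also have "\<dots> = (\<Oplus>u\<in>verts Q. \<one>\<^bsub>kQ\<^esub> (u, []) \<odot> ev (u, []))"
    by (rule A.finsum_reindex) (auto simp: inj_on_def one_apply ev_Nil eV_closed)
  also have "\<dots> = (\<Oplus>u\<in>verts Q. eV u)"
    by (intro A.finsum_cong') (auto simp: one_apply ev_Nil eV_closed)
  finally show ?thesis using eV_sum by simp
qed

lemma \<phi>_mult:
  assumes f: "f \<in> carrier kQ" and g: "g \<in> carrier kQ"
  shows "\<phi> (f \<star> g) = \<phi> f \<otimes> \<phi> g"
proof -
  have 1: "\<phi> (pe p \<star> pe q) = ev p \<otimes> ev q" if "is_path Q p" "is_path Q q" for p q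
    using that by (simp add: pe_mult ev_mult \<phi>_zero \<phi>_pe pe_mult_is_path)
  have 2: "\<phi> (pe p \<star> g) = ev p \<otimes> \<phi> g" if p: "is_path Q p" for p
    using g
  proof (induction g rule: path_induct)
    case zero
    then show ?case using p by (simp add: \<phi>_zero ev_closed pe_closed)
  next
    case (add a q g')
    then show ?case using p
      by (simp add: r_distr smult_mult_r pe_closed mult_closed smult_closed \<phi>_add \<phi>_smult 1 \<phi>_pe
          A.r_distr A.smult_mult_r ev_closed \<phi>_closed)
  qed
  show ?thesis
    using f
  proof (induction f rule: path_induct)
    case zero
    then show ?case using g by (simp add: \<phi>_zero \<phi>_closed)
  next
    case (add a q f')
    then show ?case using g
      by (simp add: l_distr smult_mult_l pe_closed mult_closed smult_closed \<phi>_add \<phi>_smult 2 \<phi>_pe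
          A.l_distr A.smult_mult_l ev_closed \<phi>_closed)
  qed
qed

lemma \<phi>_alg_hom: "\<phi> \<in> alg_hom K kQ A"
  by (rule alg_homI) (simp_all add: \<phi>_closed \<phi>_mult \<phi>_add \<phi>_one \<phi>_smult)

end

section \<open>Powers of the arrow ideal\<close>

context path_alg
begin

text \<open>The \<open>n\<close>-th power of the arrow ideal, described by its support so that
  membership becomes a condition on coefficients.\<close>

definition filt :: "nat \<Rightarrow> ('v \<times> 'e list \<Rightarrow> 'k) set" where
  "filt n = {f \<in> carrier kQ. \<forall>p. f p \<noteq> \<zero> \<longrightarrow> n \<le> length (snd p)}"

lemma filt_carrier: "f \<in> filt n \<Longrightarrow> f \<in> carrier kQ"
  by (simp add: filt_def)

lemma filt_0: "filt 0 = carrier kQ"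
  by (simp add: filt_def)

lemma filt_eq_zero: "\<lbrakk>f \<in> filt n; length (snd p) < n\<rbrakk> \<Longrightarrow> f p = \<zero>"
  unfolding filt_def using leD by blast

lemma filtI:
  "\<lbrakk>f \<in> carrier kQ; \<And>p. length (snd p) < n \<Longrightarrow> f p = \<zero>\<rbrakk> \<Longrightarrow> f \<in> filt n"
  unfolding filt_def using leI by blast

lemma filt_zero: "\<zero>\<^bsub>kQ\<^esub> \<in> filt n"
  by (rule filtI) (simp_all add: zero_apply)

lemma filt_pe: "\<lbrakk>is_path Q p; n \<le> length (snd p)\<rbrakk> \<Longrightarrow> pe p \<in> filt n"
  by (rule filtI) (auto simp: pe_closed pe_apply)

lemma filt_mult:
  assumes f: "f \<in> filt m" and g: "g \<in> filt n"
  shows "f \<star> g \<in> filt (m + n)"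
proof (rule filtI)
  show "f \<star> g \<in> carrier kQ"
    using f g by (intro mult_closed filt_carrier)
next
  fix p :: "'v \<times> 'e list" assume p: "length (snd p) < m + n"
  obtain u es where ues: "p = (u, es)" by force
  have "f (u, take i es) \<otimes> g (Q.awlast u (take i es), drop i es) = \<zero>" if "i \<le> length es" for i
  proof -
    \<comment> \<open>A path with fewer than \<open>m + n\<close> arrows cannot be cut into parts
      with at least \<open>m\<close> and at least \<open>n\<close> arrows, so each summand has a
      vanishing factor.\<close>
    have "i < m \<or> length es - i < n" using that p ues by auto
    then have "f (u, take i es) = \<zero> \<or> g (Q.awlast u (take i es), drop i es) = \<zero>"
      using that filt_eq_zero[OF f, of "(u, take i es)"] filt_eq_zero[OF g, of "(_, drop i es)"]
      by auto
    then show ?thesis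
      using coeff_closed[OF filt_carrier[OF f]] coeff_closed[OF filt_carrier[OF g]] by auto
  qed
  then have "(f \<star> g) (u, es) = (\<Oplus>i\<in>{..length es}. \<zero>)"
    unfolding mult_apply by (intro K.finsum_cong') auto
  then show "(f \<star> g) p = \<zero>" using ues by simp
qed

lemma mult_apply_Nil:
  assumes "f \<in> carrier kQ" "g \<in> carrier kQ"
  shows "(f \<star> g) (u, []) = f (u, []) \<otimes> g (u, [])"
  using assms by (simp add: mult_apply)

lemma filt_list_prod:
  "set fs \<subseteq> filt 1 \<Longrightarrow> list_prod kQ fs \<in> filt (length fs)"
proof (induction fs)
  case Nil
  then show ?case by (simp add: filt_0 one_closed)
next
  case (Cons f fs)
  then show ?case using filt_mult[of f 1 "list_prod kQ fs" "length fs"] by simp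
qed

text \<open>A longer path has an initial part of length exactly \<open>N\<close>, so an ideal that
  contains the paths of length \<open>N\<close> contains all longer ones as well.\<close>

lemma filt_subset_ideal:
  assumes I: "ideal I kQ" and N: "\<And>p. \<lbrakk>is_path Q p; length (snd p) = N\<rbrakk> \<Longrightarrow> pe p \<in> I"
  shows "filt N \<subseteq> I"
proof
  interpret I: ideal I kQ by (rule I)
  fix f assume f: "f \<in> filt N"
  have pe: "pe p \<in> I" if "is_path Q p" "N \<le> length (snd p)" for p
  proof -
    obtain u es where p: "p = (u, es)" by force
    let ?q = "(u, take N es)" and ?r = "(path_end (u, take N es), drop N es)"
    have "is_path Q (u, take N es @ drop N es)" using that p by simp
    then have qr: "is_path Q ?q" "is_path Q ?r"
      unfolding is_path_append by auto
    then have "pe ?q \<star> pe ?r = pe p"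
      using p by (simp add: pe_mult)
    moreover have "pe ?q \<in> I" using qr that p by (intro N) auto
    ultimately show ?thesis
      using I.I_r_closed[of "pe ?q" "pe ?r"] qr pe_closed by simp
  qed
  show "f \<in> I" using filt_carrier[OF f]
  proof (induction f rule: path_induct)
    case zero
    then show ?case by simp
  next
    case (add a p g)
    then have "N \<le> length (snd p)" using f filt_eq_zero leI by blast
    then show ?case using add pe R.ideal_smult_closed[OF I] by simp
  qed
qed

end


section \<open>Tensor powers\<close>

locale bimod =
  fixes \<Gamma> :: "('g, 'c) ring_scheme" and M :: "('g, 'm, 'd) bimodule_scheme" (structure)
  assumes bimodule_M: "is_bimodule \<Gamma> M"
begin

sublocale \<Gamma>: ring \<Gamma>
  using bimodule_M by (simp add: is_bimodule_def)

sublocale M: abelian_group M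
  using bimodule_M by (simp add: is_bimodule_def)

lemma act_closed [simp]:
  "\<lbrakk>g \<in> carrier \<Gamma>; x \<in> carrier M\<rbrakk> \<Longrightarrow> g \<odot> x \<in> carrier M"
  "\<lbrakk>g \<in> carrier \<Gamma>; x \<in> carrier M\<rbrakk> \<Longrightarrow> x \<odot>\<^sub>r g \<in> carrier M"
  using bimodule_M by (simp_all add: is_bimodule_def)

lemma act_add:
  "\<lbrakk>g \<in> carrier \<Gamma>; x \<in> carrier M; y \<in> carrier M\<rbrakk> \<Longrightarrow> g \<odot> (x \<oplus> y) = g \<odot> x \<oplus> g \<odot> y"
  "\<lbrakk>g \<in> carrier \<Gamma>; x \<in> carrier M; y \<in> carrier M\<rbrakk> \<Longrightarrow> (x \<oplus> y) \<odot>\<^sub>r g = x \<odot>\<^sub>r g \<oplus> y \<odot>\<^sub>r g"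
  using bimodule_M by (simp_all add: is_bimodule_def)

lemma act_ring:
  assumes "g \<in> carrier \<Gamma>" "h \<in> carrier \<Gamma>" "x \<in> carrier M"
  shows "(g \<oplus>\<^bsub>\<Gamma>\<^esub> h) \<odot> x = g \<odot> x \<oplus> h \<odot> x"
    and "x \<odot>\<^sub>r (g \<oplus>\<^bsub>\<Gamma>\<^esub> h) = x \<odot>\<^sub>r g \<oplus> x \<odot>\<^sub>r h"
    and "(g \<otimes>\<^bsub>\<Gamma>\<^esub> h) \<odot> x = g \<odot> (h \<odot> x)"
    and "x \<odot>\<^sub>r (g \<otimes>\<^bsub>\<Gamma>\<^esub> h) = (x \<odot>\<^sub>r g) \<odot>\<^sub>r h"
    and "(g \<odot> x) \<odot>\<^sub>r h = g \<odot> (x \<odot>\<^sub>r h)"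
  using bimodule_M assms unfolding is_bimodule_def by blast+

lemma act_one [simp]:
  "x \<in> carrier M \<Longrightarrow> \<one>\<^bsub>\<Gamma>\<^esub> \<odot> x = x" "x \<in> carrier M \<Longrightarrow> x \<odot>\<^sub>r \<one>\<^bsub>\<Gamma>\<^esub> = x"
  using bimodule_M by (simp_all add: is_bimodule_def)

lemma act_zero [simp]:
  "g \<in> carrier \<Gamma> \<Longrightarrow> g \<odot> \<zero> = \<zero>"
  "g \<in> carrier \<Gamma> \<Longrightarrow> \<zero> \<odot>\<^sub>r g = \<zero>"
  "x \<in> carrier M \<Longrightarrow> \<zero>\<^bsub>\<Gamma>\<^esub> \<odot> x = \<zero>"
  "x \<in> carrier M \<Longrightarrow> x \<odot>\<^sub>r \<zero>\<^bsub>\<Gamma>\<^esub> = \<zero>"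
  using act_add(1)[of g "\<zero>" "\<zero>"] act_add(2)[of g "\<zero>" "\<zero>"]
    act_ring(1)[of "\<zero>\<^bsub>\<Gamma>\<^esub>" "\<zero>\<^bsub>\<Gamma>\<^esub>" x] act_ring(2)[of "\<zero>\<^bsub>\<Gamma>\<^esub>" "\<zero>\<^bsub>\<Gamma>\<^esub>" x] act_closed M.add.l_cancel_one'
  by simp_all

abbreviation "W \<equiv> tensor_words M"
abbreviation "F n \<equiv> free_Abelian_group (W n)"
abbreviation "H \<equiv> tensor_subgroup \<Gamma> M"
abbreviation "C \<equiv> tensor_coset \<Gamma> M"
abbreviation "T \<equiv> tensor_power \<Gamma> M"

section \<open>The subgroup of relations and its cosets\<close>

lemma tensor_relatorsE:
  assumes "r \<in> tensor_relators \<Gamma> M n"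
  obtains xs x y ys where "xs @ [x] @ ys \<in> W n" "y \<in> carrier M"
    "r = frag_of (xs @ [x \<oplus> y] @ ys) - frag_of (xs @ [x] @ ys) - frag_of (xs @ [y] @ ys)"
  | xs x g y ys where "xs @ [x, y] @ ys \<in> W n" "g \<in> carrier \<Gamma>"
    "r = frag_of (xs @ [x \<odot>\<^sub>r g, y] @ ys) - frag_of (xs @ [x, g \<odot> y] @ ys)"
  using assms unfolding tensor_relators_def by blast

lemma relators_carrier: "tensor_relators \<Gamma> M n \<subseteq> carrier (F n)"
proof -
  have *: "Poly_Mapping.keys (frag_of a - frag_of b) \<subseteq> W n"
    if "a \<in> W n" "b \<in> W n" for a b :: "'m list"
    using that keys_diff[of "frag_of a" "frag_of b"] by auto
  have **: "Poly_Mapping.keys (frag_of a - frag_of b - frag_of c) \<subseteq> W n"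
    if "a \<in> W n" "b \<in> W n" "c \<in> W n" for a b c :: "'m list"
    using that keys_diff[of "frag_of a - frag_of b" "frag_of c"] *[of a b] by auto
  show ?thesis
  proof
    fix r assume "r \<in> tensor_relators \<Gamma> M n"
    then show "r \<in> carrier (F n)"
    proof (cases rule: tensor_relatorsE)
      case 1
      then show ?thesis
        by (simp only: carrier_free_Abelian_group_iff) (rule **, auto simp: tensor_words_def)
    next
      case 2
      then show ?thesis
        by (simp only: carrier_free_Abelian_group_iff) (rule *, auto simp: tensor_words_def)
    qed
  qed
qed

lemma subgroup_H: "subgroup (H n) (F n)"
  unfolding tensor_subgroup_def
  by (rule group.generate_is_subgroup[OF group_free_Abelian_group relators_carrier])

lemma H_carrier: "x \<in> H n \<Longrightarrow> Poly_Mapping.keys x \<subseteq> W n"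
  using subgroup.mem_carrier[OF subgroup_H] by fastforce

lemma H_zero: "0 \<in> H n"
  using subgroup.one_closed[OF subgroup_H, of n] by simp

lemma H_plus: "\<lbrakk>x \<in> H n; y \<in> H n\<rbrakk> \<Longrightarrow> x + y \<in> H n"
  using subgroup.m_closed[OF subgroup_H, of x n y] by simp

lemma H_uminus: "x \<in> H n \<Longrightarrow> - x \<in> H n"
  using subgroup.m_inv_closed[OF subgroup_H, of x n] H_carrier by simp

lemma H_minus: "\<lbrakk>x \<in> H n; y \<in> H n\<rbrakk> \<Longrightarrow> x - y \<in> H n"
  using H_plus[of x n "- y"] H_uminus by simp

lemma H_add:
  assumes "xs @ [x] @ ys \<in> W n" "y \<in> carrier M"
  shows "frag_of (xs @ [x \<oplus> y] @ ys) - frag_of (xs @ [x] @ ys) - frag_of (xs @ [y] @ ys) \<in> H n"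
  unfolding tensor_subgroup_def
  by (rule generate.incl) (use assms in \<open>auto simp: tensor_relators_def\<close>)

lemma H_balanced:
  assumes "xs @ [x, y] @ ys \<in> W n" "g \<in> carrier \<Gamma>"
  shows "frag_of (xs @ [x \<odot>\<^sub>r g, y] @ ys) - frag_of (xs @ [x, g \<odot> y] @ ys) \<in> H n"
  unfolding tensor_subgroup_def
  by (rule generate.incl) (use assms in \<open>auto simp: tensor_relators_def\<close>)

lemma mem_C_iff: "d \<in> C n c \<longleftrightarrow> d - c \<in> H n"
  unfolding tensor_coset_def r_coset_def
  by (auto simp: algebra_simps) (metis add.commute diff_add_cancel)

lemma C_eq_iff: "C n c = C n d \<longleftrightarrow> c - d \<in> H n"
proof
  assume "C n c = C n d"
  then show "c - d \<in> H n"
    using mem_C_iff[of c n c] mem_C_iff[of c n d] H_zero by simp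
next
  assume "c - d \<in> H n"
  then have "e - c \<in> H n \<longleftrightarrow> e - d \<in> H n" for e
    using H_plus[of "e - c" n "c - d"] H_minus[of "e - d" n "c - d"] by auto
  then show "C n c = C n d" by (auto simp: mem_C_iff)
qed

lemma T_carrier: "carrier (T n) = {C n c | c. Poly_Mapping.keys c \<subseteq> W n}"
  by (auto simp: tensor_power_def Let_def FactGroup_def RCOSETS_def tensor_coset_def)

lemma T_carrierI: "Poly_Mapping.keys c \<subseteq> W n \<Longrightarrow> C n c \<in> carrier (T n)"
  using T_carrier by blast

lemma T_add:
  assumes "Poly_Mapping.keys c \<subseteq> W n" "Poly_Mapping.keys d \<subseteq> W n"
  shows "C n c \<oplus>\<^bsub>T n\<^esub> C n d = C n (c + d)"
proof -
  have "H n \<lhd> F n"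
    by (rule comm_group.subgroup_imp_normal[OF abelian_free_Abelian_group subgroup_H])
  from normal.rcos_sum[OF this, of c d] show ?thesis
    using assms by (simp add: tensor_power_def Let_def FactGroup_def tensor_coset_def)
qed

text \<open>The criterion under which \<open>tensor_map\<close> is well defined: if \<open>f\<close>
  carries both kinds of relators into the target subgroup, its additive extension carries the whole
  generated subgroup there, so the cosets in the union coincide.\<close>

lemma tensor_map_C:
  assumes words: "\<And>ms. ms \<in> W n' \<Longrightarrow> f ms \<in> W n"
    and add: "\<And>xs x y ys. \<lbrakk>xs @ [x] @ ys \<in> W n'; y \<in> carrier M\<rbrakk> \<Longrightarrow>
      frag_of (f (xs @ [x \<oplus> y] @ ys)) - frag_of (f (xs @ [x] @ ys)) - frag_of (f (xs @ [y] @ ys)) \<in> H n"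
    and bal: "\<And>xs x y ys g. \<lbrakk>xs @ [x, y] @ ys \<in> W n'; g \<in> carrier \<Gamma>\<rbrakk> \<Longrightarrow>
      frag_of (f (xs @ [x \<odot>\<^sub>r g, y] @ ys)) - frag_of (f (xs @ [x, g \<odot> y] @ ys)) \<in> H n"
  shows "tensor_map \<Gamma> M n f (C n' c) = C n (frag_extend (\<lambda>ms. frag_of (f ms)) c)"
proof -
  let ?g = "frag_extend (\<lambda>ms. frag_of (f ms))"
  have rel: "?g r \<in> H n" if r: "r \<in> tensor_relators \<Gamma> M n'" for r
    using r
  proof (cases rule: tensor_relatorsE)
    case 1
    then show ?thesis using add[OF 1(1,2)] by (simp only: frag_extend_diff frag_extend_of)
  next
    case 2
    then show ?thesis using bal[OF 2(1,2)] by (simp only: frag_extend_diff frag_extend_of)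
  qed
  have g: "?g r \<in> H n" if "r \<in> H n'" for r
    using that unfolding tensor_subgroup_def[of \<Gamma> M n']
  proof (induction r rule: generate.induct)
    case one
    then show ?case by (simp add: H_zero)
  next
    case (incl r)
    then show ?case by (rule rel)
  next
    case (inv r)
    have "r \<in> carrier (F n')"
      by (rule subsetD[OF relators_carrier inv])
    then have "Poly_Mapping.keys r \<subseteq> W n'"
      by (simp only: carrier_free_Abelian_group_iff)
    then show ?case using rel[OF inv] by (simp add: frag_extend_minus H_uminus)
  next
    case (eng r s)
    then show ?case by (simp add: frag_extend_add H_plus)
  qed
  have "C n (?g d) = C n (?g c)" if "d \<in> C n' c" for d
    using that g[of "d - c"] by (simp add: C_eq_iff mem_C_iff frag_extend_diff)
  moreover have "c \<in> C n' c" by (simp add: mem_C_iff H_zero)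
  ultimately show ?thesis unfolding tensor_map_def by blast
qed

text \<open>Relations that do not involve the first letter are carried to relations of the same
  kind. At the first letter, additivity of the left action and its commuting with the right action
  are used. Positivity of \<open>n\<close> ensures that \<open>hd\<close> meets an actual
  letter.\<close>

lemma smult_T:
  assumes g: "g \<in> carrier \<Gamma>" and n: "n > 0" and ms: "ms \<in> W n"
  shows "g \<odot>\<^bsub>T n\<^esub> C n (frag_of ms) = C n (frag_of ((g \<odot> hd ms) # tl ms))"
proof -
  have "tensor_map \<Gamma> M n (\<lambda>ms. (g \<odot> hd ms) # tl ms) (C n (frag_of ms)) =
      C n (frag_extend (\<lambda>ms. frag_of ((g \<odot> hd ms) # tl ms)) (frag_of ms))"
  proof (rule tensor_map_C, goal_cases)
    case (1 ms)
    then show ?case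
      using n g by (cases ms) (auto simp: tensor_words_def)
  next
    case (2 xs x y ys)
    show ?case
    proof (cases xs)
      case Nil
      then show ?thesis
        using 2 g H_add[of "[]" "g \<odot> x" ys n "g \<odot> y"] by (simp add: act_add tensor_words_def)
    next
      case (Cons a zs)
      then show ?thesis
        using 2 g H_add[of "(g \<odot> a) # zs" x ys n y] by (simp add: tensor_words_def)
    qed
  next
    case (3 xs x y ys h)
    show ?case
    proof (cases xs)
      case Nil
      then show ?thesis
        using 3 g H_balanced[of "[]" "g \<odot> x" y ys n h] by (simp add: act_ring(5) tensor_words_def)
    next
      case (Cons a zs)
      then show ?thesis
        using 3 g H_balanced[of "(g \<odot> a) # zs" x y ys n h] by (simp add: tensor_words_def)
    qed
  qed
  then show ?thesis by (simp add: tensor_power_def Let_def)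
qed

lemma rsmult_T:
  assumes g: "g \<in> carrier \<Gamma>" and n: "n > 0" and ms: "ms \<in> W n"
  shows "C n (frag_of ms) \<odot>\<^sub>r\<^bsub>T n\<^esub> g = C n (frag_of (butlast ms @ [last ms \<odot>\<^sub>r g]))"
proof -
  have "tensor_map \<Gamma> M n (\<lambda>ms. butlast ms @ [last ms \<odot>\<^sub>r g]) (C n (frag_of ms)) =
      C n (frag_extend (\<lambda>ms. frag_of (butlast ms @ [last ms \<odot>\<^sub>r g])) (frag_of ms))"
  proof (rule tensor_map_C, goal_cases)
    case (1 ms)
    then show ?case
      using n g by (cases ms rule: rev_cases) (auto simp: tensor_words_def)
  next
    case (2 xs x y ys)
    show ?case
    proof (cases ys rule: rev_cases)
      case Nil
      then show ?thesis
        using 2 g H_add[of xs "x \<odot>\<^sub>r g" "[]" n "y \<odot>\<^sub>r g"] by (simp add: act_add tensor_words_def)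
    next
      case (snoc zs a)
      then show ?thesis
        using 2 g H_add[of xs x "zs @ [a \<odot>\<^sub>r g]" n y] by (simp add: tensor_words_def butlast_append)
    qed
  next
    case (3 xs x y ys h)
    show ?case
    proof (cases ys rule: rev_cases)
      case Nil
      then show ?thesis
        using 3 g H_balanced[of xs x "y \<odot>\<^sub>r g" "[]" n h]
        by (simp add: act_ring(5) tensor_words_def butlast_append)
    next
      case (snoc zs a)
      then show ?thesis
        using 3 g H_balanced[of xs x y "zs @ [a \<odot>\<^sub>r g]" n h]
        by (simp add: tensor_words_def butlast_append)
    qed
  qed
  then show ?thesis by (simp add: tensor_power_def Let_def)
qed

lemma pure_tensor_C: "ms \<in> W n \<Longrightarrow> pure_tensor \<Gamma> M ms = C n (frag_of ms)"
  by (simp add: pure_tensor_def tensor_words_def)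

text \<open>Makes the definite description in \<open>theta_power\<close> at \<open>0\<close>
  meaningful. The universal property of the free abelian group gives an additive map
  \<open>h\<close> that sends the one-letter word of \<open>x\<close> to \<open>x\<close>. It kills
  all relators, since a balancing relator needs two letters and only additivity is left.\<close>

lemma pure_tensor_single_inject:
  assumes "x \<in> carrier M" "y \<in> carrier M" "pure_tensor \<Gamma> M [x] = pure_tensor \<Gamma> M [y]"
  shows "x = y"
proof -
  have "hd ` W 1 \<subseteq> carrier (add_monoid M)"
    by (auto simp: tensor_words_def length_Suc_conv)
  from comm_group.free_Abelian_group_universal[OF M.a_comm_group this] obtain h
    where h: "h \<in> hom (F 1) (add_monoid M)" "\<And>ms. ms \<in> W 1 \<Longrightarrow> h (frag_of ms) = hd ms" by metis
  interpret h: group_hom "F 1" "add_monoid M" h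
    using h(1) by (simp add: group_hom_def group_hom_axioms_def M.a_group)
  have h_diff: "h (a - b) = h a \<ominus> h b"
    if "Poly_Mapping.keys a \<subseteq> W 1" "Poly_Mapping.keys b \<subseteq> W 1" for a b
  proof -
    have ab: "a \<in> carrier (F 1)" "b \<in> carrier (F 1)"
      using that by simp_all
    have "a - b = a \<otimes>\<^bsub>F 1\<^esub> inv\<^bsub>F 1\<^esub> b"
      using that by (simp only: inv_free_Abelian_group mult_free_Abelian_group diff_conv_add_uminus)
    then have "h (a - b) = h (a \<otimes>\<^bsub>F 1\<^esub> inv\<^bsub>F 1\<^esub> b)" by (rule arg_cong)
    also have "\<dots> = h a \<oplus> h (inv\<^bsub>F 1\<^esub> b)"
      using h.hom_mult[OF ab(1) h.G.inv_closed[OF ab(2)]] by simp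
    also have "\<dots> = h a \<ominus> h b"
      unfolding h.hom_inv[OF ab(2)] a_minus_def a_inv_def ..
    finally show ?thesis .
  qed
  have rel: "h r = \<zero>" if "r \<in> tensor_relators \<Gamma> M 1" for r
  proof -
    from that obtain a b where ab: "a \<in> carrier M" "b \<in> carrier M"
        "r = frag_of [a \<oplus> b] - frag_of [a] - frag_of [b]"
      by (auto simp: tensor_relators_def tensor_words_def)
    then have W: "[a \<oplus> b] \<in> W 1" "[a] \<in> W 1" "[b] \<in> W 1"
      by (simp_all add: tensor_words_def)
    then have "Poly_Mapping.keys (frag_of [a \<oplus> b] - frag_of [a]) \<subseteq> W 1"
      using keys_diff[of "frag_of [a \<oplus> b]" "frag_of [a]"] by auto
    then have "h r = a \<oplus> b \<ominus> a \<ominus> b"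
      using W ab by (simp add: h_diff h(2))
    also have "\<dots> = \<zero>"
      using ab by (simp add: a_minus_def M.a_assoc M.a_comm[of a] M.r_neg1 M.r_neg)
    finally show ?thesis .
  qed
  have "h r = \<zero>" if "r \<in> H 1" for r
    using that unfolding tensor_subgroup_def
  proof (induction r rule: generate.induct)
    case one
    then show ?case using h.hom_one by simp
  next
    case (incl r)
    then show ?case by (rule rel)
  next
    case (inv r)
    have "r \<in> carrier (F 1)" by (rule subsetD[OF relators_carrier inv])
    then have "h (inv\<^bsub>F 1\<^esub> r) = \<ominus> h r" by (simp only: h.hom_inv a_inv_def)
    then show ?case using rel[OF inv] by simp
  next
    case (eng r s)
    then show ?case
      using h.hom_mult[of r s] H_carrier[of r 1] H_carrier[of s 1] by (simp add: tensor_subgroup_def)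
  qed
  moreover have "frag_of [x] - frag_of [y] \<in> H 1"
    using assms pure_tensor_C[of "[x]" 1] pure_tensor_C[of "[y]" 1]
    by (simp add: tensor_words_def C_eq_iff)
  ultimately have "h (frag_of [x] - frag_of [y]) = \<zero>" by blast
  then have "x \<ominus> y = \<zero>"
    using assms by (simp add: h_diff h(2) tensor_words_def)
  then show ?thesis using assms by simp
qed

end


section \<open>The split extension\<close>

locale mult_bimod = \<Gamma>: k_algebra K \<Gamma> + bimod \<Gamma> M
  for K :: "('k, 'b) ring_scheme" and \<Gamma> :: "('k, 'g, 'c) module_scheme"
    and M :: "('g, 'm, 'd) bimodule_scheme" (structure) +
  fixes \<theta> :: "'m tensor_fun"
  assumes multiplicative: "multiplicative_bimodule K \<Gamma> M \<theta>"
begin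

text \<open>The biadditive balanced product on M that \<theta> encodes. All further algebra is done
  with it, and tensors reappear only where nilpotency is unfolded.\<close>

definition \<mu> :: "'m \<Rightarrow> 'm \<Rightarrow> 'm" where
  "\<mu> x y = \<theta> (pure_tensor \<Gamma> M [x, y])"

lemma W2: "\<lbrakk>x \<in> carrier M; y \<in> carrier M\<rbrakk> \<Longrightarrow> [x, y] \<in> W 2"
  by (simp add: tensor_words_def)

lemma \<mu>_C: "\<lbrakk>x \<in> carrier M; y \<in> carrier M\<rbrakk> \<Longrightarrow> \<mu> x y = \<theta> (C 2 (frag_of [x, y]))"
  using pure_tensor_C[OF W2] by (simp add: \<mu>_def)

lemma \<theta>_hom: "\<theta> \<in> bimodule_hom \<Gamma> (T 2) M"
  using multiplicative by (simp add: multiplicative_bimodule_def)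

lemma \<theta>_closed: "Poly_Mapping.keys c \<subseteq> W 2 \<Longrightarrow> \<theta> (C 2 c) \<in> carrier M"
  using \<theta>_hom T_carrierI[of c 2] by (simp add: bimodule_hom_def)

lemma \<theta>_add:
  assumes "Poly_Mapping.keys c \<subseteq> W 2" "Poly_Mapping.keys d \<subseteq> W 2"
  shows "\<theta> (C 2 (c + d)) = \<theta> (C 2 c) \<oplus> \<theta> (C 2 d)"
proof -
  have "\<theta> (X \<oplus>\<^bsub>T 2\<^esub> Y) = \<theta> X \<oplus> \<theta> Y" if "X \<in> carrier (T 2)" "Y \<in> carrier (T 2)" for X Y
    using \<theta>_hom that by (simp add: bimodule_hom_def)
  from this[OF T_carrierI[OF assms(1)] T_carrierI[OF assms(2)]] show ?thesis
    by (simp only: T_add[OF assms])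
qed

lemma \<theta>_zero: "\<theta> (C 2 0) = \<zero>"
  using \<theta>_add[of 0 0] \<theta>_closed[of 0] M.add.l_cancel_one' by simp

lemma \<theta>_diff:
  assumes "Poly_Mapping.keys c \<subseteq> W 2" "Poly_Mapping.keys d \<subseteq> W 2"
  shows "\<theta> (C 2 (c - d)) = \<theta> (C 2 c) \<ominus> \<theta> (C 2 d)"
proof -
  have k: "Poly_Mapping.keys (c - d) \<subseteq> W 2"
    using assms keys_diff[of c d] by blast
  have "\<theta> (C 2 c) = \<theta> (C 2 (c - d)) \<oplus> \<theta> (C 2 d)"
    using \<theta>_add[OF k assms(2)] by simp
  then show ?thesis
    using \<theta>_closed[OF k] \<theta>_closed[OF assms(2)] by (simp add: a_minus_def M.a_assoc M.r_neg)
qed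

lemma \<mu>_closed [simp]: "\<lbrakk>x \<in> carrier M; y \<in> carrier M\<rbrakk> \<Longrightarrow> \<mu> x y \<in> carrier M"
  using \<theta>_closed[of "frag_of [x, y]"] W2[of x y] by (simp add: \<mu>_C)

lemma keys_W2: "\<lbrakk>x \<in> carrier M; y \<in> carrier M\<rbrakk> \<Longrightarrow> Poly_Mapping.keys (frag_of [x, y]) \<subseteq> W 2"
  using W2 by simp

lemma H2_add_l:
  assumes "x \<in> carrier M" "y \<in> carrier M" "z \<in> carrier M"
  shows "frag_of [x \<oplus> y, z] - frag_of [x, z] - frag_of [y, z] \<in> H 2"
  using H_add[of "[]" x "[z]" 2 y] W2 assms by simp

lemma H2_add_r:
  assumes "x \<in> carrier M" "y \<in> carrier M" "z \<in> carrier M"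
  shows "frag_of [z, x \<oplus> y] - frag_of [z, x] - frag_of [z, y] \<in> H 2"
  using H_add[of "[z]" x "[]" 2 y] W2 assms by simp

lemma H2_balanced:
  assumes "x \<in> carrier M" "y \<in> carrier M" "g \<in> carrier \<Gamma>"
  shows "frag_of [x \<odot>\<^sub>r g, y] - frag_of [x, g \<odot> y] \<in> H 2"
  using H_balanced[of "[]" x y "[]" 2 g] W2 assms by simp

lemma \<mu>_add_l:
  assumes "x \<in> carrier M" "y \<in> carrier M" "z \<in> carrier M"
  shows "\<mu> (x \<oplus> y) z = \<mu> x z \<oplus> \<mu> y z"
proof -
  have "frag_of [x \<oplus> y, z] - (frag_of [x, z] + frag_of [y, z]) \<in> H 2"
    using H2_add_l[OF assms] by (simp add: diff_diff_eq)
  then have "C 2 (frag_of [x \<oplus> y, z]) = C 2 (frag_of [x, z] + frag_of [y, z])"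
    by (simp only: C_eq_iff)
  then show ?thesis
    using assms keys_W2 by (simp add: \<mu>_C \<theta>_add del: keys_frag_of)
qed

lemma \<mu>_add_r:
  assumes "x \<in> carrier M" "y \<in> carrier M" "z \<in> carrier M"
  shows "\<mu> z (x \<oplus> y) = \<mu> z x \<oplus> \<mu> z y"
proof -
  have "frag_of [z, x \<oplus> y] - (frag_of [z, x] + frag_of [z, y]) \<in> H 2"
    using H2_add_r[OF assms] by (simp add: diff_diff_eq)
  then have "C 2 (frag_of [z, x \<oplus> y]) = C 2 (frag_of [z, x] + frag_of [z, y])"
    by (simp only: C_eq_iff)
  then show ?thesis
    using assms keys_W2 by (simp add: \<mu>_C \<theta>_add del: keys_frag_of)
qed

lemma \<mu>_zero [simp]:
  "x \<in> carrier M \<Longrightarrow> \<mu> \<zero> x = \<zero>"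
  "x \<in> carrier M \<Longrightarrow> \<mu> x \<zero> = \<zero>"
  using \<mu>_add_l[of "\<zero>" "\<zero>" x] \<mu>_add_r[of "\<zero>" "\<zero>" x] M.add.l_cancel_one' by simp_all

lemma \<mu>_balanced:
  assumes "x \<in> carrier M" "y \<in> carrier M" "g \<in> carrier \<Gamma>"
  shows "\<mu> (x \<odot>\<^sub>r g) y = \<mu> x (g \<odot> y)"
proof -
  have "C 2 (frag_of [x \<odot>\<^sub>r g, y]) = C 2 (frag_of [x, g \<odot> y])"
    using H2_balanced[OF assms] by (simp only: C_eq_iff)
  then show ?thesis using assms by (simp add: \<mu>_C)
qed

lemma \<mu>_act_l:
  assumes "x \<in> carrier M" "y \<in> carrier M" "g \<in> carrier \<Gamma>"
  shows "\<mu> (g \<odot> x) y = g \<odot> \<mu> x y"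
proof -
  have "C 2 (frag_of [x, y]) \<in> carrier (T 2)"
    using assms keys_W2 by (intro T_carrierI)
  then have "\<theta> (g \<odot>\<^bsub>T 2\<^esub> C 2 (frag_of [x, y])) = g \<odot> \<theta> (C 2 (frag_of [x, y]))"
    using \<theta>_hom assms(3) by (simp add: bimodule_hom_def)
  then show ?thesis using assms smult_T[of g 2 "[x, y]"] W2 by (simp add: \<mu>_C)
qed

lemma \<mu>_act_r:
  assumes "x \<in> carrier M" "y \<in> carrier M" "g \<in> carrier \<Gamma>"
  shows "\<mu> x (y \<odot>\<^sub>r g) = \<mu> x y \<odot>\<^sub>r g"
proof -
  have "C 2 (frag_of [x, y]) \<in> carrier (T 2)"
    using assms keys_W2 by (intro T_carrierI)
  then have "\<theta> (C 2 (frag_of [x, y]) \<odot>\<^sub>r\<^bsub>T 2\<^esub> g) = \<theta> (C 2 (frag_of [x, y])) \<odot>\<^sub>r g"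
    using \<theta>_hom assms(3) by (simp add: bimodule_hom_def)
  then show ?thesis using assms rsmult_T[of g 2 "[x, y]"] W2 by (simp add: \<mu>_C)
qed

lemma W3_cases:
  assumes "xs @ [x] @ ys \<in> W 3"
  obtains a b where "xs = []" "ys = [a, b]" | a b where "xs = [a]" "ys = [b]" | a b where "xs = [a, b]" "ys = []"
  using assms by (auto simp: tensor_words_def numeral_3_eq_3 length_Suc_conv append_eq_Cons_conv)

lemma W3_cases2:
  assumes "xs @ [x, y] @ ys \<in> W 3"
  obtains a where "xs = []" "ys = [a]" | a where "xs = [a]" "ys = []"
  using assms by (auto simp: tensor_words_def numeral_3_eq_3 length_Suc_conv append_eq_Cons_conv)

text \<open>This is the assumed associativity of \<theta>, evaluated at a pure tensor of three
  factors. To evaluate it, both bracketings must be compatible with the relators, which is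
  biadditivity and balancedness of \<open>\<mu>\<close> and its compatibility with the outer
  actions.\<close>

lemma \<mu>_assoc:
  assumes xyz: "x \<in> carrier M" "y \<in> carrier M" "z \<in> carrier M"
  shows "\<mu> (\<mu> x y) z = \<mu> x (\<mu> y z)"
proof -
  let ?l = "\<lambda>ms. [\<theta> (pure_tensor \<Gamma> M [ms ! 0, ms ! 1]), ms ! 2]"
  let ?r = "\<lambda>ms. [ms ! 0, \<theta> (pure_tensor \<Gamma> M [ms ! 1, ms ! 2])]"
  have W3: "[x, y, z] \<in> W 3" using xyz by (simp add: tensor_words_def)
  have l: "tensor_map \<Gamma> M 2 ?l (C 3 (frag_of [x, y, z])) = C 2 (frag_extend (\<lambda>ms. frag_of (?l ms)) (frag_of [x, y, z]))"
    unfolding \<mu>_def[symmetric]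
  proof (rule tensor_map_C, goal_cases)
    case (1 ms)
    then show ?case by (auto simp: tensor_words_def numeral_3_eq_3 numeral_2_eq_2 length_Suc_conv)
  next
    case (2 xs x y ys)
    from 2(1) show ?case
      using 2 by (cases rule: W3_cases) (auto simp: tensor_words_def \<mu>_add_l \<mu>_add_r intro!: H2_add_l H2_add_r)
  next
    case (3 xs x y ys g)
    from 3(1) show ?case
      using 3 by (cases rule: W3_cases2)
        (auto simp: tensor_words_def \<mu>_balanced \<mu>_act_r H_zero intro!: H2_balanced)
  qed
  have r: "tensor_map \<Gamma> M 2 ?r (C 3 (frag_of [x, y, z])) = C 2 (frag_extend (\<lambda>ms. frag_of (?r ms)) (frag_of [x, y, z]))"
    unfolding \<mu>_def[symmetric]
  proof (rule tensor_map_C, goal_cases)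
    case (1 ms)
    then show ?case by (auto simp: tensor_words_def numeral_3_eq_3 numeral_2_eq_2 length_Suc_conv)
  next
    case (2 xs x y ys)
    from 2(1) show ?case
      using 2 by (cases rule: W3_cases) (auto simp: tensor_words_def \<mu>_add_l \<mu>_add_r intro!: H2_add_l H2_add_r)
  next
    case (3 xs x y ys g)
    from 3(1) show ?case
      using 3 by (cases rule: W3_cases2)
        (auto simp: tensor_words_def \<mu>_balanced \<mu>_act_l H_zero intro!: H2_balanced)
  qed
  have "C 3 (frag_of [x, y, z]) \<in> carrier (T 3)"
    using W3 by (intro T_carrierI) simp
  then have "\<theta> (tensor_map \<Gamma> M 2 ?l (C 3 (frag_of [x, y, z]))) = \<theta> (tensor_map \<Gamma> M 2 ?r (C 3 (frag_of [x, y, z])))"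
    using multiplicative unfolding multiplicative_bimodule_def by blast
  then show ?thesis
    unfolding l r using xyz \<mu>_C[of "\<mu> x y" z] \<mu>_C[of x "\<mu> y z"]
    by (simp add: \<mu>_def[symmetric])
qed

section \<open>The split extension as an algebra\<close>

abbreviation "E \<equiv> split_extension \<Gamma> M \<theta>"

abbreviation E_times (infixl \<open>\<cdot>\<close> 70) where "x \<cdot> y \<equiv> x \<otimes>\<^bsub>E\<^esub> y"

abbreviation "scal a \<equiv> a \<odot>\<^bsub>\<Gamma>\<^esub> \<one>\<^bsub>\<Gamma>\<^esub>"

lemma E_carrier: "carrier E = carrier \<Gamma> \<times> carrier M"
  by (simp add: split_extension_def)

lemma E_mult:
  "(g, m) \<cdot> (h, n) = (g \<otimes>\<^bsub>\<Gamma>\<^esub> h, g \<odot> n \<oplus> m \<odot>\<^sub>r h \<oplus> \<mu> m n)"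
  by (simp add: split_extension_def \<mu>_def)

lemma E_add: "(g, m) \<oplus>\<^bsub>E\<^esub> (h, n) = (g \<oplus>\<^bsub>\<Gamma>\<^esub> h, m \<oplus> n)"
  by (simp add: split_extension_def)

lemma E_one: "\<one>\<^bsub>E\<^esub> = (\<one>\<^bsub>\<Gamma>\<^esub>, \<zero>)"
  by (simp add: split_extension_def)

lemma E_zero: "\<zero>\<^bsub>E\<^esub> = (\<zero>\<^bsub>\<Gamma>\<^esub>, \<zero>)"
  by (simp add: split_extension_def)

lemma E_smult: "a \<odot>\<^bsub>E\<^esub> (g, m) = (a \<odot>\<^bsub>\<Gamma>\<^esub> g, scal a \<odot> m)"
  by (simp add: split_extension_def scalar_restriction_def)

lemma central: "\<lbrakk>a \<in> carrier K; x \<in> carrier M\<rbrakk> \<Longrightarrow>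
    x \<odot>\<^sub>r scal a = scal a \<odot> x"
  using multiplicative by (simp add: multiplicative_bimodule_def central_action_def)

lemma scalar_mult: "\<lbrakk>a \<in> carrier K; g \<in> carrier \<Gamma>\<rbrakk> \<Longrightarrow> a \<odot>\<^bsub>\<Gamma>\<^esub> g = scal a \<otimes>\<^bsub>\<Gamma>\<^esub> g"
  by (simp add: \<Gamma>.smult_mult_l)

lemma scalar_mult_r: "\<lbrakk>a \<in> carrier K; g \<in> carrier \<Gamma>\<rbrakk> \<Longrightarrow> a \<odot>\<^bsub>\<Gamma>\<^esub> g = g \<otimes>\<^bsub>\<Gamma>\<^esub> scal a"
  by (simp add: \<Gamma>.smult_mult_r)

lemma E_abelian_group: "abelian_group E"
proof (rule abelian_groupI)
  fix x assume "x \<in> carrier E"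
  then obtain g m where "x = (g, m)" "g \<in> carrier \<Gamma>" "m \<in> carrier M" by (auto simp: E_carrier)
  then show "\<exists>y\<in>carrier E. y \<oplus>\<^bsub>E\<^esub> x = \<zero>\<^bsub>E\<^esub>"
    by (intro bexI[of _ "(\<ominus>\<^bsub>\<Gamma>\<^esub> g, \<ominus> m)"]) (simp_all add: E_carrier E_add E_zero \<Gamma>.l_neg M.l_neg)
qed (auto simp: E_carrier E_add E_zero \<Gamma>.a_ac M.a_ac)

lemma E_ring: "ring E"
proof (intro ringI E_abelian_group monoidI)
  fix x y z assume "x \<in> carrier E" "y \<in> carrier E" "z \<in> carrier E"
  then obtain g h k l m n where
      "x = (g, l)" "y = (h, m)" "z = (k, n)"
      and cl: "g \<in> carrier \<Gamma>" "h \<in> carrier \<Gamma>" "k \<in> carrier \<Gamma>" "l \<in> carrier M" "m \<in> carrier M" "n \<in> carrier M"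
    by (auto simp: E_carrier)
  note eq = \<open>x = _\<close> \<open>y = _\<close> \<open>z = _\<close>
  show "(x \<cdot> y) \<cdot> z = x \<cdot> (y \<cdot> z)"
    unfolding eq using cl
    by (simp add: E_mult \<Gamma>.m_assoc act_add act_ring \<mu>_add_l \<mu>_add_r \<mu>_balanced \<mu>_act_l \<mu>_act_r
        \<mu>_assoc M.a_ac)
  show "(x \<oplus>\<^bsub>E\<^esub> y) \<cdot> z = x \<cdot> z \<oplus>\<^bsub>E\<^esub> y \<cdot> z"
    unfolding eq using cl
    by (simp add: E_mult E_add \<Gamma>.l_distr act_add act_ring \<mu>_add_l M.a_ac)
  show "z \<cdot> (x \<oplus>\<^bsub>E\<^esub> y) = z \<cdot> x \<oplus>\<^bsub>E\<^esub> z \<cdot> y"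
    unfolding eq using cl
    by (simp add: E_mult E_add \<Gamma>.r_distr act_add act_ring \<mu>_add_r M.a_ac)
qed (auto simp: E_carrier E_mult E_one)

lemma E_assoc_algebra: "assoc_algebra K E"
  unfolding assoc_algebra_def
proof (intro conjI ballI)
  have "Module.module K E"
  proof (rule moduleI)
    fix a b x assume ab: "a \<in> carrier K" "b \<in> carrier K" and "x \<in> carrier E"
    then obtain g m where x: "x = (g, m)" "g \<in> carrier \<Gamma>" "m \<in> carrier M" by (auto simp: E_carrier)
    show "(a \<oplus>\<^bsub>K\<^esub> b) \<odot>\<^bsub>E\<^esub> x = a \<odot>\<^bsub>E\<^esub> x \<oplus>\<^bsub>E\<^esub> b \<odot>\<^bsub>E\<^esub> x"
      using ab x by (simp add: E_smult E_add \<Gamma>.V.smult_l_distr act_ring)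
    have "(a \<otimes>\<^bsub>K\<^esub> b) \<odot>\<^bsub>\<Gamma>\<^esub> \<one>\<^bsub>\<Gamma>\<^esub> = scal a \<otimes>\<^bsub>\<Gamma>\<^esub> scal b"
      using ab by (simp add: \<Gamma>.V.smult_assoc1 \<Gamma>.smult_mult_l)
    then show "(a \<otimes>\<^bsub>K\<^esub> b) \<odot>\<^bsub>E\<^esub> x = a \<odot>\<^bsub>E\<^esub> (b \<odot>\<^bsub>E\<^esub> x)"
      using ab x by (simp add: E_smult \<Gamma>.V.smult_assoc1 act_ring)
  qed (auto simp: \<Gamma>.V.R.is_cring E_abelian_group E_carrier E_smult E_add \<Gamma>.V.smult_r_distr act_add)
  then show "vectorspace K E"
    by (intro vectorspace.intro \<Gamma>.V.field_axioms)
  show "ring E" by (rule E_ring)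
next
  fix a x y assume a: "a \<in> carrier K" and "x \<in> carrier E" "y \<in> carrier E"
  then obtain g h m n where xy: "x = (g, m)" "y = (h, n)"
      and cl: "g \<in> carrier \<Gamma>" "h \<in> carrier \<Gamma>" "m \<in> carrier M" "n \<in> carrier M"
    by (auto simp: E_carrier)
  let ?a = "a \<odot>\<^bsub>\<Gamma>\<^esub> \<one>\<^bsub>\<Gamma>\<^esub>"
  have a': "?a \<in> carrier \<Gamma>" using a by simp
  have 0: "(a \<odot>\<^bsub>\<Gamma>\<^esub> g) \<odot> n = ?a \<odot> (g \<odot> n)"
    unfolding scalar_mult[OF a cl(1)] by (rule act_ring(3)[OF a' cl(1,4)])
  show "(a \<odot>\<^bsub>E\<^esub> x) \<cdot> y = a \<odot>\<^bsub>E\<^esub> (x \<cdot> y)"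
    unfolding xy using cl a a'
    by (simp add: E_mult E_smult \<Gamma>.smult_mult_l act_add act_ring(5) \<mu>_act_l 0)
  \<comment> \<open>Scalars act on the left, so a scalar in the second factor must be moved to the
    front: past \<open>g\<close> because it is central in \<Gamma>, past \<open>m\<close> by
    \<open>central\<close>, and out of \<open>\<mu>\<close> by balancedness followed by
    \<open>central\<close>.\<close>
  have 1: "g \<odot> (?a \<odot> n) = ?a \<odot> (g \<odot> n)"
  proof -
    have "g \<odot> (?a \<odot> n) = (g \<otimes>\<^bsub>\<Gamma>\<^esub> ?a) \<odot> n"
      by (rule act_ring(3)[OF cl(1) a' cl(4), symmetric])
    then show ?thesis unfolding scalar_mult_r[OF a cl(1), symmetric] 0 .
  qed
  have 2: "m \<odot>\<^sub>r (a \<odot>\<^bsub>\<Gamma>\<^esub> h) = ?a \<odot> (m \<odot>\<^sub>r h)"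
  proof -
    have "m \<odot>\<^sub>r (a \<odot>\<^bsub>\<Gamma>\<^esub> h) = (m \<odot>\<^sub>r ?a) \<odot>\<^sub>r h"
      unfolding scalar_mult[OF a cl(2)] by (rule act_ring(4)[OF a' cl(2,3)])
    then show ?thesis using cl a a' by (simp add: central act_ring(5))
  qed
  have 3: "\<mu> m (?a \<odot> n) = ?a \<odot> \<mu> m n"
    unfolding \<mu>_balanced[OF cl(3,4) a', symmetric] central[OF a cl(3)]
    by (rule \<mu>_act_l[OF cl(3,4) a'])
  show "x \<cdot> (a \<odot>\<^bsub>E\<^esub> y) = a \<odot>\<^bsub>E\<^esub> (x \<cdot> y)"
    unfolding xy using cl a a'
    by (simp add: E_mult E_smult \<Gamma>.smult_mult_r act_add 1 2 3)
qed

sublocale E: k_algebra K E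
  using E_assoc_algebra by unfold_locales

end


section \<open>Nilpotency in terms of products\<close>

context mult_bimod
begin

definition \<iota> :: "'m \<Rightarrow> 'g \<times> 'm" where
  "\<iota> m = (\<zero>\<^bsub>\<Gamma>\<^esub>, m)"

text \<open>The product of a word over M, computed in E so that associativity and distributivity
  come from the ring structure. On the empty word it takes the default value \<open>\<zero>\<close>,
  the second component of the unit.\<close>

definition mprod :: "'m list \<Rightarrow> 'm" where
  "mprod ms = snd (list_prod E (map \<iota> ms))"

lemma \<iota>_closed: "m \<in> carrier M \<Longrightarrow> \<iota> m \<in> carrier E"
  by (simp add: \<iota>_def E_carrier)

lemma \<iota>_list_closed: "set ms \<subseteq> carrier M \<Longrightarrow> set (map \<iota> ms) \<subseteq> carrier E"
  using \<iota>_closed by auto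

lemma \<iota>_mult: "\<lbrakk>x \<in> carrier M; y \<in> carrier M\<rbrakk> \<Longrightarrow> \<iota> x \<cdot> \<iota> y = \<iota> (\<mu> x y)"
  by (simp add: \<iota>_def E_mult)

lemma \<iota>_add: "\<iota> (x \<oplus> y) = \<iota> x \<oplus>\<^bsub>E\<^esub> \<iota> y"
  by (simp add: \<iota>_def E_add)

lemma \<iota>_act:
  assumes "x \<in> carrier M" "g \<in> carrier \<Gamma>"
  shows "\<iota> (g \<odot> x) = (g, \<zero>) \<cdot> \<iota> x" "\<iota> (x \<odot>\<^sub>r g) = \<iota> x \<cdot> (g, \<zero>)"
  using assms by (simp_all add: \<iota>_def E_mult)

lemma list_prod_\<iota>:
  assumes "ms \<noteq> []" "set ms \<subseteq> carrier M"
  shows "list_prod E (map \<iota> ms) = \<iota> (mprod ms)" "mprod ms \<in> carrier M"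
proof -
  have "\<exists>m\<in>carrier M. list_prod E (map \<iota> ms) = \<iota> m" using assms
  proof (induction ms)
    case (Cons x ms)
    show ?case
    proof (cases "ms = []")
      case True
      then show ?thesis using Cons \<iota>_closed[of x] by auto
    next
      case False
      then show ?thesis using Cons \<iota>_mult \<mu>_closed by fastforce
    qed
  qed simp
  then obtain m where "m \<in> carrier M" "list_prod E (map \<iota> ms) = \<iota> m" by blast
  then show "list_prod E (map \<iota> ms) = \<iota> (mprod ms)" "mprod ms \<in> carrier M"
    by (simp_all add: mprod_def \<iota>_def)
qed

lemma mprod_eqI:
  assumes "list_prod E (map \<iota> ms) = \<iota> m"
  shows "mprod ms = m"
  using assms by (simp add: mprod_def \<iota>_def)

lemma mprod_single: "x \<in> carrier M \<Longrightarrow> mprod [x] = x"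
  by (rule mprod_eqI) (simp add: \<iota>_closed)

lemma mprod_snoc:
  assumes "xs \<noteq> []" "set xs \<subseteq> carrier M" "x \<in> carrier M"
  shows "mprod (xs @ [x]) = \<mu> (mprod xs) x"
proof (rule mprod_eqI)
  have "list_prod E (map \<iota> (xs @ [x])) = list_prod E (map \<iota> xs) \<cdot> \<iota> x"
    using \<iota>_list_closed[OF assms(2)] \<iota>_closed[OF assms(3)] by (simp add: E.list_prod_append)
  then show "list_prod E (map \<iota> (xs @ [x])) = \<iota> (\<mu> (mprod xs) x)"
    using list_prod_\<iota>[OF assms(1,2)] assms(3) by (simp add: \<iota>_mult)
qed

lemma list_prod_middle:
  assumes "set xs \<subseteq> carrier M" "x \<in> carrier M" "set ys \<subseteq> carrier M"
  shows "list_prod E (map \<iota> (xs @ [x] @ ys)) =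
    list_prod E (map \<iota> xs) \<cdot> (\<iota> x \<cdot> list_prod E (map \<iota> ys))"
  using \<iota>_list_closed[OF assms(1)] \<iota>_list_closed[OF assms(3)] \<iota>_closed[OF assms(2)]
  by (simp add: E.list_prod_append)

lemma list_prod_map_closed: "set xs \<subseteq> carrier M \<Longrightarrow> list_prod E (map \<iota> xs) \<in> carrier E"
  by (intro E.list_prod_closed \<iota>_list_closed)

lemma mprod_add:
  assumes "set xs \<subseteq> carrier M" "x \<in> carrier M" "y \<in> carrier M" "set ys \<subseteq> carrier M"
  shows "mprod (xs @ [x \<oplus> y] @ ys) = mprod (xs @ [x] @ ys) \<oplus> mprod (xs @ [y] @ ys)"
proof (rule mprod_eqI)
  have "list_prod E (map \<iota> (xs @ [x \<oplus> y] @ ys)) =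
      list_prod E (map \<iota> (xs @ [x] @ ys)) \<oplus>\<^bsub>E\<^esub> list_prod E (map \<iota> (xs @ [y] @ ys))"
    using assms list_prod_map_closed[of xs] list_prod_map_closed[of ys] \<iota>_closed[of x] \<iota>_closed[of y]
    by (simp only: list_prod_middle M.a_closed \<iota>_add E.l_distr E.r_distr E.m_closed)
  then show "list_prod E (map \<iota> (xs @ [x \<oplus> y] @ ys)) =
      \<iota> (mprod (xs @ [x] @ ys) \<oplus> mprod (xs @ [y] @ ys))"
    using assms list_prod_\<iota>(1)[of "xs @ [x] @ ys"] list_prod_\<iota>(1)[of "xs @ [y] @ ys"]
    by (simp add: \<iota>_add)
qed

lemma mprod_rsmult:
  assumes "set xs \<subseteq> carrier M" "x \<in> carrier M" "g \<in> carrier \<Gamma>"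
  shows "mprod (xs @ [x \<odot>\<^sub>r g]) = mprod (xs @ [x]) \<odot>\<^sub>r g"
proof (cases "xs = []")
  case False
  then show ?thesis
    using assms list_prod_\<iota>(2)[of xs] by (simp add: mprod_snoc \<mu>_act_r)
qed (use assms in \<open>simp add: mprod_single\<close>)

text \<open>In E both actions are multiplication by \<open>(g, \<zero>)\<close>, so balancedness is
  an instance of associativity.\<close>

lemma mprod_balanced:
  assumes "set xs \<subseteq> carrier M" "x \<in> carrier M" "y \<in> carrier M" "set ys \<subseteq> carrier M" "g \<in> carrier \<Gamma>"
  shows "mprod (xs @ [x \<odot>\<^sub>r g, y] @ ys) = mprod (xs @ [x, g \<odot> y] @ ys)"
proof -
  have g: "(g, \<zero>) \<in> carrier E" using assms by (simp add: E_carrier)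
  have "list_prod E (map \<iota> (xs @ [x \<odot>\<^sub>r g] @ (y # ys))) =
      list_prod E (map \<iota> xs) \<cdot> (\<iota> (x \<odot>\<^sub>r g) \<cdot> (\<iota> y \<cdot> list_prod E (map \<iota> ys)))"
    using assms by (subst list_prod_middle) simp_all
  also have "\<dots> = list_prod E (map \<iota> xs) \<cdot>
      (\<iota> x \<cdot> (\<iota> (g \<odot> y) \<cdot> list_prod E (map \<iota> ys)))"
    using assms g list_prod_map_closed[of ys] \<iota>_closed[of x] \<iota>_closed[of y]
    by (simp add: \<iota>_act E.m_assoc)
  also have "\<dots> = list_prod E (map \<iota> (xs @ [x] @ ((g \<odot> y) # ys)))"
    using assms by (subst list_prod_middle) simp_all
  finally have "list_prod E (map \<iota> (xs @ [x \<odot>\<^sub>r g] @ (y # ys))) =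
    list_prod E (map \<iota> (xs @ [x] @ ((g \<odot> y) # ys)))" .
  then show ?thesis by (simp add: mprod_def)
qed

text \<open>The first assumption is what is known inductively about \<theta> iterated
  \<open>r\<close> times. Only values on pure tensors enter the next iterate, and since
  \<open>mprod\<close> respects both kinds of relations, the tensor map is well defined on arbitrary
  cosets.\<close>

lemma tensor_map_mprod:
  assumes p: "\<And>ms. ms \<in> W (Suc r) \<Longrightarrow> p (pure_tensor \<Gamma> M ms) = mprod ms"
    and c: "Poly_Mapping.keys c \<subseteq> W (Suc (Suc r))"
  shows "tensor_map \<Gamma> M 2 (\<lambda>ms. [p (pure_tensor \<Gamma> M (butlast ms)), last ms]) (C (Suc (Suc r)) c) =
     C 2 (frag_extend (\<lambda>ms. frag_of [mprod (butlast ms), last ms]) c)"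
proof -
  let ?f = "\<lambda>ms. [p (pure_tensor \<Gamma> M (butlast ms)), last ms]"
  have f: "?f (ms @ [m]) = [mprod ms, m]" if "ms @ [m] \<in> W (Suc (Suc r))" for ms m
    using that p[of ms] by (simp add: tensor_words_def)
  have mp: "mprod ms \<in> carrier M" if "ms @ [m] \<in> W (Suc (Suc r))" for ms m
    using that by (intro list_prod_\<iota>(2)) (auto simp: tensor_words_def)
  have "tensor_map \<Gamma> M 2 ?f (C (Suc (Suc r)) c) = C 2 (frag_extend (\<lambda>ms. frag_of (?f ms)) c)"
  proof (rule tensor_map_C, goal_cases)
    case (1 ms)
    then obtain xs x where ms: "ms = xs @ [x]"
      by (cases ms rule: rev_cases) (auto simp: tensor_words_def)
    then have "?f ms = [mprod xs, x]" using f 1 by blast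
    then show ?case using mp[of xs x] 1 ms by (simp add: tensor_words_def)
  next
    case (2 xs x y ys)
    show ?case
    proof (cases ys rule: rev_cases)
      case Nil
      have w: "xs @ [x] \<in> W (Suc (Suc r))" "xs @ [y] \<in> W (Suc (Suc r))" "xs @ [x \<oplus> y] \<in> W (Suc (Suc r))"
        using 2 Nil by (auto simp: tensor_words_def)
      show ?thesis
        unfolding Nil append_Nil2 f[OF w(1)] f[OF w(2)] f[OF w(3)]
        using 2 mp[OF w(1)] by (intro H2_add_r) (auto simp: tensor_words_def)
    next
      case (snoc zs a)
      have w: "(xs @ [x] @ zs) @ [a] \<in> W (Suc (Suc r))" "(xs @ [y] @ zs) @ [a] \<in> W (Suc (Suc r))"
         "(xs @ [x \<oplus> y] @ zs) @ [a] \<in> W (Suc (Suc r))"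
        using 2 snoc by (auto simp: tensor_words_def)
      have "frag_of [mprod (xs @ [x \<oplus> y] @ zs), a] - frag_of [mprod (xs @ [x] @ zs), a] -
          frag_of [mprod (xs @ [y] @ zs), a] \<in> H 2"
        using 2 snoc mp[OF w(1)] mp[OF w(2)]
        by (subst mprod_add) (auto simp: tensor_words_def intro!: H2_add_l)
      then show ?thesis
        using f[OF w(1)] f[OF w(2)] f[OF w(3)] by (simp only: snoc append_assoc)
    qed
  next
    case (3 xs x y ys g)
    show ?case
    proof (cases ys rule: rev_cases)
      case Nil
      have w: "(xs @ [x]) @ [y] \<in> W (Suc (Suc r))" "(xs @ [x]) @ [g \<odot> y] \<in> W (Suc (Suc r))"
          "(xs @ [x \<odot>\<^sub>r g]) @ [y] \<in> W (Suc (Suc r))"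
        using 3 Nil by (auto simp: tensor_words_def)
      have "frag_of [mprod (xs @ [x \<odot>\<^sub>r g]), y] - frag_of [mprod (xs @ [x]), g \<odot> y] \<in> H 2"
        using 3 Nil mp[OF w(1)]
        by (subst mprod_rsmult) (auto simp: tensor_words_def intro!: H2_balanced)
      then show ?thesis
        using f[OF w(2)] f[OF w(3)] Nil by simp
    next
      case (snoc zs a)
      have w: "(xs @ [x, g \<odot> y] @ zs) @ [a] \<in> W (Suc (Suc r))"
          "(xs @ [x \<odot>\<^sub>r g, y] @ zs) @ [a] \<in> W (Suc (Suc r))"
        using 3 snoc by (auto simp: tensor_words_def)
      have "mprod (xs @ [x \<odot>\<^sub>r g, y] @ zs) = mprod (xs @ [x, g \<odot> y] @ zs)"
        using 3 snoc by (intro mprod_balanced) (auto simp: tensor_words_def)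
      then have "frag_of [mprod (xs @ [x \<odot>\<^sub>r g, y] @ zs), a] -
          frag_of [mprod (xs @ [x, g \<odot> y] @ zs), a] \<in> H 2"
        by (simp add: H_zero)
      then show ?thesis
        using f[OF w(1)] f[OF w(2)] by (simp only: snoc append_assoc)
    qed
  qed
  also have "frag_extend (\<lambda>ms. frag_of (?f ms)) c = frag_extend (\<lambda>ms. frag_of [mprod (butlast ms), last ms]) c"
  proof (rule frag_extend_eq)
    fix ms assume "ms \<in> Poly_Mapping.keys c"
    then have "ms \<in> W (Suc (Suc r))" using c by blast
    then show "frag_of (?f ms) = frag_of [mprod (butlast ms), last ms]"
      using f[of "butlast ms" "last ms"] by (cases ms rule: rev_cases) (auto simp: tensor_words_def)
  qed
  finally show ?thesis .
qed

text \<open>The recursion brackets from the left, exactly as \<open>mprod_snoc\<close> does. For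
  \<open>r = 0\<close> the definite description is resolved by
  \<open>pure_tensor_single_inject\<close>.\<close>

lemma theta_power_pure:
  "ms \<in> W (Suc r) \<Longrightarrow> theta_power \<Gamma> M \<theta> r (pure_tensor \<Gamma> M ms) = mprod ms"
proof (induction r arbitrary: ms)
  case 0
  then obtain x where x: "ms = [x]" "x \<in> carrier M"
    by (auto simp: tensor_words_def length_Suc_conv)
  have "(THE y. y \<in> carrier M \<and> pure_tensor \<Gamma> M [x] = pure_tensor \<Gamma> M [y]) = x"
    using x pure_tensor_single_inject by (intro the_equality) auto
  then show ?case using x by (simp add: mprod_single)
next
  case (Suc r)
  obtain xs x where ms: "ms = xs @ [x]"
    using Suc.prems by (cases ms rule: rev_cases) (auto simp: tensor_words_def)
  have xs: "xs \<noteq> []" "set xs \<subseteq> carrier M" "x \<in> carrier M"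
    using Suc.prems ms by (auto simp: tensor_words_def)
  have "theta_power \<Gamma> M \<theta> (Suc r) (pure_tensor \<Gamma> M ms) = \<theta> (C 2 (frag_of [mprod xs, x]))"
    using Suc.prems tensor_map_mprod[OF Suc.IH, where c = "frag_of ms"] ms
    by (simp add: pure_tensor_C)
  then show ?case
    using xs list_prod_\<iota>(2)[of xs] ms by (simp add: \<mu>_C mprod_snoc)
qed

text \<open>From left to right one evaluates at pure tensors. Conversely, writing
  \<open>N = Suc r\<close> exposes an outermost \<theta>, whose additivity extends vanishing from
  pure tensors to the whole tensor power.\<close>

lemma nilpotent_iff:
  "nilpotent_bimodule \<Gamma> M \<theta> \<longleftrightarrow> (\<exists>N\<ge>1. \<forall>ms\<in>W (N + 1). mprod ms = \<zero>)"
proof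
  assume "nilpotent_bimodule \<Gamma> M \<theta>"
  then obtain N where N: "N \<ge> 1" "\<And>X. X \<in> carrier (T (N + 1)) \<Longrightarrow> theta_power \<Gamma> M \<theta> N X = \<zero>"
    unfolding nilpotent_bimodule_def by blast
  have "mprod ms = \<zero>" if ms: "ms \<in> W (N + 1)" for ms
  proof -
    have "pure_tensor \<Gamma> M ms \<in> carrier (T (N + 1))"
      using pure_tensor_C[OF ms] T_carrierI[of "frag_of ms" "N + 1"] ms by simp
    then show ?thesis using N(2) theta_power_pure[of ms N] ms by simp
  qed
  then show "\<exists>N\<ge>1. \<forall>ms\<in>W (N + 1). mprod ms = \<zero>" using N(1) by blast
next
  assume "\<exists>N\<ge>1. \<forall>ms\<in>W (N + 1). mprod ms = \<zero>"
  then obtain N where "N \<ge> 1" and N: "\<And>ms. ms \<in> W (N + 1) \<Longrightarrow> mprod ms = \<zero>" by blast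
  then obtain r where r: "N = Suc r" using not0_implies_Suc by fastforce
  let ?G = "frag_extend (\<lambda>ms. frag_of [mprod (butlast ms), last ms])"
  \<comment> \<open>The condition on the keys travels with the claim because
    \<open>\<theta>_diff\<close> applies only to combinations of words over M.\<close>
  have G: "Poly_Mapping.keys (?G c) \<subseteq> W 2 \<and> \<theta> (C 2 (?G c)) = \<zero>"
    if "Poly_Mapping.keys c \<subseteq> W (Suc (Suc r))" for c
    using that
  proof (rule free_Abelian_group_induct)
    show "Poly_Mapping.keys (?G 0) \<subseteq> W 2 \<and> \<theta> (C 2 (?G 0)) = \<zero>"
      by (simp add: \<theta>_zero)
  next
    fix c d assume c: "Poly_Mapping.keys (?G c) \<subseteq> W 2 \<and> \<theta> (C 2 (?G c)) = \<zero>"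
      and d: "Poly_Mapping.keys (?G d) \<subseteq> W 2 \<and> \<theta> (C 2 (?G d)) = \<zero>"
    have "Poly_Mapping.keys (?G c - ?G d) \<subseteq> W 2"
      using c d keys_diff[of "?G c" "?G d"] by blast
    then show "Poly_Mapping.keys (?G (c - d)) \<subseteq> W 2 \<and> \<theta> (C 2 (?G (c - d))) = \<zero>"
      using c d by (simp add: frag_extend_diff \<theta>_diff a_minus_def)
  next
    fix ms assume ms: "ms \<in> W (Suc (Suc r))"
    then obtain xs x where "ms = xs @ [x]"
      by (cases ms rule: rev_cases) (auto simp: tensor_words_def)
    then have xs: "ms = xs @ [x]" "xs \<noteq> []" "set xs \<subseteq> carrier M" "x \<in> carrier M"
      using ms by (auto simp: tensor_words_def)
    have "\<theta> (C 2 (frag_of [mprod xs, x])) = mprod ms"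
      using xs list_prod_\<iota>(2)[of xs] by (simp add: mprod_snoc \<mu>_C)
    then show "Poly_Mapping.keys (?G (frag_of ms)) \<subseteq> W 2 \<and> \<theta> (C 2 (?G (frag_of ms))) = \<zero>"
      using xs list_prod_\<iota>(2)[of xs] W2 N[of ms] r ms by simp
  qed
  have "theta_power \<Gamma> M \<theta> N X = \<zero>" if X: "X \<in> carrier (T (N + 1))" for X
  proof -
    obtain c where c: "X = C (Suc (Suc r)) c" "Poly_Mapping.keys c \<subseteq> W (Suc (Suc r))"
      using X r T_carrier[of "N + 1"] by auto
    have "theta_power \<Gamma> M \<theta> N X = \<theta> (C 2 (?G c))"
      unfolding r c(1) using tensor_map_mprod[of r "theta_power \<Gamma> M \<theta> r", OF theta_power_pure c(2)] by simp
    then show ?thesis using G[OF c(2)] by simp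
  qed
  then show "nilpotent_bimodule \<Gamma> M \<theta>"
    unfolding nilpotent_bimodule_def using \<open>N \<ge> 1\<close> by blast
qed

lemma nilpotentI:
  assumes "\<And>ms. \<lbrakk>length ms = N; set ms \<subseteq> carrier M\<rbrakk> \<Longrightarrow> list_prod E (map \<iota> ms) = \<zero>\<^bsub>E\<^esub>" "N > 0"
  shows "nilpotent_bimodule \<Gamma> M \<theta>"
  unfolding nilpotent_iff
proof (intro exI[of _ N] conjI ballI)
  \<comment> \<open>The power of \<theta> with exponent \<open>N\<close> takes \<open>N + 1\<close>
    factors, and the last \<open>N\<close> of them already multiply to zero.\<close>
  fix ms assume ms: "ms \<in> W (N + 1)"
  then obtain m ms' where ms': "ms = m # ms'" "set ms' \<subseteq> carrier M" "length ms' = N" "m \<in> carrier M"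
    by (auto simp: tensor_words_def length_Suc_conv)
  then have "list_prod E (map \<iota> ms) = \<zero>\<^bsub>E\<^esub>"
    using assms(1)[of ms'] \<iota>_closed by simp
  then show "mprod ms = \<zero>"
    by (intro mprod_eqI) (simp add: \<iota>_def E_zero)
qed (use assms in simp)

lemma nilpotentE:
  assumes "nilpotent_bimodule \<Gamma> M \<theta>"
  obtains N where "N > 0"
    "\<And>ms. \<lbrakk>length ms = N; set ms \<subseteq> carrier M\<rbrakk> \<Longrightarrow> list_prod E (map \<iota> ms) = \<zero>\<^bsub>E\<^esub>"
proof -
  obtain N where "N \<ge> 1" and N: "\<And>ms. ms \<in> W (N + 1) \<Longrightarrow> mprod ms = \<zero>"
    using assms unfolding nilpotent_iff by blast
  have "list_prod E (map \<iota> ms) = \<zero>\<^bsub>E\<^esub>" if "length ms = N + 1" "set ms \<subseteq> carrier M" for ms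
  proof -
    have "ms \<noteq> []" using that by auto
    then show ?thesis
      using list_prod_\<iota>(1)[of ms] that N[of ms] by (simp add: tensor_words_def \<iota>_def E_zero)
  qed
  then show ?thesis using that[of "N + 1"] by simp
qed

end


section \<open>Necessity of nilpotency\<close>

locale bound_quiver_alg = path_alg K Q
  for K :: "('k, 'c) ring_scheme" (structure) and Q :: "('v, 'e) pre_digraph" +
  fixes I :: "('v \<times> 'e list \<Rightarrow> 'k) set"
  assumes ideal_I: "ideal I kQ" and admissible_I: "admissible K Q I"
begin

sublocale I: ideal I kQ by (rule ideal_I)

abbreviation "B \<equiv> bound_quiver_algebra K Q I"
abbreviation "cls \<equiv> (+>\<^bsub>kQ\<^esub>) I"

lemma ex_filt_subset: "\<exists>N>1. filt N \<subseteq> I"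
proof -
  obtain N where "N > 1" "\<And>p. \<lbrakk>is_path Q p; length (snd p) = N\<rbrakk> \<Longrightarrow> pe p \<in> I"
    using admissible_I unfolding admissible_def by blast
  then show ?thesis using filt_subset_ideal[OF ideal_I] by blast
qed

lemma I_subset_filt: "I \<subseteq> filt 2"
  using admissible_I I.a_subset unfolding admissible_def filt_def by auto

lemma B_assoc: "assoc_algebra K B"
  unfolding bound_quiver_algebra_def by (rule R.quot_assoc_algebra[OF ideal_I])

lemma cls_alg_hom: "cls \<in> alg_hom K kQ B"
  unfolding bound_quiver_algebra_def by (rule R.quot_proj_alg_hom[OF ideal_I])

lemmas cls_hom = alg_homD[OF cls_alg_hom]

lemma B_carrierE:
  assumes "X \<in> carrier B"
  obtains f where "f \<in> carrier kQ" "X = cls f"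
  using assms R.quot_carrierE[OF ideal_I] unfolding bound_quiver_algebra_def by metis

lemma cls_eq_zero_iff: "f \<in> carrier kQ \<Longrightarrow> cls f = \<zero>\<^bsub>B\<^esub> \<longleftrightarrow> f \<in> I"
  unfolding bound_quiver_algebra_def by (rule R.quot_eq_zero_iff[OF ideal_I])

lemma cls_zero: "cls \<zero>\<^bsub>kQ\<^esub> = \<zero>\<^bsub>B\<^esub>"
  unfolding bound_quiver_algebra_def by (rule R.quot_zero[OF ideal_I, symmetric])

text \<open>Independent of the chosen representative only if \<open>p\<close> has length at most \<open>1\<close>.\<close>

definition coef :: "'v \<times> 'e list \<Rightarrow> ('v \<times> 'e list \<Rightarrow> 'k) set \<Rightarrow> 'k" where
  "coef p X = (SOME f. f \<in> X) p"

text \<open>Two representatives differ by an element of \<open>I\<close>, and such an element has no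
  terms of length below 2.\<close>

lemma coef_cls:
  assumes f: "f \<in> carrier kQ" and p: "length (snd p) \<le> 1"
  shows "coef p (cls f) = f p"
proof -
  have "g p = f p" if g: "g \<in> cls f" for g
  proof -
    obtain i where i: "i \<in> I" "g = i \<uplus> f"
      using g by (auto simp: a_r_coset_def r_coset_def)
    moreover have "i p = \<zero>"
      using i I_subset_filt p filt_eq_zero[of i 2 p] by auto
    ultimately show ?thesis using f by (simp add: add_apply)
  qed
  moreover have "f \<in> cls f" using f by (rule I.a_rcos_self)
  ultimately show ?thesis unfolding coef_def by (metis someI)
qed

text \<open>Some \<open>filt N\<close> lies in \<open>I\<close>, so the classes of the paths shorter
  than \<open>N\<close> span; a finite quiver has only finitely many of them.\<close>

lemma fin_dim_B: "vectorspace.fin_dim K B"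
proof -
  interpret B: k_algebra K B using B_assoc by unfold_locales
  obtain N where N: "filt N \<subseteq> I" using ex_filt_subset by blast
  let ?P = "{p. is_path Q p \<and> length (snd p) < N}"
  have "?P \<subseteq> verts Q \<times> {es. set es \<subseteq> arcs Q \<and> length es \<le> N}"
    using fst_in_verts path_arcs by fastforce
  then have fin: "finite ?P"
    by (rule finite_subset) (intro finite_cartesian_product finite_lists_length_le Q.finite_verts Q.finite_arcs)
  let ?X = "(\<lambda>p. cls (pe p)) ` ?P"
  have X: "?X \<subseteq> carrier B" using cls_hom(1) pe_closed by auto
  note sp = B.subspaceD[OF B.span_subspace[OF X]]
  have pe: "cls (pe p) \<in> B.V.span ?X" if p: "is_path Q p" for p
  proof (cases "length (snd p) < N")
    case True
    then show ?thesis using p by (intro B.span_superset[OF X]) auto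
  next
    case False
    then have "pe p \<in> I" using p N filt_pe[of p N] by auto
    then show ?thesis using cls_eq_zero_iff[OF pe_closed[OF p]] sp(2) by simp
  qed
  have "cls f \<in> B.V.span ?X" if "f \<in> carrier kQ" for f
    using that
  proof (induction f rule: path_induct)
    case zero
    then show ?case using sp(2) by (simp add: cls_zero)
  next
    case (add a p g)
    then show ?case
      using pe sp(3,4) by (simp add: cls_hom smult_closed pe_closed)
  qed
  then have "B.V.span ?X = carrier B"
    using sp(1) B_carrierE by blast
  then show ?thesis
    unfolding B.V.fin_dim_def using fin X by blast
qed

lemma fin_dim_algebra_B: "fin_dim_algebra K B"
  using B_assoc fin_dim_B by (simp add: fin_dim_algebra_def)

text \<open>An element of the arrow ideal has a power in \<open>I\<close>, so \<open>\<chi>\<close>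
  kills it, as a field has no zero divisors. Since \<open>\<chi>\<close> is not zero, it is non-zero
  on the trivial path at some \<open>u\<close>; its value there is a non-zero idempotent of the
  field, hence one. Multiplication by this path then isolates the coefficient at
  \<open>u\<close>.\<close>

lemma character_is_vertex_coefficient:
  assumes closed: "\<And>f. f \<in> carrier kQ \<Longrightarrow> \<chi> f \<in> carrier K"
    and add: "\<And>f g. \<lbrakk>f \<in> carrier kQ; g \<in> carrier kQ\<rbrakk> \<Longrightarrow> \<chi> (f \<uplus> g) = \<chi> f \<oplus> \<chi> g"
    and mult: "\<And>f g. \<lbrakk>f \<in> carrier kQ; g \<in> carrier kQ\<rbrakk> \<Longrightarrow> \<chi> (f \<star> g) = \<chi> f \<otimes> \<chi> g"
    and smult: "\<And>a f. \<lbrakk>a \<in> carrier K; f \<in> carrier kQ\<rbrakk> \<Longrightarrow> \<chi> (a \<bullet> f) = a \<otimes> \<chi> f"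
    and one: "\<chi> \<one>\<^bsub>kQ\<^esub> = \<one>"
    and ker: "\<And>f. f \<in> I \<Longrightarrow> \<chi> f = \<zero>"
  shows "\<exists>u\<in>verts Q. \<forall>f\<in>carrier kQ. \<chi> f = f (u, [])"
proof -
  obtain N where N: "filt N \<subseteq> I" using ex_filt_subset by blast
  have filt1: "\<chi> f = \<zero>" if f: "f \<in> filt 1" for f
  proof -
    have fc: "f \<in> carrier kQ" using f by (rule filt_carrier)
    have pow: "\<chi> f = \<zero>" if "\<chi> (list_prod kQ (replicate n f)) = \<zero>" for n
      using that
    proof (induction n)
      case 0
      then show ?case using one by simp
    next
      case (Suc n)
      have "list_prod kQ (replicate n f) \<in> carrier kQ"
        using fc by (intro R.list_prod_closed) auto
      then show ?case
        using Suc fc closed[of f] closed[of "list_prod kQ (replicate n f)"]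
          K.integral[of "\<chi> f" "\<chi> (list_prod kQ (replicate n f))"]
        by (auto simp: mult)
    qed
    have "list_prod kQ (replicate N f) \<in> filt (length (replicate N f))"
      using f by (intro filt_list_prod) auto
    then have "list_prod kQ (replicate N f) \<in> I" using N by auto
    then show ?thesis using pow[of N] ker by blast
  qed
  have "\<exists>u\<in>verts Q. \<chi> (pe (u, [])) \<noteq> \<zero>"
  proof (rule ccontr)
    assume *: "\<not> ?thesis"
    have pe0: "\<chi> (pe p) = \<zero>" if p: "is_path Q p" for p
    proof (cases "snd p = []")
      case True
      then have "p = (fst p, [])" by (cases p) auto
      then show ?thesis using * fst_in_verts[OF p] by metis
    next
      case False
      then show ?thesis using p by (intro filt1 filt_pe) (auto simp: Suc_le_eq)
    qed
    have "\<chi> f = \<zero>" if "f \<in> carrier kQ" for f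
      using that
    proof (induction f rule: path_induct)
      case zero
      then show ?case using ker I.zero_closed by simp
    next
      case (add a p g)
      then show ?case
        using pe0 by (simp add: assms(2) smult smult_closed pe_closed)
    qed
    then show False using one one_closed by fastforce
  qed
  then obtain u where u: "u \<in> verts Q" "\<chi> (pe (u, [])) \<noteq> \<zero>" by blast
  have up: "is_path Q (u, [])" using u by (simp add: is_path_Nil)
  let ?c = "\<chi> (pe (u, []))"
  have c: "?c \<in> carrier K" using closed pe_closed[OF up] by blast
  have "?c \<otimes> ?c = ?c"
    using mult[OF pe_closed[OF up] pe_closed[OF up]] pe_mult[OF up up] by simp
  then have c1: "?c = \<one>"
    using c u(2) K.m_lcancel[of ?c ?c "\<one>"] by simp
  have "\<chi> f = f (u, [])" if f: "f \<in> carrier kQ" for f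
  proof -
    \<comment> \<open>Multiplying \<open>f\<close> by the trivial path at \<open>u\<close> removes
      the coefficients at all other vertices. Subtracting the coefficient at \<open>u\<close> leaves
      an element of the arrow ideal, which \<open>\<chi>\<close> kills.\<close>
    let ?g = "pe (u, []) \<star> f \<uplus> (\<ominus> f (u, [])) \<bullet> pe (u, [])"
    have a: "\<ominus> f (u, []) \<in> carrier K" using f by simp
    have g: "?g \<in> carrier kQ"
      using f up a by (intro add_closed mult_closed smult_closed pe_closed)
    have "?g \<in> filt 1"
    proof (rule filtI[OF g])
      fix p :: "'v \<times> 'e list" assume "length (snd p) < 1"
      then obtain w where "p = (w, [])" by (cases p) auto
      then show "?g p = \<zero>"
        using f up by (simp add: add_apply smult_apply mult_apply_Nil pe_closed pe_apply K.r_neg)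
    qed
    then have "\<chi> ?g = \<zero>" by (rule filt1)
    then have "\<chi> f \<oplus> \<ominus> f (u, []) = \<zero>"
      using f up a c1 closed by (simp add: add mult smult mult_closed smult_closed pe_closed)
    then show ?thesis
      using K.minus_equality[of "\<chi> f" "\<ominus> f (u, [])"] closed[OF f] f by simp
  qed
  then show ?thesis using u(1) by blast
qed

end

lemma bound_quiver_imp_alg: "bound_quiver K Q I \<Longrightarrow> bound_quiver_alg K Q I"
  by (simp add: bound_quiver_def bound_quiver_alg_def path_alg_def bound_quiver_alg_axioms_def)

locale bound_quiver_bimodule = bound_quiver_alg K Q I + mult_bimod K "bound_quiver_algebra K Q I" M \<theta>
  for K :: "('k, 'c) ring_scheme" and Q :: "('v, 'e) pre_digraph"
    and I :: "('v \<times> 'e list \<Rightarrow> 'k) set"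
    and M :: "(('v \<times> 'e list \<Rightarrow> 'k) set, 'm, 'd) bimodule_scheme" and \<theta> :: "'m tensor_fun"
begin

notation E_times (infixl \<open>\<cdot>\<close> 70)

lemma nilpotent_if_bound_quiver_algebra:
  fixes Q' :: "('w, 'f) pre_digraph"
  assumes bq: "bound_quiver K Q' I'" and card: "card (verts Q') = card (verts Q)"
    and iso: "alg_isomorphic K E (bound_quiver_algebra K Q' I')"
  shows "nilpotent_bimodule B M \<theta>"
proof -
  interpret Q': bound_quiver_alg K Q' I'
    by (rule bound_quiver_imp_alg[OF bq])
  obtain h where h: "h \<in> alg_hom K E Q'.B" and bij: "bij_betw h (carrier E) (carrier Q'.B)"
    using iso unfolding alg_isomorphic_iff by blast
  define g where "g = inv_into (carrier E) h"
  have g: "g \<in> alg_hom K Q'.B E"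
    unfolding g_def by (rule alg_hom_inv_into[OF E_assoc_algebra h bij])
  define \<psi> where "\<psi> f = g (Q'.cls f)" for f
  have \<psi>: "\<psi> \<in> alg_hom K Q'.kQ E"
    unfolding \<psi>_def by (rule alg_hom_comp[OF Q'.cls_alg_hom g])
  note \<psi>D = alg_homD[OF \<psi>]
  interpret Q'B: k_algebra K Q'.B using Q'.B_assoc by unfold_locales
  have \<psi>_ker: "\<psi> f = \<zero>\<^bsub>E\<^esub>" if "f \<in> I'" for f
  proof -
    have f: "f \<in> carrier Q'.kQ" using that Q'.I.a_subset by blast
    have "g \<zero>\<^bsub>Q'.B\<^esub> = \<zero>\<^bsub>E\<^esub>"
      by (rule ring_hom_zero[OF alg_hom_ring_hom[OF g] Q'B.ring_axioms E.ring_axioms])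
    then show ?thesis using Q'.cls_eq_zero_iff[OF f] that by (simp add: \<psi>_def)
  qed
  have \<psi>_surj: "\<exists>f\<in>carrier Q'.kQ. \<psi> f = x" if x: "x \<in> carrier E" for x
  proof -
    obtain f where f: "f \<in> carrier Q'.kQ" "h x = Q'.cls f"
      using alg_homD(1)[OF h x] by (rule Q'.B_carrierE)
    have "g (h x) = x" unfolding g_def by (rule bij_betw_inv_into_left[OF bij x])
    then show ?thesis using f unfolding \<psi>_def by auto
  qed
  \<comment> \<open>The coefficient at a trivial path is multiplicative on the path algebra because
    such a path has a single cut, and it descends to the quotient because \<open>I\<close> has no
    terms of length zero.\<close>
  have char: "\<exists>u\<in>verts Q'. \<forall>f\<in>carrier Q'.kQ. coef (v, []) (fst (\<psi> f)) = f (u, [])" if v: "v \<in> verts Q" for v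
  proof (rule Q'.character_is_vertex_coefficient)
    have rep: "\<exists>a m. a \<in> carrier kQ \<and> m \<in> carrier M \<and> \<psi> f = (cls a, m)" if f: "f \<in> carrier Q'.kQ" for f
    proof -
      obtain X m where Xm: "\<psi> f = (X, m)" "X \<in> carrier B" "m \<in> carrier M"
        using \<psi>D(1)[OF f] by (cases "\<psi> f") (auto simp: E_carrier)
      from Xm(2) show ?thesis by (rule B_carrierE) (use Xm in auto)
    qed
    show "coef (v, []) (fst (\<psi> f)) \<in> carrier K" if "f \<in> carrier Q'.kQ" for f
      using rep[OF that] by (auto simp: coef_cls)
    show "coef (v, []) (fst (\<psi> (f \<oplus>\<^bsub>Q'.kQ\<^esub> f'))) = coef (v, []) (fst (\<psi> f)) \<oplus>\<^bsub>K\<^esub> coef (v, []) (fst (\<psi> f'))"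
      if "f \<in> carrier Q'.kQ" "f' \<in> carrier Q'.kQ" for f f'
      using that rep[OF that(1)] rep[OF that(2)]
      by (auto simp: \<psi>D E_add cls_hom(3)[symmetric] coef_cls add_closed add_apply)
    show "coef (v, []) (fst (\<psi> (f \<otimes>\<^bsub>Q'.kQ\<^esub> f'))) = coef (v, []) (fst (\<psi> f)) \<otimes>\<^bsub>K\<^esub> coef (v, []) (fst (\<psi> f'))"
      if "f \<in> carrier Q'.kQ" "f' \<in> carrier Q'.kQ" for f f'
      using that rep[OF that(1)] rep[OF that(2)]
      by (auto simp: \<psi>D E_mult cls_hom(2)[symmetric] coef_cls mult_closed mult_apply_Nil)
    show "coef (v, []) (fst (\<psi> (a \<odot>\<^bsub>Q'.kQ\<^esub> f))) = a \<otimes>\<^bsub>K\<^esub> coef (v, []) (fst (\<psi> f))"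
      if "a \<in> carrier K" "f \<in> carrier Q'.kQ" for a f
      using that rep[OF that(2)]
      by (auto simp: \<psi>D E_smult cls_hom(5)[symmetric] coef_cls smult_closed smult_apply)
    show "coef (v, []) (fst (\<psi> \<one>\<^bsub>Q'.kQ\<^esub>)) = \<one>\<^bsub>K\<^esub>"
      using v by (simp add: \<psi>D E_one cls_hom(4)[symmetric] coef_cls one_closed one_apply)
    show "coef (v, []) (fst (\<psi> f)) = \<zero>\<^bsub>K\<^esub>" if "f \<in> I'" for f
      using \<psi>_ker[OF that] by (simp add: E_zero cls_zero[symmetric] coef_cls zero_closed zero_apply)
  qed
  then obtain \<tau> where \<tau>: "\<And>v. v \<in> verts Q \<Longrightarrow> \<tau> v \<in> verts Q'"
    "\<And>v f. \<lbrakk>v \<in> verts Q; f \<in> carrier Q'.kQ\<rbrakk> \<Longrightarrow> coef (v, []) (fst (\<psi> f)) = f (\<tau> v, [])" by metis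
  \<comment> \<open>A preimage of the idempotent at \<open>v\<close> separates: its coefficient at
    \<open>\<tau> v\<close> is the coefficient of that idempotent at \<open>v\<close>, its
    coefficient at \<open>\<tau> w\<close> the one at \<open>w\<close>, and these differ unless
    \<open>v = w\<close>.\<close>
  have "inj_on \<tau> (verts Q)"
  proof (rule inj_onI)
    fix v w assume vw: "v \<in> verts Q" "w \<in> verts Q" "\<tau> v = \<tau> w"
    have p: "is_path Q (v, [])" using vw by (simp add: is_path_Nil)
    have "(cls (pe (v, [])), \<zero>\<^bsub>M\<^esub>) \<in> carrier E"
      using cls_hom(1)[OF pe_closed[OF p]] by (simp add: E_carrier)
    then obtain f where f: "f \<in> carrier Q'.kQ" "\<psi> f = (cls (pe (v, [])), \<zero>\<^bsub>M\<^esub>)"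
      using \<psi>_surj by blast
    have "pe (v, []) (v, [] :: 'e list) = pe (v, []) (w, [] :: 'e list)"
      using \<tau>(2)[OF vw(1) f(1)] \<tau>(2)[OF vw(2) f(1)] vw(3) f(2) coef_cls[OF pe_closed[OF p]] by simp
    then show "v = w" by (simp add: pe_apply split: if_splits)
  qed
  then have "\<tau> ` verts Q = verts Q'"
    using \<tau>(1) card by (intro card_subset_eq) (auto simp: card_image)
  then have surj: "\<exists>v\<in>verts Q. u = \<tau> v" if "u \<in> verts Q'" for u using that by blast
  \<comment> \<open>Every vertex of \<open>Q'\<close> is some \<open>\<tau> v\<close>, so each
    coefficient of a lift at a trivial path is a coefficient of the \<Gamma> component of
    \<open>\<iota> m\<close>, which is zero.\<close>
  have \<iota>_filt: "\<exists>f\<in>Q'.filt 1. \<psi> f = \<iota> m" if m: "m \<in> carrier M" for m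
  proof -
    obtain f where f: "f \<in> carrier Q'.kQ" "\<psi> f = \<iota> m"
      using \<psi>_surj \<iota>_closed[OF m] by blast
    have "f \<in> Q'.filt 1"
    proof (rule Q'.filtI[OF f(1)])
      fix p :: "'w \<times> 'f list" assume "length (snd p) < 1"
      then obtain u where p: "p = (u, [])" by (cases p) auto
      show "f p = \<zero>\<^bsub>K\<^esub>"
      proof (cases "u \<in> verts Q'")
        case True
        then obtain v where v: "v \<in> verts Q" "u = \<tau> v" using surj by blast
        have "coef (v, []) (fst (\<psi> f)) = \<zero>\<^bsub>K\<^esub>"
          using f(2) by (simp add: \<iota>_def cls_zero[symmetric] coef_cls zero_closed zero_apply)
        then show ?thesis using \<tau>(2)[OF v(1) f(1)] v p by simp
      next
        case False
        then show ?thesis using Q'.is_path_support[OF f(1), of p] p by (auto simp: Q'.is_path_Nil)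
      qed
    qed
    then show ?thesis using f by blast
  qed
  obtain N where N: "N > 1" "Q'.filt N \<subseteq> I'" using Q'.ex_filt_subset by blast
  have "list_prod E (map \<iota> ms) = \<zero>\<^bsub>E\<^esub>" if ms: "length ms = N" "set ms \<subseteq> carrier M" for ms
  proof -
    \<comment> \<open>Lifts into the arrow ideal: the product of \<open>N\<close> of them has only
      terms of length at least \<open>N\<close>, hence lies in \<open>I'\<close> and maps to
      zero.\<close>
    obtain r where r: "\<And>m. m \<in> carrier M \<Longrightarrow> r m \<in> Q'.filt 1 \<and> \<psi> (r m) = \<iota> m"
      using \<iota>_filt by metis
    let ?fs = "map r ms"
    have fs: "set ?fs \<subseteq> Q'.filt 1" using r ms by auto
    then have "set ?fs \<subseteq> carrier Q'.kQ" using Q'.filt_carrier by blast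
    then have "\<psi> (list_prod Q'.kQ ?fs) = list_prod E (map \<psi> ?fs)"
      by (rule alg_hom_list_prod[OF \<psi> Q'.assoc_algebra_kQ])
    also have "map \<psi> ?fs = map \<iota> ms" using r ms by auto
    finally have "list_prod E (map \<iota> ms) = \<psi> (list_prod Q'.kQ ?fs)" by simp
    moreover have "list_prod Q'.kQ ?fs \<in> I'"
      using Q'.filt_list_prod[OF fs] N ms by auto
    ultimately show ?thesis using \<psi>_ker by simp
  qed
  then show ?thesis using N(1) by (intro nilpotentI[of N]) auto
qed

end


section \<open>Generators of the radical\<close>

lemma alg_hom_finsum:
  assumes h: "h \<in> alg_hom K A B" and A: "assoc_algebra K A" and B: "assoc_algebra K B"
    and "finite S" "\<And>i. i \<in> S \<Longrightarrow> f i \<in> carrier A"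
  shows "h (finsum A f S) = finsum B (\<lambda>i. h (f i)) S"
proof -
  interpret A: k_algebra K A using A by unfold_locales
  interpret B: k_algebra K B using B by unfold_locales
  note hD = alg_homD[OF h]
  have h0: "h \<zero>\<^bsub>A\<^esub> = \<zero>\<^bsub>B\<^esub>"
    by (rule ring_hom_zero[OF alg_hom_ring_hom[OF h] A.ring_axioms B.ring_axioms])
  show ?thesis using assms(4,5)
  proof (induction S)
    case empty
    then show ?case using h0 by simp
  next
    case (insert i S)
    then have "finsum A f S \<in> carrier A" by (intro A.finsum_closed) auto
    moreover have "finsum A f (insert i S) = f i \<oplus>\<^bsub>A\<^esub> finsum A f S"
      using insert by (intro A.finsum_insert) auto
    moreover have "finsum B (\<lambda>i. h (f i)) (insert i S) = h (f i) \<oplus>\<^bsub>B\<^esub> finsum B (\<lambda>i. h (f i)) S"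
      using insert hD(1) by (intro B.finsum_insert) auto
    ultimately show ?case
      using insert hD by simp
  qed
qed

lemma alg_hom_fin_dim:
  assumes h: "h \<in> alg_hom K A B" and A: "assoc_algebra K A" and B: "assoc_algebra K B"
    and surj: "h ` carrier A = carrier B" and fd: "vectorspace.fin_dim K A"
  shows "vectorspace.fin_dim K B"
proof -
  interpret A: k_algebra K A using A by unfold_locales
  interpret B: k_algebra K B using B by unfold_locales
  note hD = alg_homD[OF h]
  obtain X where X: "finite X" "X \<subseteq> carrier A" "A.V.span X = carrier A"
    using fd unfolding A.V.fin_dim_def by blast
  have hX: "h ` X \<subseteq> carrier B" using X hD(1) by auto
  note sp = B.subspaceD[OF B.span_subspace[OF hX]]
  have "h \<zero>\<^bsub>A\<^esub> = \<zero>\<^bsub>B\<^esub>"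
    by (rule ring_hom_zero[OF alg_hom_ring_hom[OF h] A.ring_axioms B.ring_axioms])
  then have "submodule K {x \<in> carrier A. h x \<in> B.V.span (h ` X)} A"
    using sp hD by (intro A.subspaceI) auto
  moreover have "X \<subseteq> {x \<in> carrier A. h x \<in> B.V.span (h ` X)}"
    using X B.span_superset[OF hX] by blast
  ultimately have "A.V.span X \<subseteq> {x \<in> carrier A. h x \<in> B.V.span (h ` X)}"
    by (rule A.span_least)
  then have "h x \<in> B.V.span (h ` X)" if "x \<in> carrier A" for x
    using that unfolding X(3) by (simp add: subset_iff)
  then have "h ` carrier A \<subseteq> B.V.span (h ` X)" by (rule image_subsetI)
  then have "carrier B \<subseteq> B.V.span (h ` X)" by (simp only: surj)
  then have "B.V.span (h ` X) = carrier B" using sp(1) by blast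
  then show ?thesis unfolding B.V.fin_dim_def using X(1) hX by blast
qed

context path_alg
begin

lemma finsum_apply:
  assumes "finite S" "\<And>i. i \<in> S \<Longrightarrow> f i \<in> carrier kQ"
  shows "(\<Oplus>\<^bsub>kQ\<^esub>i\<in>S. f i) p = (\<Oplus>i\<in>S. f i p)"
  using assms
proof (induction S)
  case empty
  then show ?case by (simp add: zero_apply)
next
  case (insert i S)
  have "(\<Oplus>\<^bsub>kQ\<^esub>i\<in>insert i S. f i) = f i \<uplus> (\<Oplus>\<^bsub>kQ\<^esub>i\<in>S. f i)"
    using insert by (intro M.finsum_insert) auto
  moreover have "(\<Oplus>i\<in>insert i S. f i p) = f i p \<oplus> (\<Oplus>i\<in>S. f i p)"
    using insert by (intro K.finsum_insert) auto
  ultimately show ?case using insert by (simp add: add_apply)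
qed

lemma one_eq_finsum: "\<one>\<^bsub>kQ\<^esub> = (\<Oplus>\<^bsub>kQ\<^esub>v\<in>verts Q. pe (v, []))"
proof (rule path_eqI)
  fix u :: 'v and es :: "'e list"
  have "(\<Oplus>\<^bsub>kQ\<^esub>v\<in>verts Q. pe (v, [])) (u, es) = (\<Oplus>v\<in>verts Q. pe (v, []) (u, es))"
    by (rule finsum_apply) (simp_all add: pe_closed is_path_Nil)
  also have "\<dots> = (\<Oplus>v\<in>verts Q. if u = v then (if es = [] then \<one> else \<zero>) else \<zero>)"
    by (intro K.finsum_cong') (auto simp: pe_apply)
  also have "\<dots> = \<one>\<^bsub>kQ\<^esub> (u, es)"
  proof (cases "u \<in> verts Q")
    case True
    then show ?thesis by (subst K.finsum_singleton) (auto simp: one_apply)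
  next
    case False
    then have "(\<Oplus>v\<in>verts Q. if u = v then (if es = [] then \<one> else \<zero>) else \<zero>) =
      (\<Oplus>v\<in>verts Q. \<zero>)"
      by (intro K.finsum_cong') auto
    then show ?thesis using False by (simp add: one_apply)
  qed
  finally show "\<one>\<^bsub>kQ\<^esub> (u, es) = (\<Oplus>\<^bsub>kQ\<^esub>v\<in>verts Q. pe (v, [])) (u, es)" ..
qed

end

context mult_bimod
begin

lemma fst_alg_hom: "fst \<in> alg_hom K E \<Gamma>"
  by (rule alg_homI) (auto simp: E_carrier E_mult E_add E_one E_smult)

text \<open>Finite dimension of M is stated over this structure; the statement can be unfolded only
  once the structure is known to be a vector space.\<close>

lemma module_scalar_restriction: "Module.module K (scalar_restriction \<Gamma> M)"
proof (rule moduleI)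
  let ?S = "scalar_restriction \<Gamma> M"
  have simps: "carrier ?S = carrier M" "ring.add ?S = ring.add M" "\<zero>\<^bsub>?S\<^esub> = \<zero>"
      "\<And>a x. a \<odot>\<^bsub>?S\<^esub> x = scal a \<odot> x"
    by (simp_all add: scalar_restriction_def)
  show "abelian_group ?S"
  proof (rule abelian_groupI)
    fix x assume "x \<in> carrier ?S"
    then show "\<exists>y\<in>carrier ?S. y \<oplus>\<^bsub>?S\<^esub> x = \<zero>\<^bsub>?S\<^esub>"
      by (intro bexI[of _ "\<ominus> x"]) (simp_all add: simps M.l_neg)
  qed (simp_all add: simps M.a_ac)
  show "cring K" by (rule \<Gamma>.V.R.is_cring)
  fix a x assume a: "a \<in> carrier K" and x: "x \<in> carrier ?S"
  show "a \<odot>\<^bsub>?S\<^esub> x \<in> carrier ?S" using a x by (simp add: simps)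
  show "a \<odot>\<^bsub>?S\<^esub> (x \<oplus>\<^bsub>?S\<^esub> y) = a \<odot>\<^bsub>?S\<^esub> x \<oplus>\<^bsub>?S\<^esub> a \<odot>\<^bsub>?S\<^esub> y" if "y \<in> carrier ?S" for y
    using a x that by (simp add: simps act_add)
  fix b assume b: "b \<in> carrier K"
  show "(a \<oplus>\<^bsub>K\<^esub> b) \<odot>\<^bsub>?S\<^esub> x = a \<odot>\<^bsub>?S\<^esub> x \<oplus>\<^bsub>?S\<^esub> b \<odot>\<^bsub>?S\<^esub> x"
    using a b x by (simp add: simps \<Gamma>.V.smult_l_distr act_ring)
  have "(a \<otimes>\<^bsub>K\<^esub> b) \<odot>\<^bsub>\<Gamma>\<^esub> \<one>\<^bsub>\<Gamma>\<^esub> = scal a \<otimes>\<^bsub>\<Gamma>\<^esub> scal b"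
    using a b by (simp add: \<Gamma>.V.smult_assoc1 \<Gamma>.smult_mult_l)
  then show "(a \<otimes>\<^bsub>K\<^esub> b) \<odot>\<^bsub>?S\<^esub> x = a \<odot>\<^bsub>?S\<^esub> (b \<odot>\<^bsub>?S\<^esub> x)"
    using a b x by (simp add: simps act_ring)
qed (simp add: scalar_restriction_def)

lemma \<iota>_smult: "a \<odot>\<^bsub>E\<^esub> \<iota> m = \<iota> (scal a \<odot> m)" if "a \<in> carrier K"
  using that by (simp add: \<iota>_def E_smult)

text \<open>Transfers finite dimension from the scalar restriction of M to its copy inside E: the
  elements of M whose image lies in the span of the images form a subspace that contains the
  spanning set.\<close>

lemma finite_spanning_set:
  obtains S where "finite S" "S \<subseteq> carrier M" "\<iota> ` carrier M \<subseteq> E.V.span (\<iota> ` S)"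
proof -
  let ?S = "scalar_restriction \<Gamma> M"
  interpret S: vectorspace K ?S
    by (intro vectorspace.intro module_scalar_restriction \<Gamma>.V.field_axioms)
  have simps: "carrier ?S = carrier M" "ring.add ?S = ring.add M" "\<zero>\<^bsub>?S\<^esub> = \<zero>"
      "\<And>a x. a \<odot>\<^bsub>?S\<^esub> x = scal a \<odot> x"
    by (simp_all add: scalar_restriction_def)
  have "S.fin_dim" using multiplicative by (simp add: multiplicative_bimodule_def)
  then obtain S where S: "finite S" "S \<subseteq> carrier M" "S.span S = carrier M"
    unfolding S.fin_dim_def simps by blast
  have \<iota>S: "\<iota> ` S \<subseteq> carrier E" using S \<iota>_closed by auto
  note sp = E.subspaceD[OF E.span_subspace[OF \<iota>S]]
  have z: "\<iota> \<zero> = \<zero>\<^bsub>E\<^esub>" by (simp add: \<iota>_def E_zero)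
  let ?N = "{m \<in> carrier M. \<iota> m \<in> E.V.span (\<iota> ` S)}"
  have "submodule K ?N ?S"
    unfolding submodule_def
    using sp(2-4) z S.module_axioms by (auto simp: simps \<iota>_add \<iota>_smult[symmetric])
  moreover have "S \<subseteq> ?N" using S E.span_superset[OF \<iota>S] by blast
  ultimately have "S.span S \<subseteq> ?N" by (rule S.span_is_subset[rotated])
  then have "\<iota> ` carrier M \<subseteq> E.V.span (\<iota> ` S)" using S(3) by blast
  then show ?thesis using S that by blast
qed


lemma \<iota>_image_iff: "x \<in> \<iota> ` carrier M \<longleftrightarrow> x \<in> carrier E \<and> fst x = \<zero>\<^bsub>\<Gamma>\<^esub>"
  by (cases x) (auto simp: \<iota>_def E_carrier)

lemma \<iota>_image_mult:
  assumes "x \<in> \<iota> ` carrier M" "y \<in> carrier E"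
  shows "x \<cdot> y \<in> \<iota> ` carrier M" "y \<cdot> x \<in> \<iota> ` carrier M"
  using assms alg_homD(1,2)[OF fst_alg_hom] by (auto simp: \<iota>_image_iff)

end

section \<open>The ideal R, its nilpotency and its generators\<close>

context bound_quiver_bimodule
begin

text \<open>The projection of the path algebra onto \<Gamma>, followed by the splitting of E onto
  \<Gamma>.\<close>

definition \<sigma> :: "('v \<times> 'e list \<Rightarrow> 'k) \<Rightarrow> ('v \<times> 'e list \<Rightarrow> 'k) set \<times> 'm" where
  "\<sigma> f = (cls f, \<zero>\<^bsub>M\<^esub>)"

definition "idm v = \<sigma> (pe (v, []))"

text \<open>The ideal R of the overview: a first component in the image of the arrow ideal, and any
  second component.\<close>

definition "rad = {x \<in> carrier E. \<exists>f\<in>filt 1. fst x = cls f}"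

text \<open>Only the set of products; R^2 is its linear span, and spans are taken where the set is
  used.\<close>

definition "rad2 = {x \<cdot> y | x y. x \<in> rad \<and> y \<in> rad}"

lemma \<sigma>_alg_hom: "\<sigma> \<in> alg_hom K kQ E"
  unfolding \<sigma>_def by (rule alg_homI) (simp_all add: E_carrier E_mult E_add E_one E_smult cls_hom)

lemmas \<sigma>_hom = alg_homD[OF \<sigma>_alg_hom]

lemma \<sigma>_zero: "\<sigma> \<zero>\<^bsub>kQ\<^esub> = \<zero>\<^bsub>E\<^esub>"
  by (simp add: \<sigma>_def cls_zero E_zero)

lemma idm_closed: "v \<in> verts Q \<Longrightarrow> idm v \<in> carrier E"
  by (simp add: idm_def \<sigma>_hom pe_closed is_path_Nil)

lemma idm_idem: "v \<in> verts Q \<Longrightarrow> idm v \<cdot> idm v = idm v"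
  by (simp add: idm_def \<sigma>_hom(2)[symmetric] pe_closed is_path_Nil pe_mult)

lemma idm_orth: "\<lbrakk>u \<in> verts Q; v \<in> verts Q; u \<noteq> v\<rbrakk> \<Longrightarrow> idm u \<cdot> idm v = \<zero>\<^bsub>E\<^esub>"
  by (simp add: idm_def \<sigma>_hom(2)[symmetric] pe_closed is_path_Nil pe_mult \<sigma>_zero)

lemma idm_sum: "finsum E idm (verts Q) = \<one>\<^bsub>E\<^esub>"
proof -
  have "finsum E idm (verts Q) = \<sigma> \<one>\<^bsub>kQ\<^esub>"
    unfolding idm_def one_eq_finsum
    by (rule alg_hom_finsum[OF \<sigma>_alg_hom assoc_algebra_kQ E_assoc_algebra, symmetric])
       (simp_all add: pe_closed is_path_Nil)
  then show ?thesis by (simp add: \<sigma>_hom)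
qed

text \<open>The vertex idempotents sum to one, so \<open>x\<close> is the sum of its Peirce
  components.\<close>

lemma subspace_Peirce:
  assumes N: "submodule K N E" and x: "x \<in> carrier E"
    and *: "\<And>u v. \<lbrakk>u \<in> verts Q; v \<in> verts Q\<rbrakk> \<Longrightarrow> idm u \<cdot> x \<cdot> idm v \<in> N"
  shows "x \<in> N"
proof -
  have 1: "idm u \<cdot> x \<in> N" if u: "u \<in> verts Q" for u
  proof -
    have "(\<Oplus>\<^bsub>E\<^esub>v\<in>verts Q. idm u \<cdot> x \<cdot> idm v) \<in> N"
      by (rule E.subspace_finsum[OF N]) (simp_all add: * u)
    also have "(\<Oplus>\<^bsub>E\<^esub>v\<in>verts Q. idm u \<cdot> x \<cdot> idm v) = idm u \<cdot> x \<cdot> finsum E idm (verts Q)"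
      using u x idm_closed by (intro E.finsum_rdistr[symmetric]) auto
    finally show ?thesis using u x idm_closed idm_sum by simp
  qed
  have "(\<Oplus>\<^bsub>E\<^esub>u\<in>verts Q. idm u \<cdot> x) \<in> N"
    by (rule E.subspace_finsum[OF N]) (simp_all add: 1)
  also have "(\<Oplus>\<^bsub>E\<^esub>u\<in>verts Q. idm u \<cdot> x) = finsum E idm (verts Q) \<cdot> x"
    using x idm_closed by (intro E.finsum_ldistr[symmetric]) auto
  finally show ?thesis using x idm_sum by simp
qed

lemma rad_carrier: "rad \<subseteq> carrier E"
  by (auto simp: rad_def)

lemma rad2_carrier: "rad2 \<subseteq> carrier E"
  using rad_carrier E.m_closed unfolding rad2_def by blast

lemma rad_mult_l:
  assumes "x \<in> carrier E" "y \<in> rad"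
  shows "x \<cdot> y \<in> rad"
proof -
  obtain f where f: "f \<in> filt 1" "fst y = cls f" "y \<in> carrier E" using assms by (auto simp: rad_def)
  obtain g where g: "g \<in> carrier kQ" "fst x = cls g"
    using assms(1) alg_homD(1)[OF fst_alg_hom] B_carrierE by metis
  have "g \<star> f \<in> filt (0 + 1)"
    using f g by (intro filt_mult) (simp_all add: filt_0)
  moreover have "fst (x \<cdot> y) = cls (g \<star> f)"
    using f g assms alg_homD(2)[OF fst_alg_hom] filt_carrier by (simp add: cls_hom)
  ultimately show ?thesis using f(3) assms(1) unfolding rad_def by auto
qed

lemma \<iota>_rad: "m \<in> carrier M \<Longrightarrow> \<iota> m \<in> rad"
  using \<iota>_closed filt_zero cls_zero by (force simp: rad_def \<iota>_def)

lemma \<sigma>_rad: "f \<in> filt 1 \<Longrightarrow> \<sigma> f \<in> rad"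
  unfolding rad_def using \<sigma>_hom(1)[OF filt_carrier]
  by (intro CollectI conjI bexI[of _ f]) (auto simp: \<sigma>_def)

text \<open>The projection to \<Gamma> turns the product into the class of a product of
  \<open>N\<close> elements of the arrow ideal, and such a class is zero.\<close>

lemma list_prod_rad_in_\<iota>:
  assumes N: "filt N \<subseteq> I" and xs: "length xs = N" "set xs \<subseteq> rad"
  shows "list_prod E xs \<in> \<iota> ` carrier M"
proof -
  obtain r where r: "\<And>x. x \<in> rad \<Longrightarrow> r x \<in> filt 1 \<and> fst x = cls (r x)"
  proof -
    have "\<forall>x\<in>rad. \<exists>f. f \<in> filt 1 \<and> fst x = cls f" by (auto simp: rad_def)
    then show ?thesis using that bchoice by metis
  qed
  let ?fs = "map r xs"
  have fs: "set ?fs \<subseteq> filt 1" using r xs by auto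
  then have fsc: "set ?fs \<subseteq> carrier kQ" using filt_carrier by blast
  have xsc: "set xs \<subseteq> carrier E" using xs rad_carrier by blast
  have "fst (list_prod E xs) = list_prod B (map fst xs)"
    by (rule alg_hom_list_prod[OF fst_alg_hom E_assoc_algebra xsc])
  also have "map fst xs = map cls ?fs" using r xs by auto
  also have "list_prod B (map cls ?fs) = cls (list_prod kQ ?fs)"
    by (rule alg_hom_list_prod[OF cls_alg_hom assoc_algebra_kQ fsc, symmetric])
  also have "\<dots> = \<zero>\<^bsub>B\<^esub>"
    using filt_list_prod[OF fs] N xs cls_eq_zero_iff[OF R.list_prod_closed[OF fsc]] by auto
  finally show ?thesis using E.list_prod_closed[OF xsc] by (simp add: \<iota>_image_iff)
qed

text \<open>The exponent is \<open>k * N\<close>: each block of \<open>N\<close> factors multiplies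
  into M, and \<open>k\<close> elements of M multiply to zero.\<close>

lemma rad_nilpotent:
  assumes "nilpotent_bimodule B M \<theta>"
  obtains L where "L > 1" "\<And>xs. \<lbrakk>length xs = L; set xs \<subseteq> rad\<rbrakk> \<Longrightarrow> list_prod E xs = \<zero>\<^bsub>E\<^esub>"
proof -
  obtain k where k: "k > 0" "\<And>ms. \<lbrakk>length ms = k; set ms \<subseteq> carrier M\<rbrakk> \<Longrightarrow> list_prod E (map \<iota> ms) = \<zero>\<^bsub>E\<^esub>"
    using nilpotentE[OF assms] by blast
  obtain N where N: "N > 1" "filt N \<subseteq> I" using ex_filt_subset by blast
  have *: "\<exists>ms. length ms = j \<and> set ms \<subseteq> carrier M \<and> list_prod E xs = list_prod E (map \<iota> ms)"
    if "length xs = j * N" "set xs \<subseteq> rad" for xs j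
    using that
  proof (induction j arbitrary: xs)
    case 0
    then show ?case by (intro exI[of _ "[]"]) simp
  next
    case (Suc j)
    have sub: "set (take N xs) \<subseteq> rad" "set (drop N xs) \<subseteq> rad"
      using Suc.prems(2) set_take_subset[of N xs] set_drop_subset[of N xs] by auto
    obtain m where m: "m \<in> carrier M" "list_prod E (take N xs) = \<iota> m"
      using list_prod_rad_in_\<iota>[OF N(2) _ sub(1)] Suc.prems(1) by auto
    obtain ms where ms: "length ms = j" "set ms \<subseteq> carrier M"
        "list_prod E (drop N xs) = list_prod E (map \<iota> ms)"
      using Suc.IH[OF _ sub(2)] Suc.prems(1) by auto
    have "list_prod E (take N xs @ drop N xs) = list_prod E (take N xs) \<cdot> list_prod E (drop N xs)"
      using sub rad_carrier by (intro E.list_prod_append) auto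
    then have "list_prod E xs = list_prod E (map \<iota> (m # ms))" using m ms by simp
    then show ?case using m(1) ms(1,2) by (intro exI[of _ "m # ms"]) auto
  qed
  have "list_prod E xs = \<zero>\<^bsub>E\<^esub>" if "length xs = k * N" "set xs \<subseteq> rad" for xs
    using *[OF that] k(2) by auto
  moreover have "k * N > 1" using k(1) N(1) by (metis less_1_mult' mult.commute mult_1 nat_less_le Suc_lessI One_nat_def)
  ultimately show ?thesis using that by blast
qed

text \<open>A Nakayama-type step: if \<open>S\<close> generates R modulo R^2 and is closed under
  products, then it generates R modulo every higher power. For nilpotent R the error term eventually
  vanishes.\<close>

lemma rad_subset_span_powers:
  assumes S: "S \<subseteq> rad" and S_mult: "\<And>x y. \<lbrakk>x \<in> S; y \<in> S\<rbrakk> \<Longrightarrow> x \<cdot> y \<in> S"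
    and gen: "rad \<subseteq> E.V.span (S \<union> rad2)"
  shows "k \<ge> 2 \<Longrightarrow> rad \<subseteq> E.V.span (S \<union> {list_prod E xs | xs. length xs = k \<and> set xs \<subseteq> rad})"
proof (induction k rule: dec_induct)
  let ?P = "\<lambda>k. {list_prod E xs | xs. length xs = k \<and> set xs \<subseteq> rad}"
  have P_carrier: "?P k \<subseteq> carrier E" for k
  proof
    fix z assume "z \<in> ?P k"
    then obtain xs where "z = list_prod E xs" "set xs \<subseteq> rad" by blast
    then show "z \<in> carrier E" using rad_carrier E.list_prod_closed[of xs] by blast
  qed
  then have SP: "S \<union> ?P k \<subseteq> carrier E" for k using S rad_carrier by blast
  {
    case base
    have "rad2 \<subseteq> ?P 2"
    proof
      fix z assume "z \<in> rad2"
      then obtain x y where xy: "x \<in> rad" "y \<in> rad" "z = x \<cdot> y" by (auto simp: rad2_def)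
      then have "z = list_prod E [x, y]" using rad_carrier by auto
      then show "z \<in> ?P 2" using xy by (intro CollectI exI[of _ "[x, y]"]) simp
    qed
    then have "E.V.span (S \<union> rad2) \<subseteq> E.V.span (S \<union> ?P 2)"
      using E.span_superset[OF SP] by (intro E.span_least E.span_subspace SP) blast
    then show ?case using gen by blast
  next
    case (step k)
    let ?U = "E.V.span (S \<union> ?P (Suc k))"
    note U = E.span_subspace[OF SP, of "Suc k"]
    have Pk_rad: "?P k \<subseteq> rad"
    proof
      fix z assume "z \<in> ?P k"
      then obtain xs where xs: "z = list_prod E xs" "length xs = k" "set xs \<subseteq> rad" by blast
      then obtain ys y where ys: "xs = ys @ [y]" using step(1) by (cases xs rule: rev_cases) auto
      have "list_prod E (ys @ [y]) = list_prod E ys \<cdot> y"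
        using xs(3) ys rad_carrier by (subst E.list_prod_append) auto
      then show "z \<in> rad"
        using xs ys rad_carrier by (auto intro!: rad_mult_l E.list_prod_closed)
    qed
    have l: "x \<cdot> y \<in> ?P (Suc k)" if x: "x \<in> rad" and y: "y \<in> ?P k" for x y
    proof -
      obtain ys where ys: "y = list_prod E ys" "length ys = k" "set ys \<subseteq> rad" using y by blast
      then show ?thesis using x by (intro CollectI exI[of _ "x # ys"]) simp
    qed
    have r: "y \<cdot> x \<in> ?P (Suc k)" if x: "x \<in> rad" and y: "y \<in> ?P k" for x y
    proof -
      obtain ys where ys: "y = list_prod E ys" "length ys = k" "set ys \<subseteq> rad" using y by blast
      have "list_prod E (ys @ [x]) = list_prod E ys \<cdot> x"
        using ys(3) x rad_carrier by (subst E.list_prod_append) auto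
      then show ?thesis using x ys by (intro CollectI exI[of _ "ys @ [x]"]) simp
    qed
    \<comment> \<open>By induction, both factors are combinations of \<open>S\<close> and of
      products of \<open>k\<close> elements. A product of two elements of \<open>S\<close> is in
      \<open>S\<close>; in every other case one factor has length \<open>k\<close> and the other one
      lies in R, which gives a product of \<open>k + 1\<close> elements.\<close>
    have "rad2 \<subseteq> ?U"
    proof
      fix z assume "z \<in> rad2"
      then obtain x y where xy: "x \<in> rad" "y \<in> rad" "z = x \<cdot> y" by (auto simp: rad2_def)
      have "x \<cdot> y \<in> ?U"
      proof (rule E.span_mult[OF U SP SP])
        show "x \<in> E.V.span (S \<union> ?P k)" "y \<in> E.V.span (S \<union> ?P k)" using xy step(3) by blast+
        fix a b assume ab: "a \<in> S \<union> ?P k" "b \<in> S \<union> ?P k"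
        then have "a \<in> rad" "b \<in> rad" using S Pk_rad by blast+
        then have "a \<cdot> b \<in> S \<union> ?P (Suc k)" using ab S_mult l r by blast
        then show "a \<cdot> b \<in> ?U" by (rule E.span_superset[OF SP])
      qed
      then show "z \<in> ?U" using xy by simp
    qed
    then have "E.V.span (S \<union> rad2) \<subseteq> ?U"
      using E.span_superset[OF SP] by (intro E.span_least U) blast
    then show ?case using gen by blast
  }
qed

text \<open>The Peirce components of a finite spanning set still span M and have well-defined ends,
  so they can serve as arrows. A subset of least cardinality that spans M modulo R^2 has the
  required minimality.\<close>

lemma minimal_generators:
  obtains G where "finite G" "G \<subseteq> \<iota> ` carrier M"
    "\<And>b. b \<in> G \<Longrightarrow> \<exists>u\<in>verts Q. \<exists>v\<in>verts Q. idm u \<cdot> b = b \<and> b \<cdot> idm v = b"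
    "\<iota> ` carrier M \<subseteq> E.V.span (G \<union> rad2)"
    "\<And>b. b \<in> G \<Longrightarrow> b \<notin> E.V.span (G - {b} \<union> rad2)"
proof -
  obtain S where S: "finite S" "S \<subseteq> carrier M" "\<iota> ` carrier M \<subseteq> E.V.span (\<iota> ` S)"
    by (rule finite_spanning_set)
  let ?f = "\<lambda>(u, s, v). idm u \<cdot> \<iota> s \<cdot> idm v"
  let ?G0 = "?f ` (verts Q \<times> S \<times> verts Q)"
  have G0: "finite ?G0" using S(1) by (intro finite_imageI finite_cartesian_product) auto
  have G0_\<iota>: "?G0 \<subseteq> \<iota> ` carrier M"
  proof
    fix x assume "x \<in> ?G0"
    then obtain u s v where x: "x = idm u \<cdot> \<iota> s \<cdot> idm v" "u \<in> verts Q" "v \<in> verts Q" "s \<in> S" by auto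
    have "\<iota> s \<in> \<iota> ` carrier M" using x(4) S(2) by blast
    then show "x \<in> \<iota> ` carrier M"
      unfolding x(1) using x(2,3) by (intro \<iota>_image_mult idm_closed)
  qed
  have \<iota>E: "\<iota> ` carrier M \<subseteq> carrier E" using \<iota>_closed by auto
  have G0_E: "?G0 \<subseteq> carrier E" using G0_\<iota> \<iota>E by (rule subset_trans)
  have GE: "G \<union> rad2 \<subseteq> carrier E" if "G \<subseteq> ?G0" for G
    using that G0_E rad2_carrier by (intro Un_least) (auto dest: subset_trans)
  define good where "good G \<longleftrightarrow> G \<subseteq> ?G0 \<and> \<iota> ` carrier M \<subseteq> E.V.span (G \<union> rad2)" for G
  have "good ?G0"
    unfolding good_def
  proof (intro conjI subset_refl)
    note sub = E.span_subspace[OF GE[OF subset_refl]]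
    have "\<iota> ` S \<subseteq> E.V.span (?G0 \<union> rad2)"
    proof
      fix x assume "x \<in> \<iota> ` S"
      then obtain s where s: "x = \<iota> s" "s \<in> S" by blast
      show "x \<in> E.V.span (?G0 \<union> rad2)"
      proof (rule subspace_Peirce[OF sub])
        show "x \<in> carrier E" using s S(2) \<iota>_closed by auto
        fix u v assume "u \<in> verts Q" "v \<in> verts Q"
        then have "idm u \<cdot> x \<cdot> idm v \<in> ?G0"
          using s by (intro image_eqI[of _ _ "(u, s, v)"]) auto
        then show "idm u \<cdot> x \<cdot> idm v \<in> E.V.span (?G0 \<union> rad2)"
          by (intro E.span_superset[OF GE[OF subset_refl]] UnI1)
      qed
    qed
    then show "\<iota> ` carrier M \<subseteq> E.V.span (?G0 \<union> rad2)"
      using E.span_least[OF sub] S(3) by (meson subset_trans)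
  qed
  then obtain G where G: "good G" and least: "\<And>G'. good G' \<Longrightarrow> card G \<le> card G'"
    using ex_has_least_nat[of good ?G0 card] by blast
  have GG0: "G \<subseteq> ?G0" and gen: "\<iota> ` carrier M \<subseteq> E.V.span (G \<union> rad2)" using G by (auto simp: good_def)
  have fin: "finite G" by (rule finite_subset[OF GG0 G0])
  show ?thesis
  proof (rule that[OF fin _ _ gen])
    show "G \<subseteq> \<iota> ` carrier M" using GG0 G0_\<iota> by (rule subset_trans)
  next
    fix b assume "b \<in> G"
    then obtain u s v where b: "b = idm u \<cdot> \<iota> s \<cdot> idm v" "u \<in> verts Q" "v \<in> verts Q" "s \<in> S"
      using GG0 by auto
    have cl: "idm u \<in> carrier E" "idm v \<in> carrier E" "\<iota> s \<in> carrier E"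
      using b S(2) idm_closed \<iota>_closed by auto
    have "idm u \<cdot> b = (idm u \<cdot> idm u) \<cdot> \<iota> s \<cdot> idm v"
      using cl unfolding b(1) by (simp add: E.m_assoc)
    moreover have "b \<cdot> idm v = idm u \<cdot> \<iota> s \<cdot> (idm v \<cdot> idm v)"
      using cl unfolding b(1) by (simp add: E.m_assoc)
    ultimately have "idm u \<cdot> b = b \<and> b \<cdot> idm v = b"
      using b idm_idem by simp
    then show "\<exists>u\<in>verts Q. \<exists>v\<in>verts Q. idm u \<cdot> b = b \<and> b \<cdot> idm v = b"
      using b(2,3) by blast
  next
    fix b assume b: "b \<in> G"
    show "b \<notin> E.V.span (G - {b} \<union> rad2)"
    proof
      assume b_in: "b \<in> E.V.span (G - {b} \<union> rad2)"
      have sub: "G - {b} \<union> rad2 \<subseteq> carrier E" using GG0 by (intro GE) blast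
      have "G \<union> rad2 \<subseteq> E.V.span (G - {b} \<union> rad2)"
        using b_in E.span_superset[OF sub] by blast
      then have "E.V.span (G \<union> rad2) \<subseteq> E.V.span (G - {b} \<union> rad2)"
        by (rule E.span_least[OF E.span_subspace[OF sub]])
      \<comment> \<open>A redundant member could be dropped without losing the generating property,
        against the least cardinality of \<open>G\<close>.\<close>
      then have "good (G - {b})" using gen GG0 by (auto simp: good_def)
      then have "card G \<le> card (G - {b})" by (rule least)
      then show False using card_Diff1_less[OF fin b] by linarith
    qed
  qed
qed

end


section \<open>The quiver of the split extension\<close>

context bound_quiver_alg
begin

lemma coef_zero: "length (snd p) \<le> 1 \<Longrightarrow> coef p \<zero>\<^bsub>B\<^esub> = \<zero>"
  by (simp add: cls_zero[symmetric] coef_cls zero_closed zero_apply)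

lemma coef_add:
  assumes "X \<in> carrier B" "Y \<in> carrier B" "length (snd p) \<le> 1"
  shows "coef p (X \<oplus>\<^bsub>B\<^esub> Y) = coef p X \<oplus> coef p Y"
proof -
  obtain f g where "f \<in> carrier kQ" "X = cls f" "g \<in> carrier kQ" "Y = cls g"
    using assms B_carrierE by metis
  then show ?thesis
    using assms(3) by (simp add: cls_hom(3)[symmetric] coef_cls add_closed add_apply)
qed

lemma coef_smult:
  assumes "a \<in> carrier K" "X \<in> carrier B" "length (snd p) \<le> 1"
  shows "coef p (a \<odot>\<^bsub>B\<^esub> X) = a \<otimes> coef p X"
proof -
  obtain f where "f \<in> carrier kQ" "X = cls f"
    using assms B_carrierE by metis
  then show ?thesis
    using assms(1,3) by (simp add: cls_hom(5)[symmetric] coef_cls smult_closed smult_apply)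
qed

end

text \<open>The new quiver must be one on natural numbers. Hence \<open>fv\<close> and
  \<open>fa\<close> number the \<open>n\<close> vertices and \<open>m\<close> arrows of
  \<open>Q\<close>, while \<open>fb\<close> numbers the \<open>l\<close> minimal generators, whose
  Peirce ends \<open>tb\<close> and \<open>hb\<close> become tail and head of a new arrow.\<close>

locale ext_quiver = bound_quiver_bimodule K Q I M \<theta>
  for K :: "('k, 'c) ring_scheme" and Q :: "('v, 'e) pre_digraph"
    and I :: "('v \<times> 'e list \<Rightarrow> 'k) set"
    and M :: "(('v \<times> 'e list \<Rightarrow> 'k) set, 'm, 'd) bimodule_scheme" and \<theta> :: "'m tensor_fun" +
  fixes fv :: "nat \<Rightarrow> 'v" and fa :: "nat \<Rightarrow> 'e"
    and fb :: "nat \<Rightarrow> ('v \<times> 'e list \<Rightarrow> 'k) set \<times> 'm" and tb hb :: "nat \<Rightarrow> 'v" and n m l :: nat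
  assumes bij_v: "bij_betw fv {..<n} (verts Q)" and bij_a: "bij_betw fa {..<m} (arcs Q)"
    and inj_b: "inj_on fb {..<l}"
    and fb_M: "j < l \<Longrightarrow> fb j \<in> \<iota> ` carrier M"
    and tb_verts: "j < l \<Longrightarrow> tb j \<in> verts Q" and hb_verts: "j < l \<Longrightarrow> hb j \<in> verts Q"
    and tb_mult: "j < l \<Longrightarrow> idm (tb j) \<cdot> fb j = fb j"
    and hb_mult: "j < l \<Longrightarrow> fb j \<cdot> idm (hb j) = fb j"
    and generating: "\<iota> ` carrier M \<subseteq> E.V.span (fb ` {..<l} \<union> rad2)"
    and minimal: "j < l \<Longrightarrow> fb j \<notin> E.V.span (fb ` {..<l} - {fb j} \<union> rad2)"
    and nilpotent: "nilpotent_bimodule B M \<theta>"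
begin

definition "gv = inv_into {..<n} fv"
definition "ga = inv_into {..<m} fa"

text \<open>Arrows below \<open>m\<close> are the old ones, and \<open>m + j\<close> is the new
  arrow for the generator \<open>fb j\<close>. Ends are translated back to numbers by
  \<open>gv\<close>.\<close>

definition Q' :: nat_quiver where
  "Q' = \<lparr>verts = {..<n}, arcs = {..<m + l},
     tail = (\<lambda>a. gv (if a < m then tail Q (fa a) else tb (a - m))),
     head = (\<lambda>a. gv (if a < m then head Q (fa a) else hb (a - m)))\<rparr>"

definition "eV i = idm (fv i)"

definition "eA a = (if a < m then \<sigma> (pe (tail Q (fa a), [fa a])) else fb (a - m))"

lemma fv_verts: "i < n \<Longrightarrow> fv i \<in> verts Q"
  using bij_v by (auto simp: bij_betw_def)

lemma fa_arcs: "a < m \<Longrightarrow> fa a \<in> arcs Q"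
  using bij_a by (auto simp: bij_betw_def)

lemma fv_gv: "v \<in> verts Q \<Longrightarrow> fv (gv v) = v"
  unfolding gv_def by (rule bij_betw_inv_into_right[OF bij_v])

lemma gv_less: "v \<in> verts Q \<Longrightarrow> gv v < n"
  unfolding gv_def using bij_v inv_into_into[of v fv "{..<n}"] by (auto simp: bij_betw_def)

lemma fa_ga: "a \<in> arcs Q \<Longrightarrow> fa (ga a) = a"
  unfolding ga_def by (rule bij_betw_inv_into_right[OF bij_a])

lemma ga_less: "a \<in> arcs Q \<Longrightarrow> ga a < m"
  unfolding ga_def using bij_a inv_into_into[of a fa "{..<m}"] by (auto simp: bij_betw_def)

lemma Q'_simps:
  "verts Q' = {..<n}" "arcs Q' = {..<m + l}"
  "a < m \<Longrightarrow> tail Q' a = gv (tail Q (fa a))" "a < m \<Longrightarrow> head Q' a = gv (head Q (fa a))"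
  "\<not> a < m \<Longrightarrow> tail Q' a = gv (tb (a - m))" "\<not> a < m \<Longrightarrow> head Q' a = gv (hb (a - m))"
  by (simp_all add: Q'_def)

lemma fin_digraph_Q': "fin_digraph Q'"
proof (intro fin_digraph.intro wf_digraph.intro fin_digraph_axioms.intro)
  fix a assume a: "a \<in> arcs Q'"
  show "tail Q' a \<in> verts Q'" "head Q' a \<in> verts Q'"
    using a fa_arcs[of a] tb_verts[of "a - m"] hb_verts[of "a - m"]
    by (cases "a < m"; simp add: Q'_simps gv_less)+
qed (simp_all add: Q'_simps)

lemma fb_closed: "j < l \<Longrightarrow> fb j \<in> carrier E"
  using fb_M \<iota>_image_iff by blast

lemma new_index: "\<lbrakk>a \<in> arcs Q'; \<not> a < m\<rbrakk> \<Longrightarrow> a - m < l"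
  by (auto simp: Q'_simps)

lemma old_arc_path: "a < m \<Longrightarrow> is_path Q (tail Q (fa a), [fa a])"
  by (simp add: arc_is_path fa_arcs)

lemma eA_closed': "a \<in> arcs Q' \<Longrightarrow> eA a \<in> carrier E"
  using new_index fb_closed by (auto simp: eA_def intro!: \<sigma>_hom pe_closed old_arc_path)

sublocale rep: quiver_rep K Q' E eV eA
proof (intro quiver_rep.intro path_alg.intro k_algebra.intro quiver_rep_axioms.intro)
  show "field K" by (rule field_K)
  show "fin_digraph Q'" by (rule fin_digraph_Q')
  show "assoc_algebra K E" by (rule E_assoc_algebra)
  show "eV v \<in> carrier E" "eV v \<cdot> eV v = eV v" if "v \<in> verts Q'" for v
    using that by (simp_all add: eV_def idm_closed idm_idem fv_verts Q'_simps)
  show "eV u \<cdot> eV v = \<zero>\<^bsub>E\<^esub>" if "u \<in> verts Q'" "v \<in> verts Q'" "u \<noteq> v" for u v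
  proof -
    have "fv u \<noteq> fv v" using that bij_v by (auto simp: Q'_simps bij_betw_def inj_on_def)
    then show ?thesis using that by (simp add: eV_def idm_orth fv_verts Q'_simps)
  qed
  show "finsum E eV (verts Q') = \<one>\<^bsub>E\<^esub>"
  proof -
    have "finsum E idm (fv ` {..<n}) = finsum E (\<lambda>i. idm (fv i)) {..<n}"
      using bij_v idm_closed fv_verts by (intro E.finsum_reindex) (auto simp: bij_betw_def)
    moreover have "fv ` {..<n} = verts Q" using bij_v by (simp add: bij_betw_def)
    ultimately have "finsum E (\<lambda>i. idm (fv i)) {..<n} = \<one>\<^bsub>E\<^esub>" using idm_sum by simp
    then show ?thesis by (simp add: eV_def[abs_def] Q'_simps)
  qed
  fix a assume a: "a \<in> arcs Q'"
  show "eA a \<in> carrier E" using a by (rule eA_closed')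
  show "eV (tail Q' a) \<cdot> eA a = eA a"
  proof (cases "a < m")
    case True
    then have p: "is_path Q (tail Q (fa a), [fa a])" "is_path Q (tail Q (fa a), [])"
      using old_arc_path fst_in_verts[OF old_arc_path[OF True]] by (auto simp: is_path_Nil)
    have "\<sigma> (pe (tail Q (fa a), [])) \<cdot> \<sigma> (pe (tail Q (fa a), [fa a])) = \<sigma> (pe (tail Q (fa a), [fa a]))"
      using p by (simp add: \<sigma>_hom(2)[symmetric] pe_closed pe_mult)
    then show ?thesis
      using True fa_arcs[OF True] by (simp add: eA_def eV_def idm_def Q'_simps fv_gv)
  next
    case False
    then show ?thesis
      using new_index[OF a] by (simp add: eA_def eV_def Q'_simps fv_gv tb_verts tb_mult)
  qed
  show "eA a \<cdot> eV (head Q' a) = eA a"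
  proof (cases "a < m")
    case True
    then have p: "is_path Q (tail Q (fa a), [fa a])" "is_path Q (head Q (fa a), [])"
      using old_arc_path path_end_in_verts[OF old_arc_path[OF True]] by (auto simp: is_path_Nil)
    have "\<sigma> (pe (tail Q (fa a), [fa a])) \<cdot> \<sigma> (pe (head Q (fa a), [])) = \<sigma> (pe (tail Q (fa a), [fa a]))"
      using p by (simp add: \<sigma>_hom(2)[symmetric] pe_closed pe_mult)
    then show ?thesis
      using True fa_arcs[OF True] by (simp add: eA_def eV_def idm_def Q'_simps fv_gv)
  next
    case False
    then show ?thesis
      using new_index[OF a] by (simp add: eA_def eV_def Q'_simps fv_gv hb_verts hb_mult)
  qed
qed

lemma snoc_path:
  assumes "is_path Q' (i, es @ [a])"
  shows "is_path Q' (i, es)" "a \<in> arcs Q'" "rep.path_end (i, es) = tail Q' a"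
  using assms by (auto simp: rep.is_path_append rep.is_path_Cons)

text \<open>The end vertex is carried through the induction because the next arrow has to be
  composable with the path already translated.\<close>

lemma old_path:
  assumes "is_path Q' (i, es)" "set es \<subseteq> {..<m}"
  shows "is_path Q (fv i, map fa es) \<and> path_end (fv i, map fa es) = fv (rep.path_end (i, es)) \<and>
    rep.ev (i, es) = \<sigma> (pe (fv i, map fa es))"
  using assms
proof (induction es rule: rev_induct)
  case Nil
  then show ?case
    by (simp add: rep.is_path_Nil is_path_Nil Q'_simps fv_verts rep.ev_Nil) (simp add: eV_def idm_def)
next
  case (snoc a es)
  note a = snoc_path[OF snoc.prems(1)]
  have am: "a < m" using snoc.prems(2) by simp
  have IH: "is_path Q (fv i, map fa es)" "path_end (fv i, map fa es) = fv (tail Q' a)"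
      "rep.ev (i, es) = \<sigma> (pe (fv i, map fa es))"
    using snoc a by auto
  have t: "fv (tail Q' a) = tail Q (fa a)" "fv (head Q' a) = head Q (fa a)"
    using am fa_arcs[OF am] by (simp_all add: Q'_simps fv_gv)
  have p: "is_path Q (fv i, map fa (es @ [a]))"
    using IH t old_arc_path[OF am] by (simp add: is_path_append)
  have "rep.ev (i, es @ [a]) = \<sigma> (pe (fv i, map fa es)) \<cdot> \<sigma> (pe (tail Q (fa a), [fa a]))"
    using rep.ev_snoc[OF snoc.prems(1)] IH(3) am by (simp add: eA_def)
  also have "\<dots> = \<sigma> (pe (fv i, map fa (es @ [a])))"
    using IH t old_arc_path[OF am] by (simp add: \<sigma>_hom(2)[symmetric] pe_closed pe_mult)
  finally show ?case using p t by simp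
qed

text \<open>M is an ideal of E, so a single new arrow anywhere in the path puts the whole product
  into M.\<close>

lemma new_path:
  assumes "is_path Q' (i, es)" "\<not> set es \<subseteq> {..<m}"
  shows "rep.ev (i, es) \<in> \<iota> ` carrier M"
  using assms
proof (induction es rule: rev_induct)
  case (snoc a es)
  note a = snoc_path[OF snoc.prems(1)]
  have ev: "rep.ev (i, es @ [a]) = rep.ev (i, es) \<cdot> eA a"
    by (rule rep.ev_snoc[OF snoc.prems(1)])
  show ?case
  proof (cases "a < m")
    case True
    then have "rep.ev (i, es) \<in> \<iota> ` carrier M" using snoc a by auto
    then show ?thesis
      unfolding ev using eA_closed'[OF a(2)] by (rule \<iota>_image_mult)
  next
    case False
    then have "eA a \<in> \<iota> ` carrier M" using fb_M[OF new_index[OF a(2)]] by (simp add: eA_def)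
    then show ?thesis
      unfolding ev using rep.ev_closed[OF a(1)] by (rule \<iota>_image_mult)
  qed
qed simp

lemma relabelled_path: "is_path Q (v, es) \<Longrightarrow> is_path Q' (gv v, map ga es)"
proof (induction es arbitrary: v)
  case Nil
  then show ?case by (simp add: is_path_Nil rep.is_path_Nil Q'_simps gv_less)
next
  case (Cons a es)
  then have a: "a \<in> arcs Q" "v = tail Q a" "is_path Q (head Q a, es)"
    by (simp_all add: is_path_Cons)
  have "ga a \<in> arcs Q'" "tail Q' (ga a) = gv v" "head Q' (ga a) = gv (head Q a)"
    using ga_less[OF a(1)] a by (simp_all add: Q'_simps fa_ga)
  then show ?case using Cons.IH[OF a(3)] by (simp add: rep.is_path_Cons)
qed

lemma eA_rad:
  assumes "a \<in> arcs Q'"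
  shows "eA a \<in> rad"
proof (cases "a < m")
  case True
  then show ?thesis by (auto simp: eA_def intro!: \<sigma>_rad filt_pe old_arc_path)
next
  case False
  then have "eA a \<in> \<iota> ` carrier M" using fb_M[OF new_index[OF assms]] by (simp add: eA_def)
  then show ?thesis by (rule imageE) (simp only: \<iota>_rad)
qed

lemma ev_rad:
  assumes "is_path Q' p" "snd p \<noteq> []"
  shows "rep.ev p \<in> rad"
proof -
  obtain i es a where p: "p = (i, es @ [a])"
    using assms(2) by (cases p; cases "snd p" rule: rev_cases) auto
  note a = snoc_path[OF assms(1)[unfolded p]]
  show ?thesis
    unfolding p rep.ev_snoc[OF assms(1)[unfolded p]]
    by (intro rad_mult_l rep.ev_closed eA_rad a)
qed

lemma ev_rad2:
  assumes "is_path Q' p" "2 \<le> length (snd p)"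
  shows "rep.ev p \<in> rad2"
proof -
  obtain i es a where p: "p = (i, es @ [a])" "es \<noteq> []"
    using assms(2) by (cases p; cases "snd p" rule: rev_cases) (auto simp: Suc_le_eq)
  note a = snoc_path[OF assms(1)[unfolded p]]
  have "rep.ev (i, es) \<in> rad" using p(2) by (intro ev_rad a) simp
  then show ?thesis
    unfolding p rep.ev_snoc[OF assms(1)[unfolded p]] rad2_def using eA_rad[OF a(2)] by blast
qed

text \<open>Paths with a new arrow have zero \<Gamma> component, and an old path goes to the class
  of its translation, where distinct paths stay distinct. The bound on the length is what makes
  \<open>coef\<close> independent of representatives.\<close>

lemma coef_\<phi>:
  assumes f: "f \<in> carrier rep.kQ" and q: "length es \<le> 1" "i < n" "set es \<subseteq> {..<m}"
  shows "coef (fv i, map fa es) (fst (rep.\<phi> f)) = f (i, es)"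
  using f
proof (induction f rule: rep.path_induct)
  case zero
  show ?case using q unfolding rep.\<phi>_zero by (simp add: E_zero coef_zero rep.zero_apply)
next
  case (add a p g)
  obtain j fs where p: "p = (j, fs)" by force
  have cl: "rep.ev p \<in> carrier E" "rep.\<phi> g \<in> carrier E"
    using add by (simp_all add: rep.ev_closed rep.\<phi>_closed)
  note fst_hom = alg_homD[OF fst_alg_hom]
  have "coef (fv i, map fa es) (fst (rep.ev p)) = rep.pe p (i, es)"
  proof (cases "set fs \<subseteq> {..<m}")
    case True
    note old = old_path[OF add(2)[unfolded p] True]
    have "j < n" using rep.fst_in_verts[OF add(2)] p by (simp add: Q'_simps)
    then have "fv i = fv j \<longleftrightarrow> i = j" using q(2) bij_v by (auto simp: bij_betw_def inj_on_def)
    moreover have "inj_on fa (set es \<union> set fs)"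
      by (rule inj_on_subset[OF bij_betw_imp_inj_on[OF bij_a]]) (simp add: q(3) True)
    then have "map fa es = map fa fs \<longleftrightarrow> es = fs" by (rule inj_on_map_eq_map)
    ultimately show ?thesis
      using old q(1) p by (simp add: \<sigma>_def coef_cls pe_closed pe_apply rep.pe_apply)
  next
    case False
    then have "fst (rep.ev p) = \<zero>\<^bsub>B\<^esub>" using new_path[OF add(2)[unfolded p]] p \<iota>_image_iff by auto
    moreover have "p \<noteq> (i, es)" using False q(3) p by auto
    ultimately show ?thesis using q(1) by (simp add: coef_zero rep.pe_apply)
  qed
  then have 1: "coef (fv i, map fa es) (fst (a \<odot>\<^bsub>E\<^esub> rep.ev p \<oplus>\<^bsub>E\<^esub> rep.\<phi> g)) =
      a \<otimes>\<^bsub>K\<^esub> rep.pe p (i, es) \<oplus>\<^bsub>K\<^esub> g (i, es)"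
    using add cl q(1) by (simp add: fst_hom coef_add coef_smult)
  have 2: "rep.\<phi> (a \<odot>\<^bsub>rep.kQ\<^esub> rep.pe p \<oplus>\<^bsub>rep.kQ\<^esub> g) = a \<odot>\<^bsub>E\<^esub> rep.ev p \<oplus>\<^bsub>E\<^esub> rep.\<phi> g"
    using add by (simp add: rep.\<phi>_combination)
  show ?case
    unfolding 2 1 by (simp add: rep.add_apply rep.smult_apply)
qed

section \<open>The kernel and its admissibility\<close>

definition "I' = {f \<in> carrier rep.kQ. rep.\<phi> f = \<zero>\<^bsub>E\<^esub>}"

lemma I'_iff: "f \<in> I' \<longleftrightarrow> f \<in> carrier rep.kQ \<and> rep.\<phi> f = \<zero>\<^bsub>E\<^esub>"
  unfolding I'_def by (rule mem_Collect_eq)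

lemmas I'D = I'_iff[THEN iffD1, THEN conjunct1] I'_iff[THEN iffD1, THEN conjunct2]
lemmas I'I = I'_iff[THEN iffD2, OF conjI]

lemma ideal_I': "ideal I' rep.kQ"
  unfolding I'_def by (rule rep.R.kernel_ideal[OF rep.\<phi>_alg_hom E_assoc_algebra])

lemma kernel_old_coefficient:
  assumes "f \<in> I'" "length (snd p) \<le> 1" "set (snd p) \<subseteq> {..<m}"
  shows "f p = \<zero>\<^bsub>K\<^esub>"
proof (rule ccontr)
  assume nz: "f p \<noteq> \<zero>\<^bsub>K\<^esub>"
  have f: "f \<in> carrier rep.kQ" "rep.\<phi> f = \<zero>\<^bsub>E\<^esub>" using assms(1) by (auto simp: I'_def)
  obtain i es where p: "p = (i, es)" by force
  have "i < n" using rep.fst_in_verts[OF rep.is_path_support[OF f(1) nz]] p by (simp add: Q'_simps)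
  then have "f p = coef (fv i, map fa es) (fst (rep.\<phi> f))"
    using coef_\<phi>[OF f(1)] assms(2,3) p by simp
  then show False using nz f(2) assms(2) p by (simp add: E_zero coef_zero)
qed

text \<open>Every other term of \<open>f\<close> is mapped into the span of the remaining generators
  and R^2: paths of length at least 2 go to R^2, other new arrows to other generators, and vertices
  and old arrows do not occur by \<open>kernel_old_coefficient\<close>. A non-zero coefficient would
  therefore put \<open>fb ?j\<close> into this span, against minimality.\<close>

lemma kernel_new_coefficient:
  assumes f: "f \<in> I'" and a: "a \<in> arcs Q'" "\<not> a < m"
  shows "f (tail Q' a, [a]) = \<zero>\<^bsub>K\<^esub>"
proof (rule ccontr)
  let ?p = "(tail Q' a, [a])"
  let ?c = "f ?p"
  assume nz: "?c \<noteq> \<zero>\<^bsub>K\<^esub>"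
  have fc: "f \<in> carrier rep.kQ" "rep.\<phi> f = \<zero>\<^bsub>E\<^esub>" using f by (auto simp: I'_def)
  have p: "is_path Q' ?p" by (rule rep.arc_is_path[OF a(1)])
  have c: "?c \<in> carrier K" "\<ominus>\<^bsub>K\<^esub> ?c \<in> carrier K" using fc(1) by simp_all
  let ?j = "a - m"
  have j: "?j < l" using new_index a by blast
  let ?G = "fb ` {..<l} - {fb ?j} \<union> rad2"
  have GE: "?G \<subseteq> carrier E" using fb_closed rad2_carrier by auto
  note W = E.span_subspace[OF GE]
  note WD = E.subspaceD[OF W]
  \<comment> \<open>\<open>f\<close> without its term at \<open>?p\<close>. Since \<open>f\<close>
    is in the kernel, the image of \<open>h\<close> is minus that term, a multiple of
    \<open>fb ?j\<close>.\<close>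
  define h where "h = (\<ominus>\<^bsub>K\<^esub> ?c) \<odot>\<^bsub>rep.kQ\<^esub> rep.pe ?p \<oplus>\<^bsub>rep.kQ\<^esub> f"
  have h: "h \<in> carrier rep.kQ"
    unfolding h_def by (intro rep.add_closed rep.smult_closed rep.pe_closed p c fc)
  have h_p: "h ?p = \<zero>\<^bsub>K\<^esub>"
    using c fc by (simp add: h_def rep.add_apply rep.smult_apply rep.pe_apply K.l_neg)
  have h_q: "h q = f q" if "q \<noteq> ?p" for q
    using that c fc by (simp add: h_def rep.add_apply rep.smult_apply rep.pe_apply)
  have ev_W: "rep.ev q \<in> E.V.span ?G" if q: "is_path Q' q" "h q \<noteq> \<zero>\<^bsub>K\<^esub>" for q
  proof -
    have qp: "q \<noteq> ?p" using q(2) h_p by blast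
    then have fq: "f q \<noteq> \<zero>\<^bsub>K\<^esub>" using q(2) h_q by simp
    have "rep.ev q \<in> ?G"
    proof (cases "2 \<le> length (snd q)")
      case True
      then show ?thesis using ev_rad2[OF q(1)] by blast
    next
      case False
      then have "\<not> set (snd q) \<subseteq> {..<m}"
        using kernel_old_coefficient[OF f, of q] fq by auto
      then obtain b where b: "snd q = [b]" "\<not> b < m"
        using False by (cases "snd q") (auto simp: Suc_le_eq)
      then have b': "b \<in> arcs Q'" "q = (tail Q' b, [b])"
        using q(1) by (cases q; simp add: rep.is_path_Cons)+
      then have "b \<noteq> a" using qp by blast
      moreover have bl: "b - m < l" using new_index b' b by blast
      ultimately have "fb (b - m) \<noteq> fb ?j"
        using j a(2) b(2) inj_onD[OF inj_b, of "b - m" ?j] by auto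
      moreover have "rep.ev q = fb (b - m)"
        using b' b by (simp add: rep.ev_arc eA_def)
      ultimately show ?thesis using bl by auto
    qed
    then show ?thesis by (rule E.span_superset[OF GE])
  qed
  have "rep.\<phi> h \<in> E.V.span ?G"
    using h
  proof (induction h rule: rep.path_induct)
    case zero
    then show ?case using WD(2) by (simp add: rep.\<phi>_zero)
  next
    case (add b q g)
    then show ?case
      using ev_W[OF add(2,3)] WD(3,4)
      by (simp add: rep.\<phi>_combination)
  qed
  also have "rep.\<phi> h = (\<ominus>\<^bsub>K\<^esub> ?c) \<odot>\<^bsub>E\<^esub> fb ?j"
    unfolding h_def using p c fc fb_closed[OF j] a
    by (simp add: rep.\<phi>_combination rep.ev_arc eA_def)
  finally have in_W: "(\<ominus>\<^bsub>K\<^esub> ?c) \<odot>\<^bsub>E\<^esub> fb ?j \<in> E.V.span ?G" .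
  let ?d = "inv\<^bsub>K\<^esub> (\<ominus>\<^bsub>K\<^esub> ?c)"
  have "\<ominus>\<^bsub>K\<^esub> ?c \<noteq> \<zero>\<^bsub>K\<^esub>" using nz c(1) by (metis K.minus_minus K.minus_zero)
  then have d: "?d \<in> carrier K" "?d \<otimes>\<^bsub>K\<^esub> (\<ominus>\<^bsub>K\<^esub> ?c) = \<one>\<^bsub>K\<^esub>"
    using c(2) K.field_Units K.Units_l_inv K.Units_inv_closed by auto
  have "?d \<odot>\<^bsub>E\<^esub> ((\<ominus>\<^bsub>K\<^esub> ?c) \<odot>\<^bsub>E\<^esub> fb ?j) \<in> E.V.span ?G" by (rule WD(4)[OF d(1) in_W])
  also have "?d \<odot>\<^bsub>E\<^esub> ((\<ominus>\<^bsub>K\<^esub> ?c) \<odot>\<^bsub>E\<^esub> fb ?j) = fb ?j"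
    using E.V.smult_assoc1[OF d(1) c(2) fb_closed[OF j]] d(2) fb_closed[OF j] by simp
  finally show False using minimal[OF j] by contradiction
qed

lemma admissible_I': "admissible K Q' I'"
  unfolding admissible_def
proof (intro conjI ballI allI impI)
  fix f p assume f: "f \<in> I'" and nz: "f p \<noteq> \<zero>\<^bsub>K\<^esub>"
  show "2 \<le> length (snd p)"
  proof (rule ccontr)
    assume short: "\<not> ?thesis"
    then have "\<not> set (snd p) \<subseteq> {..<m}"
      using kernel_old_coefficient[OF f, of p] nz by auto
    then obtain a where a: "snd p = [a]" "\<not> a < m"
      using short by (cases "snd p") (auto simp: Suc_le_eq)
    have "is_path Q' p" using f nz rep.is_path_support[of f p] by (simp add: I'_def)
    then have "a \<in> arcs Q'" "p = (tail Q' a, [a])"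
      using a by (cases p; simp add: rep.is_path_Cons)+
    then show False using kernel_new_coefficient[OF f] a nz by blast
  qed
next
  obtain L where L: "L > 1" "\<And>xs. \<lbrakk>length xs = L; set xs \<subseteq> rad\<rbrakk> \<Longrightarrow> list_prod E xs = \<zero>\<^bsub>E\<^esub>"
    using rad_nilpotent[OF nilpotent] by blast
  have "rep.pe p \<in> I'" if p: "is_path Q' p" "length (snd p) = L" for p
  proof -
    have "set (map eA (snd p)) \<subseteq> rad" using rep.path_arcs[OF p(1)] eA_rad by auto
    then have "list_prod E (map eA (snd p)) = \<zero>\<^bsub>E\<^esub>" using L(2) p(2) by simp
    then have "rep.ev p = \<zero>\<^bsub>E\<^esub>"
      using rep.eV_closed[OF rep.fst_in_verts[OF p(1)]] by (simp add: rep.ev_def)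
    then show ?thesis using p by (simp add: I'_def rep.\<phi>_pe rep.pe_closed)
  qed
  then show "\<exists>N>1. \<forall>p. is_path Q' p \<and> length (snd p) = N \<longrightarrow> path_elt K p \<in> I'"
    using L(1) by blast
qed

lemma bound_quiver_Q': "bound_quiver K Q' I'"
  by (simp add: bound_quiver_def field_K fin_digraph_Q' ideal_I' admissible_I')

section \<open>Surjectivity onto the split extension\<close>

abbreviation "\<Phi> \<equiv> rep.\<phi> ` carrier rep.kQ"

lemma \<phi>_image_subspace: "submodule K \<Phi> E"
proof (rule E.subspaceI)
  show "\<Phi> \<subseteq> carrier E" by (rule image_subsetI) (rule rep.\<phi>_closed)
  show "\<zero>\<^bsub>E\<^esub> \<in> \<Phi>"
    using imageI[OF rep.zero_closed, of rep.\<phi>] unfolding rep.\<phi>_zero .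
next
  fix x y assume x: "x \<in> \<Phi>" and "y \<in> \<Phi>"
  then obtain f g where fg: "f \<in> carrier rep.kQ" "x = rep.\<phi> f" "g \<in> carrier rep.kQ" "y = rep.\<phi> g"
    by (elim imageE)
  show "x \<oplus>\<^bsub>E\<^esub> y \<in> \<Phi>"
    unfolding fg(2,4) rep.\<phi>_add[OF fg(1,3), symmetric] by (intro imageI rep.add_closed fg)
next
  fix a x assume a: "a \<in> carrier K" and "x \<in> \<Phi>"
  then obtain f where f: "f \<in> carrier rep.kQ" "x = rep.\<phi> f" by (elim imageE)
  show "a \<odot>\<^bsub>E\<^esub> x \<in> \<Phi>"
    unfolding f(2) rep.\<phi>_smult[OF a f(1), symmetric] by (intro imageI rep.smult_closed a f)
qed

text \<open>A path of \<open>Q\<close>, renumbered by \<open>gv\<close> and \<open>ga\<close>, is a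
  path of \<open>Q'\<close> along old arrows, and \<open>old_path\<close> evaluates it to the class
  of the original path.\<close>

lemma \<sigma>_in_image:
  assumes "f \<in> carrier kQ"
  shows "\<sigma> f \<in> \<Phi>"
  using assms
proof (induction f rule: path_induct)
  case zero
  then show ?case using E.subspaceD(2)[OF \<phi>_image_subspace] by (simp add: \<sigma>_zero)
next
  case (add a p g)
  obtain v es where p: "p = (v, es)" by force
  have v: "v \<in> verts Q" and es: "set es \<subseteq> arcs Q"
    using fst_in_verts[OF add(2)] path_arcs[OF add(2)] p by auto
  have p': "is_path Q' (gv v, map ga es)"
    using relabelled_path add(2) p by simp
  have "map fa (map ga es) = es"
    using es fa_ga by (simp add: map_idI subset_iff)
  moreover have "set (map ga es) \<subseteq> {..<m}" using es ga_less by auto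
  ultimately have "rep.ev (gv v, map ga es) = \<sigma> (pe p)"
    using old_path[OF p'] v p by (simp add: fv_gv)
  then have "\<sigma> (pe p) \<in> \<Phi>"
    using imageI[OF rep.pe_closed[OF p'], of rep.\<phi>] unfolding rep.\<phi>_pe[OF p'] by simp
  then show ?case
    using add E.subspaceD(3,4)[OF \<phi>_image_subspace]
    by (simp add: \<sigma>_hom smult_closed pe_closed)
qed

lemma E_decompose:
  assumes "x \<in> carrier E" "f \<in> carrier kQ" "fst x = cls f"
  obtains \<mu> where "\<mu> \<in> carrier M" "x = \<sigma> f \<oplus>\<^bsub>E\<^esub> \<iota> \<mu>"
proof -
  obtain \<mu> where \<mu>: "\<mu> \<in> carrier M" "x = (cls f, \<mu>)"
    using assms by (cases x) (auto simp: E_carrier)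
  then have "x = \<sigma> f \<oplus>\<^bsub>E\<^esub> \<iota> \<mu>"
    using cls_hom(1)[OF assms(2)] by (simp add: \<sigma>_def \<iota>_def E_add)
  with \<mu>(1) show ?thesis by (rule that)
qed

text \<open>The part of the image that lies in R is closed under products and generates R modulo
  R^2: it contains the \<Gamma> part of R and all \<open>fb j\<close>. As R is nilpotent, R lies in
  the image, and E is the sum of the image of \<open>\<sigma>\<close> and of M, which is inside
  R.\<close>

lemma \<phi>_surj: "\<Phi> = carrier E"
proof
  show "\<Phi> \<subseteq> carrier E" using rep.\<phi>_closed by blast
  note SD = E.subspaceD[OF \<phi>_image_subspace]
  obtain L where L: "L > 1" "\<And>xs. \<lbrakk>length xs = L; set xs \<subseteq> rad\<rbrakk> \<Longrightarrow> list_prod E xs = \<zero>\<^bsub>E\<^esub>"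
    using rad_nilpotent[OF nilpotent] by blast
  let ?T = "\<Phi> \<inter> rad"
  have TE: "?T \<union> rad2 \<subseteq> carrier E" using rad_carrier rad2_carrier by blast
  note sub = E.span_subspace[OF TE]
  have fb: "fb j \<in> ?T" if j: "j < l" for j
  proof -
    have a: "m + j \<in> arcs Q'" using j by (simp add: Q'_simps)
    have "fb j = rep.\<phi> (rep.pe (tail Q' (m + j), [m + j]))"
      using a by (simp add: rep.\<phi>_pe rep.arc_is_path rep.ev_arc eA_def)
    then have "fb j \<in> \<Phi>"
      using imageI[OF rep.pe_closed[OF rep.arc_is_path[OF a]], of rep.\<phi>] by simp
    moreover have "fb j \<in> rad" using eA_rad[OF a] by (simp add: eA_def)
    ultimately show ?thesis by (rule IntI)
  qed
  have gen: "rad \<subseteq> E.V.span (?T \<union> rad2)"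
  proof
    fix x assume x: "x \<in> rad"
    then obtain f where f: "f \<in> filt 1" "fst x = cls f" and xE: "x \<in> carrier E" by (auto simp: rad_def)
    obtain \<mu> where \<mu>: "\<mu> \<in> carrier M" and eq: "x = \<sigma> f \<oplus>\<^bsub>E\<^esub> \<iota> \<mu>"
      using xE filt_carrier[OF f(1)] f(2) by (rule E_decompose)
    have "\<sigma> f \<in> ?T" using \<sigma>_in_image[OF filt_carrier[OF f(1)]] \<sigma>_rad[OF f(1)] by blast
    then have 1: "\<sigma> f \<in> E.V.span (?T \<union> rad2)" by (intro E.span_superset[OF TE]) blast
    have "fb ` {..<l} \<union> rad2 \<subseteq> E.V.span (?T \<union> rad2)"
      using fb E.span_superset[OF TE] by blast
    then have "\<iota> ` carrier M \<subseteq> E.V.span (?T \<union> rad2)"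
      using E.span_least[OF sub] generating by (meson subset_trans)
    then have "\<iota> \<mu> \<in> E.V.span (?T \<union> rad2)" using \<mu> by blast
    then show "x \<in> E.V.span (?T \<union> rad2)"
      unfolding eq by (rule E.subspaceD(3)[OF sub 1])
  qed
  have mult: "x \<cdot> y \<in> ?T" if xy: "x \<in> ?T" "y \<in> ?T" for x y
  proof
    obtain f g where "f \<in> carrier rep.kQ" "x = rep.\<phi> f" "g \<in> carrier rep.kQ" "y = rep.\<phi> g"
      using xy by blast
    then show "x \<cdot> y \<in> \<Phi>"
      using rep.\<phi>_mult rep.mult_closed by (metis imageI)
    show "x \<cdot> y \<in> rad"
      using xy rad_carrier by (intro rad_mult_l) auto
  qed
  \<comment> \<open>For exponent \<open>L\<close> the second set contains at most zero, so the span
    lies inside the image.\<close>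
  have "rad \<subseteq> E.V.span (?T \<union> {list_prod E xs | xs. length xs = L \<and> set xs \<subseteq> rad})"
    using L(1) by (intro rad_subset_span_powers[OF _ mult gen]) auto
  also have "\<dots> \<subseteq> \<Phi>"
    using L(2) SD(2) by (intro E.span_least[OF \<phi>_image_subspace]) auto
  finally have rad: "rad \<subseteq> \<Phi>" .
  show "carrier E \<subseteq> \<Phi>"
  proof
    fix x assume x: "x \<in> carrier E"
    obtain f where f: "f \<in> carrier kQ" "fst x = cls f"
      using alg_homD(1)[OF fst_alg_hom x] by (rule B_carrierE)
    obtain \<mu> where \<mu>: "\<mu> \<in> carrier M" "x = \<sigma> f \<oplus>\<^bsub>E\<^esub> \<iota> \<mu>"
      using x f by (rule E_decompose)
    show "x \<in> \<Phi>"
      unfolding \<mu>(2) by (rule SD(3)[OF \<sigma>_in_image[OF f(1)] subsetD[OF rad \<iota>_rad[OF \<mu>(1)]]])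
  qed
qed

lemma iso_E: "alg_isomorphic K (bound_quiver_algebra K Q' I') E"
  unfolding bound_quiver_algebra_def[of K Q' I']
  by (rule rep.R.quot_lift_iso[OF ideal_I' rep.\<phi>_alg_hom E_assoc_algebra _ \<phi>_surj])
     (simp add: I'_def)

sublocale B': bound_quiver_alg K Q' I'
  by (rule bound_quiver_imp_alg[OF bound_quiver_Q'])

section \<open>The new arrows: pre-removability and the quotient\<close>

definition "A = {m..<m + l}"

lemma A_disjoint_iff:
  assumes "is_path Q' p"
  shows "set (snd p) \<inter> A = {} \<longleftrightarrow> set (snd p) \<subseteq> {..<m}"
proof -
  have "set (snd p) \<subseteq> {..<m} \<union> A" "{..<m} \<inter> A = {}"
    using rep.path_arcs[OF assms] by (auto simp: A_def Q'_simps)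
  then show ?thesis by blast
qed

lemma parts_closed:
  assumes z: "z \<in> carrier rep.kQ"
  shows "part_through K A z \<in> carrier rep.kQ" "part_avoiding K A z \<in> carrier rep.kQ"
proof -
  have "{p. part_through K A z p \<noteq> \<zero>\<^bsub>K\<^esub>} \<subseteq> {p. z p \<noteq> \<zero>\<^bsub>K\<^esub>}"
      "{p. part_avoiding K A z p \<noteq> \<zero>\<^bsub>K\<^esub>} \<subseteq> {p. z p \<noteq> \<zero>\<^bsub>K\<^esub>}"
    by (auto simp: part_through_def part_avoiding_def)
  note fin = this[THEN finite_subset, OF rep.finite_support[OF z]]
  show "part_through K A z \<in> carrier rep.kQ"
    using fin(1) z rep.is_path_support[OF z]
    by (intro rep.carrierI) (auto simp: part_through_def split: if_splits)
  show "part_avoiding K A z \<in> carrier rep.kQ"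
    using fin(2) z rep.is_path_support[OF z]
    by (intro rep.carrierI) (auto simp: part_avoiding_def split: if_splits)
qed

lemma parts_sum:
  assumes z: "z \<in> carrier rep.kQ"
  shows "z = part_through K A z \<oplus>\<^bsub>rep.kQ\<^esub> part_avoiding K A z"
proof
  fix p show "z p = (part_through K A z \<oplus>\<^bsub>rep.kQ\<^esub> part_avoiding K A z) p"
    using z by (simp add: rep.add_apply part_through_def part_avoiding_def)
qed

lemma fst_\<phi>_eq_zero:
  assumes f: "f \<in> carrier rep.kQ" and A: "\<And>p. f p \<noteq> \<zero>\<^bsub>K\<^esub> \<Longrightarrow> set (snd p) \<inter> A \<noteq> {}"
  shows "fst (rep.\<phi> f) = \<zero>\<^bsub>B\<^esub>"
  using f
proof (induction f rule: rep.path_induct)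
  case zero
  show ?case unfolding rep.\<phi>_zero by (simp add: E_zero)
next
  case (add a p g)
  have "fst (rep.ev p) = \<zero>\<^bsub>B\<^esub>"
    using A[OF add(3)] A_disjoint_iff[OF add(2)] new_path[of "fst p" "snd p"] add(2) \<iota>_image_iff by simp
  then show ?case
    using add alg_homD[OF fst_alg_hom] rep.ev_closed[OF add(2)] rep.\<phi>_closed
    by (simp add: rep.\<phi>_combination)
qed

lemma snd_\<phi>_eq_zero:
  assumes f: "f \<in> carrier rep.kQ" and A: "\<And>p. f p \<noteq> \<zero>\<^bsub>K\<^esub> \<Longrightarrow> set (snd p) \<inter> A = {}"
  shows "snd (rep.\<phi> f) = \<zero>\<^bsub>M\<^esub>"
  using f
proof (induction f rule: rep.path_induct)
  case zero
  show ?case unfolding rep.\<phi>_zero by (simp add: E_zero)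
next
  case (add a p g)
  have "snd (rep.ev p) = \<zero>\<^bsub>M\<^esub>"
    using A[OF add(3)] A_disjoint_iff[OF add(2)] old_path[of "fst p" "snd p"] add(2) by (simp add: \<sigma>_def)
  then show ?case
    using add
    by (cases "rep.ev p"; cases "rep.\<phi> g")
       (simp add: rep.\<phi>_combination E_smult E_add)
qed

lemma \<phi>_through: "z \<in> carrier rep.kQ \<Longrightarrow> fst (rep.\<phi> (part_through K A z)) = \<zero>\<^bsub>B\<^esub>"
  by (rule fst_\<phi>_eq_zero[OF parts_closed(1)]) (auto simp: part_through_def split: if_splits)

lemma \<phi>_avoiding: "z \<in> carrier rep.kQ \<Longrightarrow> snd (rep.\<phi> (part_avoiding K A z)) = \<zero>\<^bsub>M\<^esub>"
  by (rule snd_\<phi>_eq_zero[OF parts_closed(2)]) (auto simp: part_avoiding_def split: if_splits)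

text \<open>The part through \<open>A\<close> is mapped into M and the other part into \<Gamma>, so
  the \<Gamma> component of the image of \<open>z\<close> comes from the second part alone. Only
  this component is assumed to vanish, rather than the whole image, so that the lemma also serves to
  compute the kernel of \<open>\<psi>\<close>.\<close>

lemma avoiding_in_I':
  assumes z: "z \<in> carrier rep.kQ" and fst0: "fst (rep.\<phi> z) = \<zero>\<^bsub>B\<^esub>"
  shows "part_avoiding K A z \<in> I'"
proof -
  let ?t = "part_through K A z" and ?a = "part_avoiding K A z"
  have cl: "rep.\<phi> ?t \<in> carrier E" "rep.\<phi> ?a \<in> carrier E"
    using parts_closed[OF z] rep.\<phi>_closed by blast+
  have "rep.\<phi> z = rep.\<phi> ?t \<oplus>\<^bsub>E\<^esub> rep.\<phi> ?a"
    using rep.\<phi>_add[OF parts_closed[OF z]] parts_sum[OF z] by simp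
  then have "fst (rep.\<phi> ?t) \<oplus>\<^bsub>B\<^esub> fst (rep.\<phi> ?a) = \<zero>\<^bsub>B\<^esub>"
    using alg_homD(3)[OF fst_alg_hom cl] fst0 by simp
  then have "fst (rep.\<phi> ?a) = \<zero>\<^bsub>B\<^esub>"
    using \<phi>_through[OF z] alg_homD(1)[OF fst_alg_hom cl(2)] by simp
  then have "rep.\<phi> ?a = \<zero>\<^bsub>E\<^esub>"
    using \<phi>_avoiding[OF z] by (cases "rep.\<phi> ?a") (simp add: E_zero)
  then show ?thesis
    by (rule I'I[OF parts_closed(2)[OF z]])
qed

lemma pre_removable_A: "pre_removable K Q' I' A"
  unfolding pre_removable_def
proof (intro conjI ballI)
  show "A \<subseteq> arcs Q'" unfolding A_def Q'_simps(2) by (rule subsetI) simp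
  fix z assume "z \<in> I'"
  note z = I'D[OF this]
  have "fst (rep.\<phi> z) = \<zero>\<^bsub>B\<^esub>" unfolding z(2) by (simp add: E_zero)
  then show a: "part_avoiding K A z \<in> I'" by (rule avoiding_in_I'[OF z(1)])
  have "rep.\<phi> z = rep.\<phi> (part_through K A z) \<oplus>\<^bsub>E\<^esub> rep.\<phi> (part_avoiding K A z)"
    using rep.\<phi>_add[OF parts_closed[OF z(1)]] parts_sum[OF z(1)] by simp
  moreover have "rep.\<phi> (part_avoiding K A z) = \<zero>\<^bsub>E\<^esub>"
    by (rule I'D(2)[OF a])
  ultimately have "rep.\<phi> (part_through K A z) = \<zero>\<^bsub>E\<^esub>"
    using z(2) E.r_zero[OF rep.\<phi>_closed[OF parts_closed(1)[OF z(1)]]] by argo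
  then show "part_through K A z \<in> I'"
    by (rule I'I[OF parts_closed(1)[OF z(1)]])
qed

text \<open>The isomorphism from the new bound quiver algebra to E induced by \<open>\<phi>\<close>,
  followed by the projection to \<Gamma>. Its kernel is the copy of M.\<close>

definition "\<psi> X = fst (the_elem (rep.\<phi> ` X))"

lemma \<psi>_cls: "f \<in> carrier rep.kQ \<Longrightarrow> \<psi> (B'.cls f) = fst (rep.\<phi> f)"
  unfolding \<psi>_def
  by (simp only: rep.R.quot_lift_apply[OF ideal_I' rep.\<phi>_alg_hom E_assoc_algebra I'D(2)])

lemma \<psi>_alg_hom: "\<psi> \<in> alg_hom K B'.B B"
  unfolding \<psi>_def bound_quiver_algebra_def[of K Q' I']
  by (rule alg_hom_comp[OF rep.R.quot_lift_alg_hom[OF ideal_I' rep.\<phi>_alg_hom E_assoc_algebra I'D(2)] fst_alg_hom])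

lemma \<psi>_surj: "\<psi> ` carrier B'.B = carrier B"
proof
  show "\<psi> ` carrier B'.B \<subseteq> carrier B" using alg_homD(1)[OF \<psi>_alg_hom] by blast
  show "carrier B \<subseteq> \<psi> ` carrier B'.B"
  proof
    fix X assume "X \<in> carrier B"
    then have "(X, \<zero>\<^bsub>M\<^esub>) \<in> \<Phi>" unfolding \<phi>_surj by (simp add: E_carrier)
    then obtain f where f: "f \<in> carrier rep.kQ" "rep.\<phi> f = (X, \<zero>\<^bsub>M\<^esub>)" by force
    then have "X = \<psi> (B'.cls f)" by (simp add: \<psi>_cls)
    then show "X \<in> \<psi> ` carrier B'.B" using B'.cls_hom(1)[OF f(1)] by blast
  qed
qed

text \<open>New arrows go to M, so \<open>\<psi>\<close> kills the ideal they generate. Conversely,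
  an element of the kernel is represented by its part through \<open>A\<close>, a combination of
  paths each of which factors through a new arrow.\<close>

lemma arrow_ideal_eq_kernel: "arrow_ideal K Q' I' A = {X \<in> carrier B'.B. \<psi> X = \<zero>\<^bsub>B\<^esub>}"
proof
  interpret BB: k_algebra K B'.B using B'.B_assoc by unfold_locales
  let ?gens = "(\<lambda>a. B'.cls (rep.pe (tail Q' a, [a]))) ` A"
  let ?J = "genideal B'.B ?gens"
  have A: "a \<in> arcs Q'" if "a \<in> A" for a using that by (auto simp: A_def Q'_simps)
  have gens: "?gens \<subseteq> carrier B'.B"
    using A rep.pe_closed[OF rep.arc_is_path] B'.cls_hom(1) by blast
  have AI: "arrow_ideal K Q' I' A = ?J" by (simp add: arrow_ideal_def)
  note ideal = BB.genideal_ideal[OF gens]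
  interpret J: ideal "?J" B'.B by (rule ideal)
  show "arrow_ideal K Q' I' A \<subseteq> {X \<in> carrier B'.B. \<psi> X = \<zero>\<^bsub>B\<^esub>}"
    unfolding AI
  proof (rule BB.genideal_minimal)
    show "ideal {X \<in> carrier B'.B. \<psi> X = \<zero>\<^bsub>B\<^esub>} B'.B"
      by (rule BB.kernel_ideal[OF \<psi>_alg_hom B_assoc])
    show "?gens \<subseteq> {X \<in> carrier B'.B. \<psi> X = \<zero>\<^bsub>B\<^esub>}"
    proof
      fix X assume X: "X \<in> ?gens"
      then obtain a where a: "a \<in> A" "X = B'.cls (rep.pe (tail Q' a, [a]))" by blast
      have p: "is_path Q' (tail Q' a, [a])" by (rule rep.arc_is_path[OF A[OF a(1)]])
      have "rep.ev (tail Q' a, [a]) \<in> \<iota> ` carrier M"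
        using a(1) by (intro new_path[OF p]) (simp add: A_def)
      then have "\<psi> X = \<zero>\<^bsub>B\<^esub>"
        using a p \<iota>_image_iff by (simp add: \<psi>_cls rep.pe_closed rep.\<phi>_pe)
      then show "X \<in> {X \<in> carrier B'.B. \<psi> X = \<zero>\<^bsub>B\<^esub>}" using gens X by blast
    qed
  qed
  have pe: "B'.cls (rep.pe p) \<in> ?J" if p: "is_path Q' p" "set (snd p) \<inter> A \<noteq> {}" for p
  proof -
    obtain a where a: "a \<in> set (snd p)" "a \<in> A" using p(2) by blast
    then obtain i xs ys where "p = (i, xs @ a # ys)"
      by (cases p) (auto dest: split_list)
    \<comment> \<open>Cutting the path around one new arrow exhibits it as a two-sided multiple of
      that arrow.\<close>
    then have p_eq: "p = (i, xs @ [a] @ ys)" by simp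
    then have "is_path Q' (i, xs)" "is_path Q' (rep.path_end (i, xs), [a] @ ys)"
      using p(1) rep.is_path_append by auto
    then have paths: "is_path Q' (i, xs)" "rep.path_end (i, xs) = tail Q' a"
        "is_path Q' (tail Q' a, [a])" "is_path Q' (head Q' a, ys)" "is_path Q' (tail Q' a, a # ys)"
      using rep.arc_is_path[OF A[OF a(2)]] by (auto simp: rep.is_path_Cons)
    have "rep.pe p = rep.pe (i, xs) \<otimes>\<^bsub>rep.kQ\<^esub> (rep.pe (tail Q' a, [a]) \<otimes>\<^bsub>rep.kQ\<^esub> rep.pe (head Q' a, ys))"
      using paths p_eq by (simp add: rep.pe_mult)
    then have eq: "B'.cls (rep.pe p) = B'.cls (rep.pe (i, xs)) \<otimes>\<^bsub>B'.B\<^esub>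
        (B'.cls (rep.pe (tail Q' a, [a])) \<otimes>\<^bsub>B'.B\<^esub> B'.cls (rep.pe (head Q' a, ys)))"
      using paths by (simp add: B'.cls_hom rep.pe_closed rep.mult_closed)
    have "B'.cls (rep.pe (tail Q' a, [a])) \<in> ?J"
      using BB.genideal_self[OF gens] a(2) by blast
    then show ?thesis
      unfolding eq by (intro J.I_l_closed J.I_r_closed B'.cls_hom(1) rep.pe_closed paths)
  qed
  show "{X \<in> carrier B'.B. \<psi> X = \<zero>\<^bsub>B\<^esub>} \<subseteq> arrow_ideal K Q' I' A"
    unfolding AI
  proof
    fix X assume "X \<in> {X \<in> carrier B'.B. \<psi> X = \<zero>\<^bsub>B\<^esub>}"
    then have X: "X \<in> carrier B'.B" "\<psi> X = \<zero>\<^bsub>B\<^esub>" by blast+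
    obtain z where z: "z \<in> carrier rep.kQ" "X = B'.cls z" using X(1) by (rule B'.B_carrierE)
    \<comment> \<open>Here \<open>z\<close> itself need not lie in \<open>I'\<close>; the vanishing
      of \<open>\<psi> X\<close> gives just the hypothesis on the \<Gamma> component.\<close>
    have "part_avoiding K A z \<in> I'"
      using z X(2) by (intro avoiding_in_I') (simp_all add: \<psi>_cls)
    then have "B'.cls (part_avoiding K A z) = \<zero>\<^bsub>B'.B\<^esub>"
      using B'.cls_eq_zero_iff[OF parts_closed(2)[OF z(1)]] by blast
    moreover have "B'.cls z = B'.cls (part_through K A z) \<oplus>\<^bsub>B'.B\<^esub> B'.cls (part_avoiding K A z)"
      using B'.cls_hom(3)[OF parts_closed[OF z(1)]] parts_sum[OF z(1)] by simp
    ultimately have "X = B'.cls (part_through K A z)"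
      using z B'.cls_hom(1)[OF parts_closed(1)[OF z(1)]] by simp
    moreover have "B'.cls f \<in> ?J"
      if f: "f \<in> carrier rep.kQ" and f_A: "\<And>p. f p \<noteq> \<zero>\<^bsub>K\<^esub> \<Longrightarrow> set (snd p) \<inter> A \<noteq> {}" for f
      using f
    proof (induction f rule: rep.path_induct)
      case zero
      show ?case using J.zero_closed unfolding B'.cls_zero .
    next
      case (add c p g)
      then have "B'.cls (rep.pe p) \<in> ?J" using pe f_A by blast
      then show ?case
        using add BB.ideal_smult_closed[OF ideal]
        by (simp add: B'.cls_hom rep.smult_closed rep.pe_closed)
    qed
    moreover have "set (snd p) \<inter> A \<noteq> {}" if "part_through K A z p \<noteq> \<zero>\<^bsub>K\<^esub>" for p
      using that by (auto simp: part_through_def split: if_splits)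
    ultimately have "X \<in> ?J"
      using parts_closed(1)[OF z(1)] by blast
    then show "X \<in> ?J" .
  qed
qed

lemma iso_quotient: "alg_isomorphic K B (quot_algebra B'.B (arrow_ideal K Q' I' A))"
proof -
  interpret BB: k_algebra K B'.B using B'.B_assoc by unfold_locales
  have ideal: "ideal (arrow_ideal K Q' I' A) B'.B"
    unfolding arrow_ideal_eq_kernel by (rule BB.kernel_ideal[OF \<psi>_alg_hom B_assoc])
  show ?thesis
    by (rule alg_isomorphic_sym[OF BB.quot_assoc_algebra[OF ideal]
          BB.quot_lift_iso[OF ideal \<psi>_alg_hom B_assoc _ \<psi>_surj]])
       (simp add: arrow_ideal_eq_kernel)
qed

text \<open>Obtained through the isomorphism with the new bound quiver algebra, where the bounded
  length of paths gives finite dimension.\<close>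

lemma fin_dim_E: "fin_dim_algebra K E"
proof -
  obtain h where h: "h \<in> alg_hom K B'.B E" "bij_betw h (carrier B'.B) (carrier E)"
    using iso_E unfolding alg_isomorphic_iff by blast
  have "vectorspace.fin_dim K E"
    by (rule alg_hom_fin_dim[OF h(1) B'.B_assoc E_assoc_algebra _ B'.fin_dim_B])
       (use h(2) in \<open>simp add: bij_betw_def\<close>)
  then show ?thesis using E_assoc_algebra by (simp add: fin_dim_algebra_def)
qed

lemma arrow_pre_removal: "arrow_pre_removal_algebra K B E"
  unfolding arrow_pre_removal_algebra_def
  using fin_dim_algebra_B fin_dim_E bound_quiver_Q' iso_E pre_removable_A iso_quotient by blast

lemma card_verts_Q': "card (verts Q') = card (verts Q)"
  by (simp only: Q'_simps bij_betw_same_card[OF bij_v])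

end

context bound_quiver_bimodule
begin

lemma bound_quiver_algebra_if_nilpotent:
  assumes nilp: "nilpotent_bimodule B M \<theta>"
  shows "\<exists>(Q' :: nat_quiver) I'. bound_quiver K Q' I' \<and> card (verts Q') = card (verts Q) \<and>
      alg_isomorphic K E (bound_quiver_algebra K Q' I')"
    and "arrow_pre_removal_algebra K B E"
proof -
  obtain G where G: "finite G" "G \<subseteq> \<iota> ` carrier M"
      and G_ends: "\<And>b. b \<in> G \<Longrightarrow> \<exists>u\<in>verts Q. \<exists>v\<in>verts Q. idm u \<cdot> b = b \<and> b \<cdot> idm v = b"
      and gen: "\<iota> ` carrier M \<subseteq> E.V.span (G \<union> rad2)"
      and min: "\<And>b. b \<in> G \<Longrightarrow> b \<notin> E.V.span (G - {b} \<union> rad2)"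
    by (rule minimal_generators) blast
  obtain tb hb where th: "\<And>b. b \<in> G \<Longrightarrow> tb b \<in> verts Q \<and> hb b \<in> verts Q \<and>
      idm (tb b) \<cdot> b = b \<and> b \<cdot> idm (hb b) = b"
    using G_ends by metis
  \<comment> \<open>Any numberings will do: the old vertices and arrows and the generators are
    finite sets, and only the initial segments of the natural numbers that enumerate them enter the
    construction.\<close>
  obtain fv where fv: "bij_betw fv {..<card (verts Q)} (verts Q)"
    using ex_bij_betw_nat_finite[OF Q.finite_verts] by (auto simp: lessThan_atLeast0)
  obtain fa where fa: "bij_betw fa {..<card (arcs Q)} (arcs Q)"
    using ex_bij_betw_nat_finite[OF Q.finite_arcs] by (auto simp: lessThan_atLeast0)
  obtain fb where fb: "bij_betw fb {..<card G} G"
    using ex_bij_betw_nat_finite[OF G(1)] by (auto simp: lessThan_atLeast0)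
  have fb_G: "fb ` {..<card G} = G" "\<And>j. j < card G \<Longrightarrow> fb j \<in> G" "inj_on fb {..<card G}"
    using fb by (auto simp: bij_betw_def)
  interpret X: ext_quiver K Q I M \<theta> fv fa fb "\<lambda>j. tb (fb j)" "\<lambda>j. hb (fb j)"
      "card (verts Q)" "card (arcs Q)" "card G"
  proof (intro ext_quiver.intro ext_quiver_axioms.intro)
    show "bound_quiver_bimodule K Q I M \<theta>" by (rule bound_quiver_bimodule_axioms)
  qed (use fv fa fb_G th gen min nilp G(2) in auto)
  show "\<exists>(Q' :: nat_quiver) I'. bound_quiver K Q' I' \<and> card (verts Q') = card (verts Q) \<and>
      alg_isomorphic K E (bound_quiver_algebra K Q' I')"
    using X.bound_quiver_Q' X.card_verts_Q' alg_isomorphic_sym[OF X.B'.B_assoc X.iso_E] by blast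
  show "arrow_pre_removal_algebra K B E" by (rule X.arrow_pre_removal)
qed

end

theorem lemma5p2:
  fixes K :: "('k, 'c) ring_scheme"
    and Q :: "('v, 'e) pre_digraph"
    and I :: "('v \<times> 'e list \<Rightarrow> 'k) set"
    and \<Gamma> :: "('k, ('v \<times> 'e list \<Rightarrow> 'k) set) module"
    and M :: "(('v \<times> 'e list \<Rightarrow> 'k) set, 'm, 'd) bimodule_scheme"
    and \<theta> :: "'m tensor_fun"
    and E :: "('k, ('v \<times> 'e list \<Rightarrow> 'k) set \<times> 'm) module"
  assumes "bound_quiver K Q I"
    and "\<Gamma> = bound_quiver_algebra K Q I"
    and "multiplicative_bimodule K \<Gamma> M \<theta>"
    and "E = split_extension \<Gamma> M \<theta>"
  shows "((\<exists>(Q' :: nat_quiver) I'.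
             bound_quiver K Q' I' \<and> card (verts Q') = card (verts Q) \<and>
             alg_isomorphic K E (bound_quiver_algebra K Q' I'))
          \<longleftrightarrow> nilpotent_bimodule \<Gamma> M \<theta>) \<and>
         (nilpotent_bimodule \<Gamma> M \<theta> \<longrightarrow> arrow_pre_removal_algebra K \<Gamma> E)"
proof -
  interpret BQ: bound_quiver_alg K Q I by (rule bound_quiver_imp_alg[OF assms(1)])
  interpret bound_quiver_bimodule K Q I M \<theta>
    using assms(2,3) BQ.bound_quiver_alg_axioms BQ.B_assoc
    by (intro bound_quiver_bimodule.intro mult_bimod.intro k_algebra.intro bimod.intro mult_bimod_axioms.intro)
       (auto simp: multiplicative_bimodule_def)
  show ?thesis
    unfolding assms(2,4)
    using nilpotent_if_bound_quiver_algebra bound_quiver_algebra_if_nilpotent by blast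
qed

end
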